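(* Let $k$ be a given even natural number. There is a constant $c_k>0$ such that for all sufficiently large $X$, $$\sum_{\substack{d \text{ fundamental discriminant}\\ |d|\le X}} L(\tfrac12,\chi_d)^k \;\ge\; c_k\, X(\log X)^{k(k+1)/2}.$$
   Context: For a fundamental discriminant $d$, $\chi_d$ denotes the real primitive Dirichlet character of conductor $|d|$ attached to $d$ (the Kronecker symbol $(\frac{d}{\cdot})$), and $L(s,\chi_d)=\sum_{n\ge1}\chi_d(n)n^{-s}$ is its Dirichlet $L$-function (analytically continued), so $L(\tfrac12,\chi_d)$ is real. The sum runs over all (positive and negative) fundamental discriminants $d$ with $|d|\le X$. *)

theory Defs
  imports "HOL-Complex_Analysis.Complex_Analysis" "HOL-Number_Theory.Number_Theory"
    "HOL-Computational_Algebra.Squarefree"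
begin

text \<open>
  As usual, \<open>d = 1\<close> counts as a fundamental discriminant (of the trivial character, whose
  L-function is the Riemann zeta function). Note that \<open>d mod 4\<close> is non-negative for negative
  \<open>d\<close> and that \<open>0\<close> is not squarefree.
\<close>
definition fundamental_discriminant :: "int \<Rightarrow> bool" where
  "fundamental_discriminant d \<longleftrightarrow>
     (d mod 4 = 1 \<and> squarefree d) \<or>
     (\<exists>m. d = 4 * m \<and> (m mod 4 = 2 \<or> m mod 4 = 3) \<and> squarefree m)"

text \<open>
  The prime 2 needs a separate clause because \<^term>\<open>Legendre d 2\<close> is \<open>1\<close> for every odd \<open>d\<close>.
\<close>
definition kronecker_prime :: "int \<Rightarrow> nat \<Rightarrow> int" where
  "kronecker_prime d p =
     (if p = 2 then (if even d then 0 else if d mod 8 = 1 \<or> d mod 8 = 7 then 1 else -1)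
      else Legendre d (int p))"

definition kronecker :: "int \<Rightarrow> nat \<Rightarrow> int" where
  "kronecker d n =
     (if n = 0 then (if \<bar>d\<bar> = 1 then 1 else 0)
      else (\<Prod>p\<in>prime_factors n. kronecker_prime d p ^ multiplicity p n))"

text \<open>
  Analytic continuation of the Dirichlet series with coefficients \<open>a 1, a 2, \<dots>\<close>: the value
  at \<open>s\<close> of a function \<open>f\<close> that equals the series for \<open>Re w > 1\<close> and is holomorphic in some
  half-plane containing \<open>s\<close>, except
  possibly for a singularity at \<open>1\<close>, which is only permitted if \<open>s \<noteq> 1\<close>. Half-planes are nested
  and remain connected when a point is removed, so the value depends neither on \<open>f\<close> nor on the
  half-plane (lemma \<open>dirichlet_L_eqI\<close>), and it agrees with that of a continuation to all of
  \<open>\<complex> - {1}\<close>.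
\<close>
definition dirichlet_L_continuation ::
    "(nat \<Rightarrow> complex) \<Rightarrow> real \<Rightarrow> complex \<Rightarrow> (complex \<Rightarrow> complex) \<Rightarrow> bool" where
  "dirichlet_L_continuation a c s f \<longleftrightarrow>
     c < Re s \<and>
     f holomorphic_on insert s ({w. c < Re w} - {1}) \<and>
     (\<forall>w. Re w > 1 \<longrightarrow> (\<lambda>n. a (Suc n) / of_nat (Suc n) powr w) sums f w)"

definition dirichlet_L :: "(nat \<Rightarrow> complex) \<Rightarrow> complex \<Rightarrow> complex" where
  "dirichlet_L a s = (THE z. \<exists>c f. dirichlet_L_continuation a c s f \<and> z = f s)"

lemma dirichlet_L_continuation_unique:
  assumes f: "dirichlet_L_continuation a c s f" and g: "dirichlet_L_continuation a c' s g"
  shows "f s = g s"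
proof -
  define b where "b = max c c'"
  define H where "H = {w::complex. b < Re w}"
  define U where "U = insert s (H - {1})"
  define V where "V = {w::complex. max 1 b < Re w}"
  have s: "s \<in> H"
    using f g by (auto simp: dirichlet_L_continuation_def H_def b_def)
  have opH: "open H" unfolding H_def by (rule open_halfspace_Re_gt)
  have coH: "connected H"
    unfolding H_def by (intro convex_connected convex_halfspace_Re_gt)
  have U: "U = H \<or> U = H - {1}"
    using s by (auto simp: U_def)
  have opU: "open U" using U opH by auto
  have coU: "connected U"
    using U coH connected_open_delete[OF opH coH, of 1] by auto
  have opV: "open V" unfolding V_def by (rule open_halfspace_Re_gt)
  have VU: "V \<subseteq> U" by (auto simp: V_def U_def H_def)
  have "complex_of_real (max 1 b + 1) \<in> V" by (auto simp: V_def)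
  hence V0: "V \<noteq> {}" by auto
  have "f holomorphic_on U"
    using f unfolding dirichlet_L_continuation_def
    by (auto simp: U_def H_def b_def elim!: holomorphic_on_subset)
  moreover have "g holomorphic_on U"
    using g unfolding dirichlet_L_continuation_def
    by (auto simp: U_def H_def b_def elim!: holomorphic_on_subset)
  moreover have "f w = g w" if "w \<in> V" for w
    using f g that sums_unique2
    unfolding dirichlet_L_continuation_def V_def by fastforce
  ultimately show ?thesis
    using analytic_continuation_open[OF opV opU V0 coU VU, of f g s]
    by (simp add: U_def)
qed

lemma dirichlet_L_eqI:
  assumes "dirichlet_L_continuation a c s f"
  shows "dirichlet_L a s = f s"
  unfolding dirichlet_L_def
  by (rule the_equality) (use assms dirichlet_L_continuation_unique in blast)+

text \<open>
  The values at real \<open>s\<close> are real, but \<^const>\<open>dirichlet_L\<close> is complex-valued, so they enter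
  real inequalities through \<^const>\<open>Re\<close>.
\<close>
abbreviation L_kronecker :: "int \<Rightarrow> complex \<Rightarrow> complex" where
  "L_kronecker d \<equiv> dirichlet_L (\<lambda>n. of_int (kronecker d n))"

end

theory Submission
  imports Defs
begin

text \<open>
  The argument of Rudnick and Soundararajan, restricted to the squarefree \<open>d \<equiv> 1 (mod 8)\<close> with
  \<open>X / 2 < d \<le> X\<close>; as \<open>k\<close> is even, the remaining terms are non-negative. Let \<open>A(d)\<close> be the sum of
  \<open>\<chi>\<^sub>d(n) / sqrt n\<close> over the \<open>n \<le> X powr (1 / (40 k))\<close> without small prime factors. By
  Bernoulli's inequality
  \<open>L\<^sup>k \<ge> k \<lambda>\<^bsup>k-1\<^esup> L A\<^bsup>k-1\<^esup> - (k-1) \<lambda>\<^sup>k A\<^sup>k\<close>,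
  so it suffices to bound the sum of \<open>L(1/2, \<chi>\<^sub>d) A(d)\<^bsup>k-1\<^esup>\<close> from below and that of \<open>A(d)\<^sup>k\<close> from above
  by multiples of \<open>X T\<close>, where \<open>T\<close> is the sum of \<open>(n\<^sub>1 \<cdots> n\<^sub>k)\<^bsup>-1/2\<^esup>\<close> over the \<open>k\<close>-tuples whose
  product is a square. Tuples of the form \<open>n\<^sub>i = v\<^sub>i\<^sub>i\<^sup>2 \<Prod>\<^bsub>j \<noteq> i\<^esub> v\<^sub>i\<^sub>j\<close>, with \<open>v\<^sub>i\<^sub>j = v\<^sub>j\<^sub>i\<close> pairwise coprime,
  show that \<open>T\<close> has order at least \<open>(log X)\<^bsup>k(k+1)/2\<^esup>\<close>. Excluding the small primes makes
  all coprimality conditions cost only constant factors.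

  For the first moment, \<open>sqrt \<pi> L(1/2, \<chi>)\<close> is the integral of \<open>t\<^bsup>-1/2\<^esup> \<Sum>\<chi>(n) exp(-n t)\<close>. For small \<open>t\<close>
  the inner sum is transformed by the partial fractions of the cotangent, which needs the Gauss sum of
  \<open>\<chi>\<^sub>d\<close> to be \<open>sqrt d\<close>, sign included. On either side the terms with \<open>n n\<^sub>1 \<cdots> n\<^bsub>k-1\<^esub>\<close> a square are
  non-negative, and the others are small on average over \<open>d\<close>, by the Polya--Vinogradov inequality and a
  sieve for the squarefree \<open>d\<close>.
\<close>

section \<open>Jacobi symbols\<close>

text \<open>No asymptotic formula is proved. A term whose total argument is a square is a
  non-negative number and may be dropped at will, so one-sided bounds suffice on both sides of the
  functional equation. This is why the sign of the Gauss sum matters: with the opposite sign the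
  dual square terms would be negative. The class 1 modulo 8 makes every character even and
  reciprocity free of signs.

  The exponents form one budget. Sums over the family to a non-square modulus l are at most of order
  X^(11/20) l^(1/4). Both kernels decay at least like m^(-13/10), and 13/10 - 1/4 = 21/20 > 1 lets
  the sum over m converge. Cutting the integral at t = X^(-1/2) balances the two errors at
  X^(19/20). The tuples cost a further factor X^(1/40), which leaves X^(39/40), below the main term
  X T because T is at least 1.

  The bound z below which primes are excluded depends on k alone. A prime p > z dividing two entries
  costs 1/p^2, and these costs sum to at most 1/z, so no Euler products have to be
  evaluated.\<close>

lemma Legendre_values: "Legendre a p \<in> {-1, 0, 1}"
  by (auto simp: Legendre_def)

lemma Legendre_cong:
  assumes "[a = b] (mod p)"
  shows "Legendre a p = Legendre b p"
proof -
  have "[a = 0] (mod p) \<longleftrightarrow> [b = 0] (mod p)"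
    using assms by (meson cong_sym cong_trans)
  moreover have "QuadRes p a \<longleftrightarrow> QuadRes p b"
    unfolding QuadRes_def using assms by (meson cong_sym cong_trans)
  ultimately show ?thesis by (simp add: Legendre_def)
qed

text \<open>Two such values differ by at most 2. This lifts Euler's criterion and congruences modulo
  4 to equations.\<close>

lemma small_cong_imp_eq:
  fixes x y :: int
  assumes "[x = y] (mod m)" "x \<in> {-1, 0, 1}" "y \<in> {-1, 0, 1}" "m > 2"
  shows "x = y"
proof -
  have "m dvd x - y" using assms(1) by (simp add: cong_iff_dvd_diff)
  moreover have "\<bar>x - y\<bar> < m" using assms by auto
  ultimately show ?thesis using dvd_imp_le_int[of "x - y" m] by (cases "x = y") auto
qed

lemma Legendre_2: "Legendre a 2 = (if even a then 0 else 1)"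
proof (cases "even a")
  case True
  thus ?thesis by (simp add: Legendre_def cong_0_iff)
next
  case False
  hence "[1\<^sup>2 = a] (mod 2)" by (simp add: cong_def odd_iff_mod_2_eq_one)
  hence "QuadRes 2 a" unfolding QuadRes_def by blast
  thus ?thesis using False by (simp add: Legendre_def cong_0_iff)
qed

text \<open>Euler's criterion is multiplicative modulo an odd prime; at 2 the symbol is the
  indicator of odd numbers, which is multiplicative as well.\<close>

lemma Legendre_mult:
  assumes "prime (p::nat)"
  shows "Legendre (a * b) (int p) = Legendre a (int p) * Legendre b (int p)"
proof (cases "p = 2")
  case True
  thus ?thesis by (simp add: Legendre_2)
next
  case False
  hence p: "p > 2" using assms prime_ge_2_nat[of p] by linarith
  have "[Legendre (a * b) (int p) = (a * b) ^ ((p - 1) div 2)] (mod (int p))"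
    by (rule euler_criterion[OF assms p])
  also have "(a * b) ^ ((p - 1) div 2) = a ^ ((p - 1) div 2) * b ^ ((p - 1) div 2)"
    by (simp add: power_mult_distrib)
  also have "[\<dots> = Legendre a (int p) * Legendre b (int p)] (mod (int p))"
    by (intro cong_mult cong_sym[OF euler_criterion[OF assms p]])
  finally have "[Legendre (a * b) (int p) = Legendre a (int p) * Legendre b (int p)] (mod (int p))" .
  thus ?thesis
    by (rule small_cong_imp_eq)
       (use p Legendre_values[of a p] Legendre_values[of b p] Legendre_values[of "a*b" p] in auto)
qed

text \<open>The classical symbol for odd \<open>n\<close>. A factor 2 of \<open>n\<close> only
  records the parity of \<open>a\<close>, and the empty product gives the value 1 at
  \<open>n = 0\<close>.\<close>

definition jacobi :: "int \<Rightarrow> nat \<Rightarrow> int" where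
  "jacobi a n = (\<Prod>p\<in>#prime_factorization n. Legendre a (int p))"

lemma prod_prime_factors_eq_prod_mset:
  fixes f :: "nat \<Rightarrow> 'a::comm_monoid_mult"
  shows "(\<Prod>p\<in>prime_factors n. f p ^ multiplicity p n) = (\<Prod>p\<in>#prime_factorization n. f p)"
proof -
  have "(\<Prod>p\<in>prime_factors n. f p ^ multiplicity p n) =
        (\<Prod>p\<in>prime_factors n. f p ^ count (prime_factorization n) p)"
    by (intro prod.cong refl) (auto simp: count_prime_factorization_prime dest: in_prime_factors_imp_prime)
  thus ?thesis by (simp add: image_prod_mset_multiplicity)
qed

lemma jacobi_1_right [simp]: "jacobi a (Suc 0) = 1" "jacobi a 1 = 1"
  by (simp_all add: jacobi_def)

lemma jacobi_0_right [simp]: "jacobi a 0 = 1"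
  by (simp add: jacobi_def)

lemma jacobi_prime: "prime p \<Longrightarrow> jacobi a p = Legendre a (int p)"
  by (simp add: jacobi_def prime_factorization_prime)

lemma jacobi_mult_right:
  "m > 0 \<Longrightarrow> n > 0 \<Longrightarrow> jacobi a (m * n) = jacobi a m * jacobi a n"
  by (simp add: jacobi_def prime_factorization_mult)

lemma jacobi_mult_left: "jacobi (a * b) n = jacobi a n * jacobi b n"
proof -
  have "jacobi (a * b) n = (\<Prod>p\<in>#prime_factorization n. Legendre a (int p) * Legendre b (int p))"
    unfolding jacobi_def
    by (intro arg_cong[where f = prod_mset] image_mset_cong Legendre_mult) auto
  thus ?thesis by (simp add: jacobi_def prod_mset.distrib)
qed

lemma jacobi_cong:
  assumes "[a = b] (mod int n)" "n > 0"
  shows "jacobi a n = jacobi b n"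
  unfolding jacobi_def
proof (intro arg_cong[where f = prod_mset] image_mset_cong Legendre_cong)
  fix p assume "p \<in># prime_factorization n"
  hence "int p dvd int n" by auto
  thus "[a = b] (mod int p)" using assms cong_dvd_modulus by blast
qed

lemma jacobi_values: "jacobi a n \<in> {-1, 0, 1}"
proof (induction n rule: prime_divisors_induct)
  case (unit x)
  thus ?case by simp
next
  case (factor p x)
  show ?case
  proof (cases "x = 0")
    case False
    hence "jacobi a (p * x) = Legendre a (int p) * jacobi a x"
      using factor prime_gt_0_nat by (subst jacobi_mult_right) (auto simp: jacobi_prime)
    thus ?thesis using factor Legendre_values[of a p] by auto
  qed simp
qed simp

lemma Legendre_eq_0_iff: "Legendre a p = 0 \<longleftrightarrow> p dvd a"
  by (simp add: Legendre_def cong_0_iff)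

lemma prime_common_divisor_int_nat:
  assumes "\<not> coprime a (int n)" "n > 0"
  shows "\<exists>p. prime p \<and> int p dvd a \<and> p dvd n"
proof -
  have "gcd a (int n) \<noteq> 1" using assms(1) gcd_eq_1_imp_coprime[of a "int n"] by (rule contrapos_nn)
  moreover have "gcd a (int n) > 0" using assms by simp
  ultimately have "\<not> gcd a (int n) dvd 1" "gcd a (int n) \<noteq> 0"
    using zdvd_imp_le[of "gcd a (int n)" 1] by linarith+
  then obtain q where q: "prime q" "q dvd gcd a (int n)" using prime_divisor_exists by blast
  define p where "p = nat q"
  have "q = int p" using q(1) by (simp add: p_def prime_ge_0_int)
  moreover have "q dvd a" "q dvd int n" using q(2) gcd_dvd1 gcd_dvd2 dvd_trans by blast+
  ultimately show ?thesis using q(1) by auto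
qed

lemma jacobi_eq_0_iff:
  assumes "n > 0"
  shows "jacobi a n = 0 \<longleftrightarrow> \<not> coprime a (int n)"
proof -
  have "jacobi a n = 0 \<longleftrightarrow> (\<exists>p. p \<in># prime_factorization n \<and> int p dvd a)"
    by (auto simp: jacobi_def prod_mset_zero_iff Legendre_eq_0_iff image_iff)
  also have "\<dots> \<longleftrightarrow> \<not> coprime a (int n)"
  proof
    assume "\<exists>p. p \<in># prime_factorization n \<and> int p dvd a"
    then obtain p where "prime p" "p dvd n" "int p dvd a" by auto
    hence "int p dvd gcd a (int n)" by simp
    hence "gcd a (int n) \<noteq> 1" using \<open>prime p\<close> prime_gt_1_nat[of p] by (metis int_dvd_int_iff nat_dvd_1_iff_1 of_nat_1 less_irrefl)
    thus "\<not> coprime a (int n)" using coprime_imp_gcd_eq_1[of a "int n"] by (rule contrapos_nn)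
  next
    assume "\<not> coprime a (int n)"
    then obtain p where "prime p" "int p dvd a" "p dvd n"
      using prime_common_divisor_int_nat assms by blast
    thus "\<exists>p. p \<in># prime_factorization n \<and> int p dvd a"
      using assms by (intro exI[of _ p]) (auto simp: prime_factors_dvd)
  qed
  finally show ?thesis .
qed

lemma jacobi_square:
  assumes "n > 0"
  shows "jacobi a n * jacobi a n = (if coprime a (int n) then 1 else 0)"
  using jacobi_values[of a n] jacobi_eq_0_iff[OF assms, of a] by auto

lemma jacobi_abs_le_1: "\<bar>jacobi a n\<bar> \<le> 1"
  using jacobi_values[of a n] by auto

lemma Legendre_1: "prime p \<Longrightarrow> Legendre 1 (int p) = 1"
proof -
  assume "prime p"
  have "QuadRes (int p) 1" unfolding QuadRes_def by (rule exI[of _ 1]) simp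
  moreover have "\<not> int p dvd 1" using \<open>prime p\<close> by auto
  ultimately show ?thesis by (simp add: Legendre_def cong_0_iff)
qed

lemma jacobi_1_left [simp]: "jacobi 1 n = 1"
proof -
  have "jacobi 1 n = (\<Prod>p\<in>#prime_factorization n. 1)"
    unfolding jacobi_def
    by (intro arg_cong[where f = prod_mset] image_mset_cong Legendre_1) auto
  thus ?thesis by simp
qed

text \<open>The sign (-1)^((p-1)/2) is congruent to p modulo 4. Working modulo 4 therefore replaces
  the bookkeeping of the exponents (n-1)/2 along a factorisation.\<close>

lemma completely_multiplicative_cong_4:
  fixes f :: "nat \<Rightarrow> int"
  assumes "\<And>m n. m > 0 \<Longrightarrow> n > 0 \<Longrightarrow> odd m \<Longrightarrow> odd n \<Longrightarrow> f (m * n) = f m * f n" "f 1 = 1"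
    and "\<And>p. prime p \<Longrightarrow> odd p \<Longrightarrow> p dvd n \<Longrightarrow> [f p = int p] (mod 4)"
    and "odd n"
  shows "[f n = int n] (mod 4)"
  using assms(3,4)
proof (induction n rule: prime_divisors_induct)
  case (unit x)
  thus ?case using assms(2) by simp
next
  case (factor p x)
  have "x > 0" "p > 0" using factor by (auto intro: Nat.gr0I)
  hence "f (p * x) = f p * f x" using assms(1)[of p x] factor by auto
  also have "[f p * f x = int p * int x] (mod 4)"
    using factor by (intro cong_mult) auto
  finally show ?case by simp
qed auto

lemma minus_1_power_half_cong_4:
  assumes "odd p"
  shows "[(-1) ^ ((p - 1) div 2) = int p] (mod 4)"
proof -
  obtain k where k: "p = 2 * k + 1" using assms by (auto elim: oddE)
  show ?thesis
  proof (cases "even k")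
    case True
    then obtain j where "k = 2 * j" by auto
    thus ?thesis using k by (auto simp: cong_iff_dvd_diff)
  next
    case False
    then obtain j where "k = 2 * j + 1" by (auto elim: oddE)
    thus ?thesis using k by (auto simp: cong_iff_dvd_diff)
  qed
qed

lemma Legendre_minus_1:
  assumes "prime p" "odd p"
  shows "Legendre (-1) (int p) = (-1) ^ ((p - 1) div 2)"
proof -
  have p: "p > 2" using assms prime_ge_2_nat[of p] by (cases "p = 2") auto
  show ?thesis
    by (rule small_cong_imp_eq[OF euler_criterion[OF assms(1) p]])
       (use p Legendre_values[of "-1" p] in \<open>auto simp: minus_one_power_iff\<close>)
qed

lemma jacobi_minus_1_cong: "odd n \<Longrightarrow> [jacobi (-1) n = int n] (mod 4)"
  by (rule completely_multiplicative_cong_4)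
     (auto simp: jacobi_mult_right jacobi_prime Legendre_minus_1 minus_1_power_half_cong_4[simplified])

lemma jacobi_minus_1:
  assumes "n mod 4 = 1"
  shows "jacobi (-1) n = 1"
proof -
  have "odd n" using assms by presburger
  have "[int n = 1] (mod 4)" using assms zmod_int[of n 4] by (simp add: cong_def)
  hence "[jacobi (-1) n = 1] (mod 4)" using jacobi_minus_1_cong[OF \<open>odd n\<close>] cong_trans by blast
  thus ?thesis by (rule small_cong_imp_eq) (use jacobi_values[of "-1" n] in auto)
qed

text \<open>The product \<open>f\<close> of the two symbols is completely multiplicative in
  \<open>d\<close>, and at primes it is the sign of quadratic reciprocity. If (p-1)/2 is even, all
  these signs are 1; otherwise \<open>f q\<close> is q modulo 4 at each prime, hence
  \<open>f d\<close> is d = 1 modulo 4.\<close>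

lemma Legendre_reciprocity:
  assumes p: "prime p" "odd p" and d: "d mod 4 = 1" "coprime p d"
  shows "Legendre (int d) (int p) = jacobi (int p) d"
proof -
  define f where "f d = Legendre (int d) (int p) * jacobi (int p) d" for d
  have p2: "p > 2" using p prime_ge_2_nat[of p] by (cases "p = 2") auto
  have odd_d: "odd d" using d(1) by presburger
  have f_prime: "f q = (-1) ^ ((p - 1) div 2 * ((q - 1) div 2))" if "prime q" "odd q" "q dvd d" for q
  proof -
    have "q \<noteq> p" using d(2) that p
      by (metis coprime_absorb_left not_prime_unit)
    moreover have "q > 2" using that prime_ge_2_nat[of q] by (cases "q = 2") auto
    ultimately have "Legendre q p * Legendre p q = (-1::int) ^ ((q - 1) div 2 * ((p - 1) div 2))"
      using p p2 that by (intro Quadratic_Reciprocity) auto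
    thus ?thesis using that by (simp add: f_def jacobi_prime mult.commute)
  qed
  have f_mult: "f (m * n) = f m * f n" if "m > 0" "n > 0" for m n
    using that p by (simp add: f_def jacobi_mult_right Legendre_mult)
  have f_1: "f 1 = 1" using p by (simp add: f_def Legendre_1)
  have "f d = 1"
  proof (cases "even ((p - 1) div 2)")
    case True
    have "f m = 1" if "m dvd d" for m using that odd_d
    proof (induction m rule: prime_divisors_induct)
      case (unit x)
      thus ?case using f_1 by simp
    next
      case (factor q x)
      have dvd: "q dvd d" "x dvd d"
        using factor.prems(1) dvd_mult_left dvd_mult_right by blast+
      moreover have "d > 0" using odd_d by (auto intro: Nat.gr0I)
      ultimately have "x > 0" "q > 0" "odd q"
        using odd_d dvd_trans[of 2 q d] by (auto intro: Nat.gr0I)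
      thus ?case using factor dvd f_prime[of q] True by (simp add: f_mult)
    qed auto
    thus ?thesis by simp
  next
    case False
    have "[f d = int d] (mod 4)"
    proof (rule completely_multiplicative_cong_4)
      fix q assume "prime q" "odd q" "q dvd d"
      moreover have "f q = (-1) ^ ((q - 1) div 2)"
        using f_prime[of q] False calculation by (simp add: minus_one_power_iff)
      ultimately show "[f q = int q] (mod 4)" using minus_1_power_half_cong_4 by simp
    qed (use f_mult f_1 odd_d in auto)
    moreover have "[int d = 1] (mod 4)" using d(1) zmod_int[of d 4] by (simp add: cong_def)
    ultimately have "[f d = 1] (mod 4)" using cong_trans by blast
    thus ?thesis
      by (rule small_cong_imp_eq)
         (use Legendre_values[of d p] jacobi_values[of p d] in \<open>auto simp: f_def\<close>)
  qed
  thus ?thesis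
    using Legendre_values[of d p] jacobi_values[of p d] by (auto simp: f_def)
qed

text \<open>Induction over the prime factors of \<open>n\<close>; where such a prime divides
  \<open>d\<close>, both symbols vanish.\<close>

lemma jacobi_reciprocity:
  assumes d: "d mod 4 = 1" and n: "odd n"
  shows "jacobi (int d) n = jacobi (int n) d"
  using n
proof (induction n rule: prime_divisors_induct)
  case (unit x)
  thus ?case by simp
next
  case (factor p x)
  have pos: "x > 0" "p > 0" "d > 0" "odd p" "odd x"
    using factor d by (auto intro: Nat.gr0I)
  have "Legendre (int d) (int p) = jacobi (int p) d"
  proof (cases "coprime p d")
    case True
    thus ?thesis using Legendre_reciprocity[of p d] factor d by auto
  next
    case False
    hence "p dvd d" using factor(1) prime_imp_coprime_nat by blast
    hence "Legendre (int d) (int p) = 0" by (simp add: Legendre_eq_0_iff)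
    moreover have "jacobi (int p) d = 0" using pos False by (simp add: jacobi_eq_0_iff)
    ultimately show ?thesis by simp
  qed
  thus ?case using pos factor by (simp add: jacobi_mult_right jacobi_mult_left jacobi_prime)
qed auto

text \<open>Put n = (d+1)/2, which is 1 modulo 4. As d = 2n - 1 is -1 modulo n, reciprocity gives
  (n|d) = (d|n) = (-1|n) = 1, while 2n is 1 modulo d, so (2|d) (n|d) = 1.\<close>

lemma jacobi_2:
  assumes d: "d mod 8 = 1"
  shows "jacobi 2 d = 1"
proof -
  define n where "n = (d + 1) div 2"
  have n: "2 * n = d + 1" "n mod 4 = 1" "d > 0" "d mod 4 = 1" "n > 0" "odd n"
  proof -
    obtain c where c: "d = 8 * c + 1" using d by (metis div_mult_mod_eq mult.commute)
    hence "n = 4 * c + 1" by (simp add: n_def)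
    thus "2 * n = d + 1" "n mod 4 = 1" "d > 0" "d mod 4 = 1" "n > 0" "odd n" using c by (simp_all add: mod_simps) presburger
  qed
  have "int d - (-1) = 2 * int n" using n by linarith
  hence "[int d = -1] (mod int n)" by (simp add: cong_iff_dvd_diff)
  hence "jacobi (int d) n = jacobi (-1) n" using n by (intro jacobi_cong)
  also have "\<dots> = 1" using n by (intro jacobi_minus_1)
  finally have 1: "jacobi (int n) d = 1" using jacobi_reciprocity[of d n] n by simp
  have "2 * int n - 1 = int d" using n(1) by linarith
  hence "[2 * int n = 1] (mod int d)" by (simp add: cong_iff_dvd_diff)
  hence "jacobi (2 * int n) d = 1" using jacobi_cong[of "2 * int n" 1 d] n by simp
  thus ?thesis using 1 by (simp add: jacobi_mult_left)
qed

section \<open>The Kronecker symbol for discriminants congruent to 1 modulo 8\<close>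

lemma kronecker_eq_prod_mset:
  "n > 0 \<Longrightarrow> kronecker d n = (\<Prod>p\<in>#prime_factorization n. kronecker_prime d p)"
  by (simp add: kronecker_def prod_prime_factors_eq_prod_mset)

text \<open>As a function of n the Kronecker symbol becomes a Jacobi symbol of fixed modulus
  \<open>d\<close>, hence visibly periodic. Even n are covered because both symbols are 1 at the
  prime 2.\<close>

lemma kronecker_eq_jacobi:
  assumes d: "d mod 8 = 1" and n: "n > 0"
  shows "kronecker (int d) n = jacobi (int n) d"
  using n
proof (induction n rule: prime_divisors_induct)
  case (unit x)
  thus ?case by (simp add: kronecker_eq_prod_mset)
next
  case (factor p x)
  have pos: "x > 0" "p > 0" "d > 0" using factor d by (auto intro: Nat.gr0I)
  have d4: "d mod 4 = 1" using d mod_mod_cancel[of 4 8 d] by simp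
  have d8: "int d mod 8 = 1" using d zmod_int[of d 8] by simp
  have "kronecker_prime (int d) p = jacobi (int p) d"
  proof (cases "p = 2")
    case True
    have "odd d" using d by presburger
    thus ?thesis using True jacobi_2[OF d] d8 by (simp add: kronecker_prime_def)
  next
    case False
    hence "odd p" using factor(1) primes_dvd_imp_eq two_is_prime_nat by blast
    thus ?thesis using False jacobi_reciprocity[of d p] factor(1) d4
      by (simp add: kronecker_prime_def jacobi_prime)
  qed
  thus ?case using pos factor
    by (simp add: kronecker_eq_prod_mset prime_factorization_mult prime_factorization_prime
        jacobi_mult_left)
qed auto

section \<open>Gauss sums\<close>

definition e1 :: "real \<Rightarrow> complex" where
  "e1 x = cis (2 * pi * x)"

lemma e1_add: "e1 (x + y) = e1 x * e1 y"
  by (simp add: e1_def cis_mult ring_distribs)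

lemma e1_of_int [simp]: "e1 (of_int n) = 1"
  unfolding e1_def by (rule cis_multiple_2pi) simp

lemma e1_0 [simp]: "e1 0 = 1"
  using e1_of_int[of 0] by simp

lemma norm_e1 [simp]: "norm (e1 x) = 1"
  by (simp add: e1_def)

lemma e1_minus: "e1 (-x) = cnj (e1 x)"
  by (simp add: e1_def cis_cnj)

lemma e1_nz [simp]: "e1 x \<noteq> 0"
  by (metis norm_e1 norm_zero zero_neq_one)

lemma e1_eq_1_imp_int:
  assumes "e1 x = 1"
  shows "x \<in> \<int>"
proof -
  have "cos (2 * pi * x) = 1" using assms by (simp add: e1_def complex_eq_iff)
  then obtain n :: int where "2 * pi * x = of_int n * 2 * pi" using cos_one_2pi_int by auto
  hence "x = of_int n" by simp
  thus ?thesis by simp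
qed

lemma e1_cong:
  assumes "[a = b] (mod int r)" "r > 0"
  shows "e1 (of_int a / real r) = e1 (of_int b / real r)"
proof -
  obtain k where "a = b + int r * k"
    using assms by (metis cong_iff_lin cong_sym mult.commute)
  hence "of_int a / real r = of_int b / real r + of_int k"
    using assms by (simp add: field_simps)
  thus ?thesis by (simp add: e1_add)
qed

lemma e1_eq_1_iff:
  assumes "r > 0"
  shows "e1 (of_int a / real r) = 1 \<longleftrightarrow> int r dvd a"
proof
  assume "e1 (of_int a / real r) = 1"
  then obtain k where "of_int a / real r = of_int k"
    using e1_eq_1_imp_int by (auto elim!: Ints_cases)
  hence "(of_int a :: real) = of_int (int r * k)" using assms by (simp add: field_simps)
  hence "a = int r * k" by linarith
  thus "int r dvd a" by simp
next
  assume "int r dvd a"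
  then obtain k where "a = int r * k" by (auto elim: dvdE)
  thus "e1 (of_int a / real r) = 1" using assms by simp
qed

section \<open>Complete sums over residues\<close>

lemma sum_complete_residues:
  fixes f :: "int \<Rightarrow> 'a::comm_monoid_add"
  assumes per: "\<And>x y. [x = y] (mod m) \<Longrightarrow> f x = f y"
    and S: "finite S" "inj_on (\<lambda>x. x mod m) S" "card S = nat m" and m: "m > 0"
  shows "sum f S = sum f {0..<m}"
proof -
  have "(\<lambda>x. x mod m) ` S = {0..<m}"
  proof (rule card_subset_eq)
    show "(\<lambda>x. x mod m) ` S \<subseteq> {0..<m}" using m by auto
    show "card ((\<lambda>x. x mod m) ` S) = card {0..<m}" using S by (simp add: card_image)
  qed simp
  hence "sum f {0..<m} = (\<Sum>x\<in>S. f (x mod m))"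
    using sum.reindex[OF S(2), of f] by (simp add: o_def)
  also have "\<dots> = sum f S" by (intro sum.cong refl per) (simp add: cong_def)
  finally show ?thesis by simp
qed

lemma sum_residues_scale_shift:
  fixes f :: "int \<Rightarrow> 'a::comm_monoid_add"
  assumes per: "\<And>x y. [x = y] (mod m) \<Longrightarrow> f x = f y" and m: "m > 0" and u: "coprime u m"
  shows "(\<Sum>x\<in>{0..<m}. f (u * x + c)) = sum f {0..<m}"
proof -
  have inj: "x = y" if "[u * x + c = u * y + c] (mod m)" "x \<in> {0..<m}" "y \<in> {0..<m}" for x y
  proof -
    have "[u * x = u * y] (mod m)" using that(1) by (simp add: cong_add_rcancel)
    hence "[x = y] (mod m)" using u by (simp add: cong_mult_lcancel)
    thus ?thesis using that by (auto simp: cong_def)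
  qed
  have inj1: "inj_on (\<lambda>x. u * x + c) {0..<m}" by (rule inj_onI) (auto intro!: inj)
  have "(\<Sum>x\<in>{0..<m}. f (u * x + c)) = sum f ((\<lambda>x. u * x + c) ` {0..<m})"
    using inj1 by (simp add: sum.reindex)
  also have "\<dots> = sum f {0..<m}"
  proof (rule sum_complete_residues[OF per])
    show "inj_on (\<lambda>x. x mod m) ((\<lambda>x. u * x + c) ` {0..<m})"
    proof (rule inj_onI)
      fix x y assume "x \<in> (\<lambda>x. u * x + c) ` {0..<m}" "y \<in> (\<lambda>x. u * x + c) ` {0..<m}" "x mod m = y mod m"
      then obtain a b where "a \<in> {0..<m}" "b \<in> {0..<m}" "x = u * a + c" "y = u * b + c" by blast
      moreover from this have "a = b"
        using \<open>x mod m = y mod m\<close> by (intro inj) (simp_all only: cong_def)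
      ultimately show "x = y" by simp
    qed
    show "card ((\<lambda>x. u * x + c) ` {0..<m}) = nat m"
      using inj1 by (simp add: card_image)
  qed (use m in auto)
  finally show ?thesis .
qed

lemma sum_residues_shift:
  fixes f :: "int \<Rightarrow> 'a::comm_monoid_add"
  assumes "\<And>x y. [x = y] (mod m) \<Longrightarrow> f x = f y" "m > 0"
  shows "(\<Sum>x\<in>{0..<m}. f (x + c)) = sum f {0..<m}"
  using sum_residues_scale_shift[of m f 1 c] assms by simp

lemma sum_residues_scale:
  fixes f :: "int \<Rightarrow> 'a::comm_monoid_add"
  assumes "\<And>x y. [x = y] (mod m) \<Longrightarrow> f x = f y" "m > 0" "coprime u m"
  shows "(\<Sum>x\<in>{0..<m}. f (u * x)) = sum f {0..<m}"
  using sum_residues_scale_shift[of m f u 0] assms by simp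

text \<open>The shift a -> a + m fixes \<open>f\<close> and multiplies the whole sum by e(mn/r),
  which is not 1. With m = 1 this is orthogonality of additive characters; with a proper divisor m
  of r it removes the imprimitive characters in \<open>gauss_sum_eq_quadratic\<close>.\<close>

lemma sum_e1_residues_eq_0:
  fixes f :: "int \<Rightarrow> complex"
  assumes r: "r > 0" and f: "\<And>x y. [x = y] (mod int m) \<Longrightarrow> f x = f y" and m: "m dvd r"
    and n: "\<not> int r dvd int m * n"
  shows "(\<Sum>a\<in>{0..<int r}. f a * e1 (of_int (a * n) / real r)) = 0"
proof -
  define S where "S = (\<Sum>a\<in>{0..<int r}. f a * e1 (of_int (a * n) / real r))"
  have per: "f x * e1 (of_int (x * n) / real r) = f y * e1 (of_int (y * n) / real r)"
    if "[x = y] (mod int r)" for x y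
  proof -
    have "[x = y] (mod int m)" using that m by (meson cong_dvd_modulus of_nat_dvd_iff)
    moreover have "[x * n = y * n] (mod int r)" using that by (rule cong_scalar_right)
    ultimately show ?thesis using f e1_cong[OF _ r] by metis
  qed
  have "S = (\<Sum>a\<in>{0..<int r}. f (a + int m) * e1 (of_int ((a + int m) * n) / real r))"
    unfolding S_def by (rule sum_residues_shift[symmetric]) (use per r in auto)
  also have "\<dots> = (\<Sum>a\<in>{0..<int r}. f a * e1 (of_int (a * n) / real r) * e1 (of_int (int m * n) / real r))"
  proof (intro sum.cong refl)
    fix a
    have "f (a + int m) = f a" by (rule f) (simp add: cong_def)
    moreover have "of_int ((a + int m) * n) / real r = of_int (a * n) / real r + of_int (int m * n) / real r"
      by (simp add: add_divide_distrib ring_distribs)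
    ultimately show "f (a + int m) * e1 (of_int ((a + int m) * n) / real r) =
        f a * e1 (of_int (a * n) / real r) * e1 (of_int (int m * n) / real r)"
      by (simp only: e1_add mult.assoc)
  qed
  also have "\<dots> = S * e1 (of_int (int m * n) / real r)"
    unfolding S_def by (simp only: sum_distrib_right)
  finally have "S = 0" using e1_eq_1_iff[OF r, of "int m * n"] n by simp
  thus ?thesis by (simp add: S_def)
qed

lemma sum_e1_residues:
  assumes r: "r > 0"
  shows "(\<Sum>a\<in>{0..<int r}. e1 (of_int (a * n) / real r)) = (if int r dvd n then of_nat r else 0)"
proof (cases "int r dvd n")
  case True
  hence "e1 (of_int (a * n) / real r) = 1" for a
    using e1_eq_1_iff[OF r, of "a * n"] dvd_mult by blast
  thus ?thesis using True by simp
next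
  case False
  thus ?thesis using sum_e1_residues_eq_0[of r 1 "\<lambda>_. 1" n] r by simp
qed

section \<open>Gauss sums of the Jacobi symbol\<close>

definition gauss_sum :: "nat \<Rightarrow> int \<Rightarrow> complex" where
  "gauss_sum r n = (\<Sum>a\<in>{0..<int r}. of_int (jacobi a r) * e1 (of_int (a * n) / real r))"

text \<open>If every nonzero class were a square, squaring would be surjective on a finite set and
  hence injective, but 1 and -1 have the same square.\<close>

lemma exists_nonresidue:
  assumes "prime q" "odd (q::nat)"
  shows "\<exists>b. Legendre b (int q) = -1"
proof (rule ccontr)
  assume contra: "\<not> (\<exists>b. Legendre b (int q) = -1)"
  have q: "q > 2" using assms prime_ge_2_nat[of q] by (cases "q = 2") auto
  define S where "S = {1..<int q}"
  have "S \<subseteq> (\<lambda>x. x\<^sup>2 mod int q) ` S"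
  proof
    fix a assume a: "a \<in> S"
    hence "\<not> int q dvd a" by (auto simp: S_def dest: zdvd_imp_le)
    hence "QuadRes (int q) a" using contra by (auto simp: Legendre_def cong_0_iff split: if_splits)
    then obtain y where y: "[y\<^sup>2 = a] (mod int q)" by (auto simp: QuadRes_def)
    define x where "x = y mod int q"
    have x2: "x\<^sup>2 mod int q = a" using y a by (simp add: x_def cong_def power_mod S_def)
    have "x \<noteq> 0" using x2 a by (auto simp: S_def)
    moreover have "0 \<le> x" "x < int q" using q by (simp_all add: x_def)
    ultimately have "x \<in> S" by (simp add: S_def)
    thus "a \<in> (\<lambda>x. x\<^sup>2 mod int q) ` S" using x2 by auto
  qed
  hence "inj_on (\<lambda>x. x\<^sup>2 mod int q) S"
    using finite_surj_inj[of S] unfolding S_def by blast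
  moreover have "1\<^sup>2 mod int q = (int q - 1)\<^sup>2 mod int q"
  proof -
    have "(int q - 1)\<^sup>2 = 1 + int q * (int q - 2)" by (simp add: power2_eq_square algebra_simps)
    thus ?thesis by simp
  qed
  ultimately have "1 = int q - 1" using q by (auto simp: inj_on_def S_def)
  thus False using q by simp
qed

text \<open>Primitivity: the symbol is not induced from the modulus r/q. The witness joins a
  non-residue modulo q and 1 modulo r/q by the Chinese remainder theorem.\<close>

lemma jacobi_imprimitive_witness:
  assumes r: "squarefree r" "odd r" and q: "prime q" "q dvd r"
  shows "\<exists>b. [b = 1] (mod int (r div q)) \<and> jacobi b r = -1"
proof -
  obtain m where m: "r = q * m" using q by (auto elim: dvdE)
  have pos: "q > 0" "m > 0" using r m by (auto intro: Nat.gr0I)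
  have cop: "coprime q m"
  proof (rule prime_imp_coprime_nat[OF q(1)])
    show "\<not> q dvd m"
    proof
      assume "q dvd m"
      hence "q\<^sup>2 dvd r" unfolding m power2_eq_square by (rule mult_dvd_mono[OF dvd_refl])
      thus False using r(1) q(1) by (auto simp: squarefree_def)
    qed
  qed
  have "odd q" using r m by simp
  then obtain b0 where b0: "Legendre b0 (int q) = -1" using exists_nonresidue q by blast
  have "coprime (int q) (int m)" using cop by simp
  then obtain b where b: "[b = b0] (mod int q)" "[b = 1] (mod int m)"
    using binary_chinese_remainder_int[of "int q" "int m" b0 1] by blast
  have "jacobi b r = Legendre b (int q) * jacobi b m"
    unfolding m using pos by (simp add: jacobi_mult_right jacobi_prime q(1))
  also have "Legendre b (int q) = -1" using Legendre_cong[OF b(1)] b0 by simp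
  also have "jacobi b m = 1" using jacobi_cong[OF b(2) pos(2)] by simp
  finally show ?thesis using b(2) pos by (intro exI[of _ b]) (simp add: m)
qed

text \<open>For n prime to r, substitute a -> n a. If a prime q divides both, multiplying a by the
  primitivity witness for q leaves every exponential unchanged and flips every symbol, so the sum
  equals its own negative.\<close>

lemma gauss_sum_eq:
  assumes r: "squarefree r" "odd r"
  shows "gauss_sum r n = of_int (jacobi n r) * gauss_sum r 1"
proof -
  have pos: "r > 0" using r by (auto intro: Nat.gr0I)
  have per: "of_int (jacobi x r) * e1 (of_int (x * k) / real r) = of_int (jacobi y r) * e1 (of_int (y * k) / real r)"
    if "[x = y] (mod int r)" for x y k
    using jacobi_cong[OF that pos] e1_cong[OF cong_scalar_right[OF that] pos] by metis
  show ?thesis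
  proof (cases "coprime n (int r)")
    case True
    have sq: "(of_int (jacobi n r) * of_int (jacobi n r) :: complex) = 1"
      using jacobi_square[OF pos, of n] True by (simp flip: of_int_mult)
    have "gauss_sum r 1 = (\<Sum>a\<in>{0..<int r}. of_int (jacobi (n * a) r) * e1 (of_int (n * a * 1) / real r))"
      unfolding gauss_sum_def
      by (rule sum_residues_scale[symmetric]) (use per[where k = 1] pos True in auto)
    also have "\<dots> = of_int (jacobi n r) * gauss_sum r n"
      unfolding gauss_sum_def sum_distrib_left
      by (intro sum.cong refl) (simp add: jacobi_mult_left mult_ac)
    finally have "of_int (jacobi n r) * gauss_sum r 1 =
        (of_int (jacobi n r) * of_int (jacobi n r)) * gauss_sum r n" by (simp only: mult_ac)
    thus ?thesis by (simp only: sq mult_1)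
  next
    case False
    then obtain q where q: "prime q" "int q dvd n" "q dvd r"
      using prime_common_divisor_int_nat pos by blast
    obtain b where b: "[b = 1] (mod int (r div q))" "jacobi b r = -1"
      using jacobi_imprimitive_witness[OF r q(1,3)] by blast
    have cop: "coprime b (int r)" using b(2) jacobi_eq_0_iff[OF pos, of b] by fastforce
    have bn: "[b * a * n = a * n] (mod int r)" for a
    proof -
      have "int (r div q) dvd b - 1" using b(1) by (simp add: cong_iff_dvd_diff)
      hence "int (r div q) * int q dvd (b - 1) * n" using q(2) by (rule mult_dvd_mono)
      hence "int r dvd (b - 1) * n" using q(3) by (simp flip: of_nat_mult)
      hence "int r dvd (b - 1) * n * a" by simp
      moreover have "b * a * n - a * n = (b - 1) * n * a" by (simp add: algebra_simps)
      ultimately show ?thesis by (simp add: cong_iff_dvd_diff)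
    qed
    have "gauss_sum r n = (\<Sum>a\<in>{0..<int r}. of_int (jacobi (b * a) r) * e1 (of_int (b * a * n) / real r))"
      unfolding gauss_sum_def
      by (rule sum_residues_scale[symmetric]) (use per[where k = n] pos cop in auto)
    also have "\<dots> = (\<Sum>a\<in>{0..<int r}. - (of_int (jacobi a r) * e1 (of_int (a * n) / real r)))"
      using e1_cong[OF bn pos] by (intro sum.cong refl) (simp add: jacobi_mult_left b(2))
    also have "\<dots> = - gauss_sum r n" unfolding gauss_sum_def by (simp add: sum_negf)
    finally have "gauss_sum r n = 0" by simp
    moreover have "jacobi n r = 0" using False pos by (simp add: jacobi_eq_0_iff)
    ultimately show ?thesis by simp
  qed
qed

text \<open>Evaluate the sum of |G(n)|^2 over all n twice: by orthogonality it is
  \<open>P * r\<close>, by \<open>gauss_sum_eq\<close> it is \<open>P\<close> times |G(1)|^2. Here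
  \<open>P\<close> counts the units and is nonzero.\<close>

lemma norm_gauss_sum_sq:
  assumes r: "squarefree r" "odd r"
  shows "(norm (gauss_sum r 1))\<^sup>2 = real r"
proof -
  have pos: "r > 0" using r by (auto intro: Nat.gr0I)
  define R where "R = {0..<int r}"
  define P where "P = (\<Sum>a\<in>R. (of_int (jacobi a r) * of_int (jacobi a r) :: complex))"
  have "(\<Sum>n\<in>R. gauss_sum r n * cnj (gauss_sum r n)) =
     (\<Sum>n\<in>R. \<Sum>a\<in>R. \<Sum>b\<in>R. of_int (jacobi a r) * of_int (jacobi b r) *
        e1 (of_int (n * (a - b)) / real r))"
  proof (intro sum.cong refl)
    fix n
    have "e1 (of_int (a * n) / real r) * cnj (e1 (of_int (b * n) / real r)) =
          e1 (of_int (n * (a - b)) / real r)" for a b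
    proof -
      have "of_int (n * (a - b)) / real r = of_int (a * n) / real r + - (of_int (b * n) / real r)"
        by (simp add: diff_divide_distrib ring_distribs mult.commute)
      thus ?thesis by (simp only: e1_add e1_minus)
    qed
    thus "gauss_sum r n * cnj (gauss_sum r n) = (\<Sum>a\<in>R. \<Sum>b\<in>R. of_int (jacobi a r) * of_int (jacobi b r) *
        e1 (of_int (n * (a - b)) / real r))"
      unfolding gauss_sum_def cnj_sum sum_product R_def
      by (intro sum.cong refl) (simp add: mult_ac)
  qed
  also have "\<dots> = (\<Sum>a\<in>R. \<Sum>b\<in>R. \<Sum>n\<in>R. of_int (jacobi a r) * of_int (jacobi b r) *
        e1 (of_int (n * (a - b)) / real r))"
    by (subst sum.swap) (intro sum.cong refl sum.swap)
  also have "\<dots> = (\<Sum>a\<in>R. \<Sum>b\<in>R. if a = b then of_int (jacobi a r) * of_int (jacobi b r) * of_nat r else 0)"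
  proof (intro sum.cong refl)
    fix a b assume ab: "a \<in> R" "b \<in> R"
    have "(\<Sum>n\<in>R. e1 (of_int (n * (a - b)) / real r)) = (if int r dvd a - b then of_nat r else 0)"
      unfolding R_def by (rule sum_e1_residues[OF pos])
    moreover have "int r dvd a - b \<longleftrightarrow> a = b"
      using ab unfolding R_def by (auto simp flip: cong_iff_dvd_diff simp: cong_def)
    ultimately show "(\<Sum>n\<in>R. of_int (jacobi a r) * of_int (jacobi b r) * e1 (of_int (n * (a - b)) / real r)) =
        (if a = b then of_int (jacobi a r) * of_int (jacobi b r) * of_nat r else 0)"
      by (simp flip: sum_distrib_left)
  qed
  also have "\<dots> = P * of_nat r"
    unfolding P_def sum_distrib_right by (intro sum.cong refl) (simp add: R_def)
  finally have 1: "(\<Sum>n\<in>R. gauss_sum r n * cnj (gauss_sum r n)) = P * of_nat r" .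
  have "(\<Sum>n\<in>R. gauss_sum r n * cnj (gauss_sum r n)) = P * (gauss_sum r 1 * cnj (gauss_sum r 1))"
    unfolding P_def sum_distrib_right
  proof (intro sum.cong refl)
    fix n
    show "gauss_sum r n * cnj (gauss_sum r n) =
      of_int (jacobi n r) * of_int (jacobi n r) * (gauss_sum r 1 * cnj (gauss_sum r 1))"
      by (subst (1 2) gauss_sum_eq[OF r]) (simp add: mult_ac)
  qed
  hence 2: "P * (gauss_sum r 1 * cnj (gauss_sum r 1)) = P * of_nat r" using 1 by (simp only:)
  have "P = of_int (\<Sum>a\<in>R. jacobi a r * jacobi a r)" by (simp add: P_def)
  moreover have "(\<Sum>a\<in>R. jacobi a r * jacobi a r) > 0"
  proof (cases "r = 1")
    case False
    hence "1 \<in> R" using pos by (simp add: R_def)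
    thus ?thesis by (intro sum_pos2[of R 1]) (auto simp: R_def)
  qed (simp add: R_def)
  ultimately have "P \<noteq> 0" by (simp only: of_int_eq_0_iff)
  hence "gauss_sum r 1 * cnj (gauss_sum r 1) = of_nat r" using 2 by simp
  hence "complex_of_real ((norm (gauss_sum r 1))\<^sup>2) = complex_of_real (real r)"
    by (simp only: complex_norm_square of_real_of_nat_eq)
  thus ?thesis by (simp only: of_real_eq_iff)
qed

lemma cnj_gauss_sum: "cnj (gauss_sum r n) = gauss_sum r (-n)"
  unfolding gauss_sum_def cnj_sum
  by (intro sum.cong refl) (simp add: e1_minus[symmetric])

text \<open>The sum is real because the symbol is even for r = 1 modulo 4, and its modulus is
  known.\<close>

lemma gauss_sum_cases:
  assumes r: "squarefree r" "r mod 4 = 1"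
  shows "gauss_sum r 1 = of_real (sqrt r) \<or> gauss_sum r 1 = - of_real (sqrt r)"
proof -
  have odd: "odd r" using r by presburger
  have "cnj (gauss_sum r 1) = gauss_sum r 1"
    using gauss_sum_eq[OF r(1) odd, of "-1"] jacobi_minus_1[OF r(2)] by (simp add: cnj_gauss_sum)
  then obtain x where x: "gauss_sum r 1 = complex_of_real x"
    by (metis Reals_cases Reals_cnj_iff)
  hence "x\<^sup>2 = real r" using norm_gauss_sum_sq[OF r(1) odd] by simp
  hence "\<bar>x\<bar> = sqrt r" by (metis real_sqrt_abs)
  hence "x = sqrt r \<or> x = - sqrt r" by linarith
  thus ?thesis using x by auto
qed


section \<open>The Polya-Vinogradov inequality\<close>

lemma sin_ge_cubic:
  assumes "x \<ge> (0::real)"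
  shows "sin x \<ge> x - x ^ 3 / 6"
proof -
  have "\<bar>sin x - (\<Sum>m<3. sin_coeff m * x ^ m)\<bar> \<le> inverse (fact 3) * \<bar>x\<bar> ^ 3"
    by (rule Maclaurin_sin_bound)
  moreover have "(\<Sum>m<3. sin_coeff m * x ^ m) = x"
    by (simp add: eval_nat_numeral sin_coeff_def)
  moreover have "inverse (fact 3) * \<bar>x\<bar> ^ 3 = x ^ 3 / 6"
    using assms by (simp add: fact_numeral field_simps)
  ultimately show ?thesis by (simp only: abs_le_iff) linarith
qed

text \<open>Near either end the sine exceeds the distance to that end. The symmetric right side sums
  over x = a/r to two equal harmonic sums.\<close>

lemma inverse_sin_pi_le:
  assumes "0 < x" "x < (1::real)"
  shows "1 / sin (pi * x) \<le> 1 / x + 1 / (1 - x)"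
proof -
  have half: "sin (pi * y) \<ge> y" if "0 < y" "y \<le> 1 / 2" for y :: real
  proof -
    define t where "t = pi * y"
    \<comment> \<open>The bound 1.6 exceeds pi/2. It keeps t^2/6 below 2/3, so the cubic bound
      leaves at least t/3, and pi > 3 turns t/3 into y.\<close>
    have t: "0 \<le> t" "t \<le> 1.6" "t \<ge> 3 * y"
    proof -
      show "0 \<le> t" "t \<ge> 3 * y" using that pi_gt3 by (simp_all add: t_def)
      have "t \<le> 3.2 * (1 / 2)" unfolding t_def using that pi_approx by (intro mult_mono) auto
      thus "t \<le> 1.6" by simp
    qed
    have "t ^ 3 = t * t\<^sup>2" by (simp add: power3_eq_cube power2_eq_square)
    also have "\<dots> \<le> t * 1.6\<^sup>2" using t by (intro mult_left_mono power_mono) auto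
    finally have "t - t ^ 3 / 6 \<ge> t / 3" using t by (simp add: power2_eq_square)
    thus ?thesis using sin_ge_cubic[OF t(1)] t(3) unfolding t_def by linarith
  qed
  show ?thesis
  proof (cases "x \<le> 1 / 2")
    case True
    hence "1 / sin (pi * x) \<le> 1 / x" using half[of x] assms by (intro divide_left_mono) auto
    also have "\<dots> \<le> 1 / x + 1 / (1 - x)" using assms by simp
    finally show ?thesis .
  next
    case False
    have "sin (pi * x) = sin (pi * (1 - x))"
      by (metis sin_pi_minus mult.right_neutral right_diff_distrib')
    moreover have "1 / sin (pi * (1 - x)) \<le> 1 / (1 - x)"
      using half[of "1 - x"] assms False by (intro divide_left_mono) auto
    ultimately have "1 / sin (pi * x) \<le> 1 / (1 - x)" by (simp only:)
    also have "\<dots> \<le> 1 / x + 1 / (1 - x)" using assms by simp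
    finally show ?thesis .
  qed
qed

lemma e1_minus_1: "e1 x - 1 = cis (pi * x) * (2 * \<i> * of_real (sin (pi * x)))"
proof -
  have "cis (pi * x) * (cis (pi * x) - cis (- (pi * x))) = e1 x - 1"
    by (simp add: e1_def cis_mult right_diff_distrib mult.assoc)
  moreover have "cis (pi * x) - cis (- (pi * x)) = 2 * \<i> * of_real (sin (pi * x))"
    by (simp add: complex_eq_iff)
  ultimately show ?thesis by simp
qed

lemma norm_e1_minus_1: "norm (e1 x - 1) = 2 * \<bar>sin (pi * x)\<bar>"
  by (simp add: e1_minus_1 norm_mult)

lemma norm_sum_e1_le:
  assumes x: "0 < x" "x < 1"
  shows "norm (\<Sum>i<N. e1 (x * (c + real i))) \<le> 1 / sin (pi * x)"
proof -
  have sin: "sin (pi * x) > 0" using x by (intro sin_gt_zero) auto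
  have "(e1 x - 1) * (\<Sum>i<N. e1 (x * (c + real i))) = e1 (x * (c + real N)) - e1 (x * c)"
  proof (induction N)
    case (Suc N)
    have "e1 (x * (c + real (Suc N))) = e1 x * e1 (x * (c + real N))"
      by (simp add: e1_add[symmetric] algebra_simps)
    thus ?case using Suc by (simp add: algebra_simps)
  qed simp
  hence "norm (e1 x - 1) * norm (\<Sum>i<N. e1 (x * (c + real i))) = norm (e1 (x * (c + real N)) - e1 (x * c))"
    by (metis norm_mult)
  also have "\<dots> \<le> 2" using norm_triangle_ineq4[of "e1 (x * (c + real N))" "e1 (x * c)"] by simp
  finally show ?thesis using sin by (simp add: norm_e1_minus_1 field_simps)
qed

lemma harm_le_ln: "n > 0 \<Longrightarrow> harm n \<le> 1 + ln (real n)"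
proof -
  assume "n > 0"
  then obtain m where m: "n = Suc m" by (cases n) auto
  have "harm (Suc m) - ln (real (Suc m)) \<le> harm (Suc 0) - ln (real (Suc 0))"
    using decseq_harm_diff_ln unfolding decseq_def by blast
  thus ?thesis by (simp add: m harm_def)
qed

text \<open>Multiplying by the Gauss sum, of modulus sqrt r, expands the symbol in additive
  characters. The resulting geometric sums are at most 1 / sin(pi a/r), and their sum over a is
  harmonic. The free starting point \<open>u\<close> is what later allows progressions modulo
  8.\<close>

theorem polya_vinogradov:
  assumes r: "squarefree r" "odd r" "r > 1"
  shows "\<bar>\<Sum>i<N. jacobi (u + int i) r\<bar> \<le> 2 * sqrt r * (1 + ln r)"
proof -
  define g where "g = gauss_sum r 1"
  have norm_g: "norm g = sqrt r"
    using norm_gauss_sum_sq[OF r(1,2)] by (metis g_def norm_ge_zero real_sqrt_unique)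
  have g_eq: "g * of_int (jacobi n r) = (\<Sum>a\<in>{1..<int r}. of_int (jacobi a r) * e1 (of_int (a * n) / real r))" for n
  proof -
    have "jacobi 0 r = 0" using r by (simp add: jacobi_eq_0_iff)
    moreover have "{0..<int r} = insert 0 {1..<int r}" using r by auto
    ultimately show ?thesis
      using gauss_sum_eq[OF r(1,2), of n] by (simp add: g_def gauss_sum_def mult.commute)
  qed
  have "norm g * norm (complex_of_int (\<Sum>i<N. jacobi (u + int i) r)) =
        norm (\<Sum>i<N. \<Sum>a\<in>{1..<int r}. of_int (jacobi a r) * e1 (of_int (a * (u + int i)) / real r))"
    by (simp only: norm_mult[symmetric] of_int_sum sum_distrib_left g_eq)
  also have "(\<Sum>i<N. \<Sum>a\<in>{1..<int r}. of_int (jacobi a r) * e1 (of_int (a * (u + int i)) / real r)) =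
     (\<Sum>a\<in>{1..<int r}. of_int (jacobi a r) * (\<Sum>i<N. e1 ((of_int a / real r) * (of_int u + real i))))"
    by (subst sum.swap) (simp add: sum_distrib_left)
  also have "norm \<dots> \<le> (\<Sum>a\<in>{1..<int r}. 1 / (of_int a / real r) + 1 / (1 - of_int a / real r))"
  proof (intro sum_norm_le)
    fix a assume a: "a \<in> {1..<int r}"
    define x where "x = of_int a / real r"
    have x: "0 < x" "x < 1" using a by (auto simp: x_def)
    have "norm (of_int (jacobi a r) * (\<Sum>i<N. e1 (x * (of_int u + real i)))) \<le>
          1 * (1 / sin (pi * x))"
      unfolding norm_mult using jacobi_abs_le_1[of a r] norm_sum_e1_le[OF x]
      by (intro mult_mono) (simp_all flip: of_int_abs)
    also have "\<dots> \<le> 1 / x + 1 / (1 - x)" using inverse_sin_pi_le[OF x] by simp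
    finally show "norm (of_int (jacobi a r) * (\<Sum>i<N. e1 ((of_int a / real r) * (of_int u + real i)))) \<le>
        1 / (of_int a / real r) + 1 / (1 - of_int a / real r)" by (simp add: x_def)
  qed
  also have "\<dots> = (\<Sum>a\<in>{1..<int r}. real r / of_int a) + (\<Sum>a\<in>{1..<int r}. real r / of_int (int r - a))"
    unfolding sum.distrib[symmetric] by (intro sum.cong refl) (use r in \<open>auto simp: field_simps\<close>)
  also have "(\<Sum>a\<in>{1..<int r}. real r / of_int (int r - a)) = (\<Sum>a\<in>{1..<int r}. real r / of_int a)"
    by (rule sum.reindex_bij_witness[of _ "\<lambda>a. int r - a" "\<lambda>a. int r - a"]) auto
  also have "(\<Sum>a\<in>{1..<int r}. real r / of_int a) = (\<Sum>a\<in>{1..<r}. real r / real a)"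
    by (rule sum.reindex_bij_witness[of _ int nat]) auto
  also have "\<dots> = real r * harm (r - 1)"
    using r unfolding harm_def sum_distrib_left by (intro sum.cong) (auto simp: field_simps)
  also have "harm (r - 1) \<le> 1 + ln (real (r - 1))" using r by (intro harm_le_ln) simp
  also have "ln (real (r - 1)) \<le> ln (real r)" using r by simp
  finally have "sqrt r * norm (complex_of_int (\<Sum>i<N. jacobi (u + int i) r)) \<le> 2 * (real r * (1 + ln r))"
    using r by (simp add: norm_g)
  also have "2 * (real r * (1 + ln r)) = sqrt r * (2 * sqrt r * (1 + ln r))"
    by (metis (no_types) mult.assoc mult.left_commute of_nat_0_le_iff real_sqrt_mult_self abs_of_nat)
  finally have "sqrt r * norm (complex_of_int (\<Sum>i<N. jacobi (u + int i) r)) \<le>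
      sqrt r * (2 * sqrt r * (1 + ln r))" .
  hence "norm (complex_of_int (\<Sum>i<N. jacobi (u + int i) r)) \<le> 2 * sqrt r * (1 + ln r)"
    using r by (subst (asm) mult_le_cancel_left_pos) auto
  thus ?thesis by (simp only: norm_of_int of_int_abs)
qed

subsection \<open>The sign of the quadratic Gauss sum\<close>

definition sqrt_residues :: "nat \<Rightarrow> int \<Rightarrow> int set" where
  "sqrt_residues m a = {x \<in> {0..<int m}. [x\<^sup>2 = a] (mod int m)}"

lemma card_sqrt_residues_mult:
  assumes "coprime m n" "m > 0" "n > 0"
  shows "card (sqrt_residues (m * n) a) = card (sqrt_residues m a) * card (sqrt_residues n a)"
proof -
  have cop: "coprime (int m) (int n)" using assms by simp
  have "bij_betw (\<lambda>x. (x mod int m, x mod int n)) (sqrt_residues (m * n) a) (sqrt_residues m a \<times> sqrt_residues n a)"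
    unfolding bij_betw_def
  proof (intro conjI equalityI subsetI)
    show "inj_on (\<lambda>x. (x mod int m, x mod int n)) (sqrt_residues (m * n) a)"
    proof (rule inj_onI)
      fix x y assume *: "x \<in> sqrt_residues (m * n) a" "y \<in> sqrt_residues (m * n) a"
        "(x mod int m, x mod int n) = (y mod int m, y mod int n)"
      hence "[x = y] (mod int m)" "[x = y] (mod int n)" by (simp_all add: cong_def)
      hence "[x = y] (mod int m * int n)" using cop coprime_cong_mult by blast
      thus "x = y" using * by (auto simp: sqrt_residues_def cong_def)
    qed
  next
    fix z assume "z \<in> (\<lambda>x. (x mod int m, x mod int n)) ` sqrt_residues (m * n) a"
    then obtain x where x: "z = (x mod int m, x mod int n)" "[x\<^sup>2 = a] (mod int m * int n)"
      by (auto simp: sqrt_residues_def)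
    have "[x\<^sup>2 = a] (mod int m)" "[x\<^sup>2 = a] (mod int n)"
      using x(2) by (auto intro: cong_dvd_modulus[OF x(2)])
    thus "z \<in> sqrt_residues m a \<times> sqrt_residues n a"
      using x(1) assms by (auto simp: sqrt_residues_def cong_def power_mod)
  next
    fix z assume "z \<in> sqrt_residues m a \<times> sqrt_residues n a"
    then obtain u v where z: "z = (u, v)" "0 \<le> u" "u < int m" "0 \<le> v" "v < int n"
      "[u\<^sup>2 = a] (mod int m)" "[v\<^sup>2 = a] (mod int n)"
      by (auto simp: sqrt_residues_def)
    obtain x0 where x0: "[x0 = u] (mod int m)" "[x0 = v] (mod int n)"
      using binary_chinese_remainder_int[OF cop] by blast
    define x where "x = x0 mod (int m * int n)"
    have x: "[x = u] (mod int m)" "[x = v] (mod int n)"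
      using x0 by (simp_all add: x_def cong_def mod_mod_cancel)
    have "[x\<^sup>2 = a] (mod int m)" "[x\<^sup>2 = a] (mod int n)"
      using cong_pow[OF x(1), of 2] cong_pow[OF x(2), of 2] z cong_trans by blast+
    hence "[x\<^sup>2 = a] (mod int m * int n)" using cop coprime_cong_mult by blast
    moreover have "0 \<le> x" "x < int m * int n" using assms by (simp_all add: x_def)
    ultimately have "x \<in> sqrt_residues (m * n) a" by (simp add: sqrt_residues_def)
    moreover have "z = (x mod int m, x mod int n)" using x z by (simp add: cong_def)
    ultimately show "z \<in> (\<lambda>x. (x mod int m, x mod int n)) ` sqrt_residues (m * n) a" by blast
  qed
  thus ?thesis using bij_betw_same_card card_cartesian_product by metis
qed

lemma card_sqrt_residues_prime:
  assumes "prime p" "odd (p::nat)"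
  shows "int (card (sqrt_residues p a)) = 1 + Legendre a (int p)"
proof -
  have p: "p > 2" using assms prime_ge_2_nat[of p] by (cases "p = 2") auto
  have pint: "prime (int p)" using assms by simp
  consider "int p dvd a" | "\<not> int p dvd a" "\<not> QuadRes (int p) a" | "\<not> int p dvd a" "QuadRes (int p) a"
    by blast
  thus ?thesis
  proof cases
    case 1
    have "sqrt_residues p a = {0}"
    proof (intro equalityI subsetI)
      fix x assume x: "x \<in> sqrt_residues p a"
      hence "int p dvd x\<^sup>2" using 1 cong_dvd_iff by (auto simp: sqrt_residues_def)
      hence "int p dvd x" using pint prime_dvd_power by blast
      thus "x \<in> {0}" using x zdvd_not_zless[of x "int p"] by (force simp: sqrt_residues_def)
    next
      fix x :: int assume "x \<in> {0}"
      thus "x \<in> sqrt_residues p a" using 1 p by (auto simp: sqrt_residues_def cong_def)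
    qed
    thus ?thesis using 1 by (simp add: Legendre_eq_0_iff[THEN iffD2])
  next
    case 2
    have "sqrt_residues p a = {}" using 2 by (auto simp: sqrt_residues_def QuadRes_def)
    thus ?thesis using 2 by (simp add: Legendre_def cong_0_iff)
  next
    case 3
    then obtain y where y: "[y\<^sup>2 = a] (mod int p)" by (auto simp: QuadRes_def)
    define z where "z = y mod int p"
    have z2: "[z\<^sup>2 = a] (mod int p)" using y by (simp add: z_def cong_def power_mod)
    have "z \<noteq> 0"
    proof
      assume "z = 0"
      hence "[a = 0] (mod int p)" using z2 by (simp add: cong_sym_eq)
      thus False using 3 by (simp add: cong_0_iff)
    qed
    moreover have "0 \<le> z" "z < int p" using p by (simp_all add: z_def)
    ultimately have z: "0 < z" "z < int p" by auto
    have "sqrt_residues p a = {z, int p - z}"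
    proof (intro equalityI subsetI)
      fix x assume "x \<in> sqrt_residues p a"
      hence x: "0 \<le> x" "x < int p" "[x\<^sup>2 = a] (mod int p)" by (auto simp: sqrt_residues_def)
      have "[x\<^sup>2 = z\<^sup>2] (mod int p)" using x(3) z2 cong_sym cong_trans by blast
      hence "int p dvd x\<^sup>2 - z\<^sup>2" by (simp add: cong_iff_dvd_diff)
      also have "x\<^sup>2 - z\<^sup>2 = (x - z) * (x + z)" by (simp add: power2_eq_square algebra_simps)
      finally have "int p dvd x - z \<or> int p dvd x + z" using pint by (simp add: prime_dvd_mult_iff)
      thus "x \<in> {z, int p - z}"
      proof
        assume "int p dvd x - z"
        hence "[x = z] (mod int p)" by (simp add: cong_iff_dvd_diff)
        thus ?thesis using x z by (simp add: cong_def)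
      next
        assume "int p dvd x + z"
        hence "int p dvd x + z - int p" by simp
        moreover have "\<bar>x + z - int p\<bar> < int p" using x z by linarith
        ultimately have "x + z - int p = 0" using dvd_imp_le_int[of "x + z - int p" "int p"] by auto
        thus ?thesis by simp
      qed
    next
      fix x assume "x \<in> {z, int p - z}"
      moreover have "[(int p - z)\<^sup>2 = z\<^sup>2] (mod int p)"
      proof -
        have "(int p - z)\<^sup>2 - z\<^sup>2 = int p * (int p - 2 * z)" by (simp add: power2_eq_square algebra_simps)
        thus ?thesis by (simp add: cong_iff_dvd_diff)
      qed
      hence "[(int p - z)\<^sup>2 = a] (mod int p)" using z2 cong_trans by blast
      ultimately show "x \<in> sqrt_residues p a" using z z2 by (auto simp: sqrt_residues_def)
    qed
    moreover have "z \<noteq> int p - z"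
    proof
      assume "z = int p - z"
      hence "int p = 2 * z" by simp
      hence "even (int p)" by simp
      thus False using assms by simp
    qed
    ultimately show ?thesis using 3 by (simp add: Legendre_def cong_0_iff)
  qed
qed

lemma card_sqrt_residues_prod:
  assumes "finite P" "\<And>p. p \<in> P \<Longrightarrow> prime p \<and> odd (p::nat)"
  shows "int (card (sqrt_residues (\<Prod>P) a)) = (\<Prod>p\<in>P. 1 + Legendre a (int p))"
  using assms
proof (induction P rule: finite_induct)
  case empty
  have "sqrt_residues 1 a = {0}" by (auto simp: sqrt_residues_def)
  thus ?case by simp
next
  case (insert p P)
  have "coprime p (\<Prod>P)"
  proof (rule prod_coprime_right)
    fix q assume "q \<in> P"
    thus "coprime p q" using insert by (intro primes_coprime) auto
  qed
  moreover have "p > 0" "\<Prod>P > 0" using insert.prems prime_gt_0_nat by (blast, intro prod_pos, blast)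
  ultimately have "card (sqrt_residues (p * \<Prod>P) a) = card (sqrt_residues p a) * card (sqrt_residues (\<Prod>P) a)"
    by (rule card_sqrt_residues_mult)
  thus ?case using insert card_sqrt_residues_prime[of p a] by simp
qed

lemma squarefree_eq_prod_prime_factors:
  assumes "squarefree (n::nat)" "n > 0"
  shows "n = \<Prod>(prime_factors n)"
proof -
  have "n = (\<Prod>p\<in>prime_factors n. p ^ multiplicity p n)"
    using prod_prime_factors[of n] assms by simp
  also have "\<dots> = (\<Prod>p\<in>prime_factors n. p)"
  proof (intro prod.cong refl)
    fix p assume p: "p \<in> prime_factors n"
    hence "multiplicity p n \<le> 1" using assms squarefree_factorial_semiring''[of n] by auto
    moreover have "multiplicity p n \<ge> 1" using p by (simp add: prime_factors_multiplicity)
    ultimately have "multiplicity p n = 1" by linarith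
    thus "p ^ multiplicity p n = p" by simp
  qed
  finally show ?thesis .
qed

lemma jacobi_squarefree:
  assumes "finite P" "\<And>p. p \<in> P \<Longrightarrow> prime (p::nat)"
  shows "jacobi a (\<Prod>P) = (\<Prod>p\<in>P. Legendre a (int p))"
  using assms
proof (induction P rule: finite_induct)
  case (insert p P)
  have "p > 0" "\<Prod>P > 0" using insert.prems prime_gt_0_nat by (blast, intro prod_pos, blast)
  thus ?case using insert by (simp add: jacobi_mult_right jacobi_prime)
qed simp

text \<open>The number of square roots of a modulo d is the product of 1 + (a|p) over the primes p
  of d, that is, the sum of (a|\<Prod>S) over all sets S of such primes. Against e(a/d) only the
  full set survives: for a proper subset the symbol has a period properly dividing d.\<close>

lemma gauss_sum_eq_quadratic:
  assumes d: "squarefree d" "odd d"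
  shows "gauss_sum d 1 = (\<Sum>x\<in>{0..<int d}. e1 (of_int (x\<^sup>2) / real d))"
proof -
  have pos: "d > 0" using d by (auto intro: Nat.gr0I)
  define P where "P = prime_factors d"
  have P: "finite P" "\<And>p. p \<in> P \<Longrightarrow> prime p \<and> odd p"
    using d(2) dvd_trans[of 2 _ d] by (auto simp: P_def)
  have dP: "d = \<Prod>P" unfolding P_def by (rule squarefree_eq_prod_prime_factors[OF d(1) pos])
  define R where "R = {0..<int d}"
  define h where "h a = e1 (of_int a / real d)" for a
  have jac: "jacobi a (\<Prod>S) = (\<Prod>p\<in>S. Legendre a (int p))" if "S \<subseteq> P" for S a
    using that P finite_subset by (intro jacobi_squarefree) auto
  have "(\<Sum>x\<in>R. e1 (of_int (x\<^sup>2) / real d)) = (\<Sum>x\<in>R. \<Sum>a\<in>R. if [x\<^sup>2 = a] (mod int d) then h a else 0)"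
  proof (intro sum.cong refl)
    fix x
    have "(\<Sum>a\<in>R. if [x\<^sup>2 = a] (mod int d) then h a else 0) = (\<Sum>a\<in>R. if a = x\<^sup>2 mod int d then h a else 0)"
      by (intro sum.cong refl) (auto simp: R_def cong_def)
    also have "\<dots> = h (x\<^sup>2 mod int d)" using pos by (simp add: R_def)
    also have "\<dots> = e1 (of_int (x\<^sup>2) / real d)"
      unfolding h_def by (rule e1_cong) (use pos in \<open>simp_all add: cong_def\<close>)
    finally show "e1 (of_int (x\<^sup>2) / real d) = (\<Sum>a\<in>R. if [x\<^sup>2 = a] (mod int d) then h a else 0)" ..
  qed
  also have "\<dots> = (\<Sum>a\<in>R. of_int (int (card (sqrt_residues d a))) * h a)"
    by (subst sum.swap) (simp add: sum.If_cases sqrt_residues_def R_def Int_def)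
  also have "\<dots> = (\<Sum>a\<in>R. \<Sum>S\<in>Pow P. of_int (jacobi a (\<Prod>S)) * h a)"
  proof (intro sum.cong refl)
    fix a
    have "int (card (sqrt_residues d a)) = (\<Prod>p\<in>P. Legendre a (int p) + 1)"
      using card_sqrt_residues_prod[OF P, of a] dP by (simp add: add.commute)
    also have "\<dots> = (\<Sum>S\<in>Pow P. jacobi a (\<Prod>S))"
      by (subst prod_add[OF P(1)]) (auto intro!: sum.cong simp: jac)
    finally show "of_int (int (card (sqrt_residues d a))) * h a = (\<Sum>S\<in>Pow P. of_int (jacobi a (\<Prod>S)) * h a)"
      by (simp add: sum_distrib_right)
  qed
  also have "\<dots> = (\<Sum>S\<in>Pow P. \<Sum>a\<in>R. of_int (jacobi a (\<Prod>S)) * h a)" by (rule sum.swap)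
  also have "\<dots> = (\<Sum>S\<in>{P}. \<Sum>a\<in>R. of_int (jacobi a (\<Prod>S)) * h a)"
  proof (rule sum.mono_neutral_right)
    show "\<forall>S\<in>Pow P - {P}. (\<Sum>a\<in>R. of_int (jacobi a (\<Prod>S)) * h a) = 0"
    proof
      fix S assume "S \<in> Pow P - {P}"
      hence S: "S \<subseteq> P" "S \<noteq> P" by auto
      have finS: "finite S" using S P finite_subset by blast
      have posS: "\<Prod>S > 0" using S P by (intro prod_pos) (auto intro: prime_gt_0_nat)
      obtain p where p: "p \<in> P" "p \<notin> S" using S by blast
      have "\<Prod>(insert p S) dvd \<Prod>P" using S p P by (intro prod_dvd_prod_subset) auto
      hence "p * \<Prod>S dvd d" using p finS dP by simp
      hence "p * \<Prod>S \<le> d" using pos by (rule dvd_imp_le)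
      moreover have "p \<ge> 2" using p P prime_ge_2_nat by blast
      hence "2 * \<Prod>S \<le> p * \<Prod>S" by simp
      ultimately have "\<Prod>S < d" using posS by linarith
      hence "\<not> d dvd \<Prod>S" using posS by (auto dest: dvd_imp_le)
      hence nd: "\<not> int d dvd int (\<Prod>S) * 1" by (metis int_dvd_int_iff mult.right_neutral)
      have dvd: "\<Prod>S dvd d" unfolding dP using S P by (intro prod_dvd_prod_subset) auto
      have "(\<Sum>a\<in>{0..<int d}. (of_int (jacobi a (\<Prod>S)) :: complex) * e1 (of_int (a * 1) / real d)) = 0"
      proof (rule sum_e1_residues_eq_0[OF pos _ dvd nd])
        fix x y assume "[x = y] (mod int (\<Prod>S))"
        thus "(of_int (jacobi x (\<Prod>S)) :: complex) = of_int (jacobi y (\<Prod>S))"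
          using jacobi_cong[OF _ posS] by simp
      qed
      thus "(\<Sum>a\<in>R. of_int (jacobi a (\<Prod>S)) * h a) = 0" by (simp add: R_def h_def)
    qed
  qed (use P in auto)
  also have "\<dots> = gauss_sum d 1" using dP by (simp add: gauss_sum_def R_def h_def)
  finally show ?thesis by (simp add: R_def)
qed

text \<open>
  The terms are differences of consecutive values of the bounded sequence
  \<open>e1 (y * (y - 1) / d)\<close>, \<open>y = i + b\<close>, divided by \<open>2 i sin (2 pi y / d)\<close>.
\<close>
lemma norm_quadratic_tail_le:
  fixes b d :: real
  assumes d: "d > 0" and m: "real m + b > 0" and n: "real n + b \<le> d / 4" and mn: "m \<le> n"
  shows "norm (\<Sum>i=m..n. e1 ((real i + b)\<^sup>2 / d)) \<le> 1 / sin (2 * pi * (real m + b) / d)"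
proof -
  define W where "W i = e1 ((real i + b) * (real i + b - 1) / d)" for i :: nat
  define g where "g i = 1 / (2 * sin (2 * pi * (real i + b) / d))" for i :: nat
  define z where "z i = e1 ((real i + b)\<^sup>2 / d)" for i :: nat
  have angle: "0 < 2 * pi * (real i + b) / d" "2 * pi * (real i + b) / d \<le> pi / 2"
    if "m \<le> i" "i \<le> n" for i
  proof -
    have "0 < real i + b" using m that by linarith
    thus "0 < 2 * pi * (real i + b) / d" using d by simp
    have "real i + b \<le> d / 4" using n that by linarith
    hence "2 * pi * (real i + b) / d \<le> 2 * pi * (d / 4) / d"
      using d by (intro divide_right_mono mult_left_mono) auto
    thus "2 * pi * (real i + b) / d \<le> pi / 2" using d by simp
  qed
  have sin_pos: "sin (2 * pi * (real i + b) / d) > 0" if "m \<le> i" "i \<le> n" for i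
    using angle[OF that] by (intro sin_gt_zero) auto
  have g_pos: "g i > 0" if "m \<le> i" "i \<le> n" for i
    using sin_pos[OF that] by (simp add: g_def)
  have g_mono: "g (Suc i) \<le> g i" if "m \<le> i" "Suc i \<le> n" for i
  proof -
    have "2 * pi * (real i + b) / d \<le> 2 * pi * (real (Suc i) + b) / d"
      using d by (intro divide_right_mono mult_left_mono) auto
    hence "sin (2 * pi * (real i + b) / d) \<le> sin (2 * pi * (real (Suc i) + b) / d)"
      using angle[of i] angle[of "Suc i"] that by (intro sin_monotone_2pi_le) auto
    thus ?thesis using sin_pos[of i] sin_pos[of "Suc i"] that unfolding g_def
      by (intro divide_left_mono) auto
  qed
  have z_eq: "\<i> * z i = (W (Suc i) - W i) * of_real (g i)" if "m \<le> i" "i \<le> n" for i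
  proof -
    define y where "y = (real i + b) / d"
    have 1: "(real (Suc i) + b) * (real (Suc i) + b - 1) / d = (real i + b)\<^sup>2 / d + y"
      using d by (simp add: y_def power2_eq_square field_simps)
    have 2: "(real i + b) * (real i + b - 1) / d = (real i + b)\<^sup>2 / d + - y"
      using d by (simp add: y_def power2_eq_square field_simps)
    have "W (Suc i) - W i = z i * (e1 y - e1 (-y))"
      unfolding W_def z_def 1 2 e1_add by (simp add: algebra_simps)
    also have "e1 y - e1 (-y) = 2 * \<i> * of_real (sin (2 * pi * y))"
      by (simp add: e1_def complex_eq_iff)
    finally show ?thesis using sin_pos[OF that] by (simp add: g_def y_def field_simps)
  qed
  \<comment> \<open>Partial summation with the boundary term kept on the left. As \<open>W\<close>
    has modulus 1 and \<open>g\<close> decreases, step n adds at most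
    \<open>g n - g (Suc n)\<close>, which telescopes; putting the boundary term back gives 2
    g(m).\<close>
  have "norm (\<i> * (\<Sum>i=m..n. z i) - W (Suc n) * of_real (g n)) \<le> 2 * g m - g n"
    using mn n z_eq g_pos g_mono
  proof (induction n rule: dec_induct)
    case base
    have "\<i> * (\<Sum>i=m..m. z i) - W (Suc m) * of_real (g m) = - (W m * of_real (g m))"
      using base(2)[of m] by (simp add: algebra_simps)
    thus ?case using base(3)[of m] by (simp add: norm_mult W_def)
  next
    case (step n)
    have IH: "norm (\<i> * (\<Sum>i=m..n. z i) - W (Suc n) * of_real (g n)) \<le> 2 * g m - g n"
      using step.prems by (intro step.IH) auto
    have "\<i> * (\<Sum>i=m..Suc n. z i) - W (Suc (Suc n)) * of_real (g (Suc n)) =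
      \<i> * (\<Sum>i=m..n. z i) + \<i> * z (Suc n) - W (Suc (Suc n)) * of_real (g (Suc n))"
      using step.hyps by (simp add: ring_distribs)
    also have "\<i> * z (Suc n) = (W (Suc (Suc n)) - W (Suc n)) * of_real (g (Suc n))"
      using step by auto
    also have "\<i> * (\<Sum>i=m..n. z i) + (W (Suc (Suc n)) - W (Suc n)) * of_real (g (Suc n)) -
          W (Suc (Suc n)) * of_real (g (Suc n)) =
        (\<i> * (\<Sum>i=m..n. z i) - W (Suc n) * of_real (g n)) + W (Suc n) * of_real (g n - g (Suc n))"
      by (simp add: algebra_simps)
    also have "norm \<dots> \<le> (2 * g m - g n) + norm (W (Suc n) * complex_of_real (g n - g (Suc n)))"
      using IH by (intro norm_triangle_le add_right_mono)
    also have "norm (W (Suc n) * complex_of_real (g n - g (Suc n))) = g n - g (Suc n)"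
      using step.prems(4)[of n] step.hyps unfolding norm_mult norm_of_real by (simp add: W_def)
    finally show ?case by simp
  qed
  moreover have "norm (\<i> * (\<Sum>i=m..n. z i)) \<le>
      norm (\<i> * (\<Sum>i=m..n. z i) - W (Suc n) * of_real (g n)) + norm (W (Suc n) * complex_of_real (g n))"
    by (metis norm_triangle_sub add.commute)
  moreover have "norm (W (Suc n) * complex_of_real (g n)) = g n"
    using g_pos[of n] mn by (simp add: norm_mult W_def)
  ultimately have "norm (\<Sum>i=m..n. z i) \<le> 2 * g m" by (simp add: norm_mult)
  thus ?thesis by (simp add: z_def g_def)
qed

text \<open>Take residues from -2c to 6c. Those of size at most 2c pair up under x -> -x, the others
  lie symmetrically about d/2. After this folding every argument is at most d/4, the range where
  sin(2 pi y/d) increases and \<open>norm_quadratic_tail_le\<close> applies.\<close>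

lemma quadratic_sum_split:
  assumes d: "d = 8 * c + 1"
  shows "(\<Sum>x\<in>{0..<int d}. e1 (of_int (x\<^sup>2) / real d)) =
    1 + 2 * (\<Sum>i=1..2*c. e1 ((real i)\<^sup>2 / real d)) - 2 * \<i> * (\<Sum>i<2*c. e1 ((real i + 1/2)\<^sup>2 / real d))"
proof -
  define f where "f x = e1 (of_int (x\<^sup>2) / real d)" for x :: int
  have pos: "d > 0" using d by simp
  have f_minus: "f (- x) = f x" for x by (simp add: f_def)
  have "sum f {0..<int d} = sum f {- (2 * int c)..6 * int c}"
  proof (rule sum_complete_residues[symmetric])
    show "f x = f y" if "[x = y] (mod int d)" for x y
      unfolding f_def by (rule e1_cong[OF cong_pow[OF that] pos])
    show "inj_on (\<lambda>x. x mod int d) {- (2 * int c)..6 * int c}"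
    proof (rule inj_onI)
      fix x y assume xy: "x \<in> {- (2 * int c)..6 * int c}" "y \<in> {- (2 * int c)..6 * int c}"
        "x mod int d = y mod int d"
      hence "int d dvd x - y" by (simp add: mod_eq_dvd_iff)
      moreover have "\<bar>x - y\<bar> < int d" using xy d by auto
      ultimately show "x = y" using dvd_imp_le_int[of "x - y" "int d"] by (cases "x = y") auto
    qed
  qed (use d in auto)
  also have "{- (2 * int c)..6 * int c} =
      ({- (2 * int c)..2 * int c} \<union> {2 * int c + 1..6 * int c})" by auto
  also have "sum f \<dots> = sum f {- (2 * int c)..2 * int c} + sum f {2 * int c + 1..6 * int c}"
    by (rule sum.union_disjoint) auto
  also have "sum f {- (2 * int c)..2 * int c} = 1 + 2 * (\<Sum>i=1..2*c. e1 ((real i)\<^sup>2 / real d))"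
  proof -
    have "{- (2 * int c)..2 * int c} = insert 0 ({- (2 * int c)..-1} \<union> {1..2 * int c})" by auto
    hence "sum f {- (2 * int c)..2 * int c} = f 0 + (sum f {- (2 * int c)..-1} + sum f {1..2 * int c})"
      by (simp add: sum.union_disjoint)
    also have "sum f {- (2 * int c)..-1} = sum f {1..2 * int c}"
      by (rule sum.reindex_bij_witness[of _ uminus uminus]) (auto simp: f_minus)
    also have "sum f {1..2 * int c} = (\<Sum>i=1..2*c. e1 ((real i)\<^sup>2 / real d))"
      by (rule sum.reindex_bij_witness[of _ int nat]) (auto simp: f_def)
    finally show ?thesis by (simp add: f_def)
  qed
  also have "sum f {2 * int c + 1..6 * int c} = - 2 * \<i> * (\<Sum>i<2*c. e1 ((real i + 1/2)\<^sup>2 / real d))"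
  proof -
    \<comment> \<open>With y = (d + v)/2 and v odd, y^2/d = v^2/(4d) + v/2 + d/4; here e(v/2) = -1,
      and e(d/4) = i because d = 8c + 1.\<close>
    have f_eq: "f y = - \<i> * e1 ((real i + 1/2)\<^sup>2 / real d)"
      if "2 * y = int d + (2 * int i + 1) \<or> 2 * y = int d - (2 * int i + 1)" for y i
    proof -
      define v where "v = 2 * y - int d"
      have v: "2 * y = int d + v" "v = 2 * int i + 1 \<or> v = - (2 * int i + 1)"
        using that by (auto simp: v_def)
      have rv: "real_of_int v = 2 * real i + 1 \<or> real_of_int v = - (2 * real i + 1)"
        using v(2) by auto
      have e_half: "e1 (of_int v / 2) = -1"
      proof -
        have "odd v" using v(2) by auto
        then obtain w where w: "v = 2 * w + 1" by (elim oddE)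
        have eq: "of_int v / 2 = (of_int w :: real) + 1 / 2" by (simp add: w field_simps)
        have half: "e1 (1 / 2) = -1" by (simp add: e1_def)
        show ?thesis by (simp only: eq e1_add e1_of_int half mult_1)
      qed
      have e_quart: "e1 (real d / 4) = \<i>"
      proof -
        have "real d / 4 = of_int (2 * int c) + 1 / 4" using d by (simp add: field_simps)
        moreover have "e1 (1 / 4) = \<i>" by (simp add: e1_def complex_eq_iff)
        ultimately show ?thesis by (simp only: e1_add e1_of_int mult_1)
      qed
      have y: "real_of_int y = (real d + of_int v) / 2" using arg_cong[OF v(1), of real_of_int] by simp
      have "of_int (y\<^sup>2) / real d = (of_int v)\<^sup>2 / (4 * real d) + of_int v / 2 + real d / 4"
        using pos by (simp add: y power2_eq_square field_simps)
      also have "(of_int v)\<^sup>2 = 4 * (real i + 1 / 2)\<^sup>2"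
      proof -
        have "(real_of_int v)\<^sup>2 = (2 * real i + 1)\<^sup>2" using rv by (metis power2_minus)
        thus ?thesis by (simp add: power2_eq_square algebra_simps)
      qed
      finally have "of_int (y\<^sup>2) / real d = (real i + 1/2)\<^sup>2 / real d + of_int v / 2 + real d / 4" by simp
      hence "f y = e1 ((real i + 1/2)\<^sup>2 / real d) * (-1) * \<i>"
        unfolding f_def by (simp only: e1_add e_half e_quart)
      thus ?thesis by simp
    qed
    have "{2 * int c + 1..6 * int c} = {4 * int c + 1..6 * int c} \<union> {2 * int c + 1..4 * int c}" by auto
    also have "sum f \<dots> = sum f {4 * int c + 1..6 * int c} + sum f {2 * int c + 1..4 * int c}"
      by (rule sum.union_disjoint) auto
    also have "sum f {4 * int c + 1..6 * int c} = (\<Sum>i<2*c. - \<i> * e1 ((real i + 1/2)\<^sup>2 / real d))"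
    proof (rule sum.reindex_bij_witness[of _ "\<lambda>i. 4 * int c + 1 + int i" "\<lambda>y. nat (y - (4 * int c + 1))"])
      fix y assume "y \<in> {4 * int c + 1..6 * int c}"
      thus "- \<i> * e1 ((real (nat (y - (4 * int c + 1))) + 1/2)\<^sup>2 / real d) = f y"
        by (intro f_eq[symmetric]) (auto simp: d)
    qed auto
    also have "sum f {2 * int c + 1..4 * int c} = (\<Sum>i<2*c. - \<i> * e1 ((real i + 1/2)\<^sup>2 / real d))"
    proof (rule sum.reindex_bij_witness[of _ "\<lambda>i. 4 * int c - int i" "\<lambda>y. nat (4 * int c - y)"])
      fix y assume "y \<in> {2 * int c + 1..4 * int c}"
      thus "- \<i> * e1 ((real (nat (4 * int c - y)) + 1/2)\<^sup>2 / real d) = f y"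
        by (intro f_eq[symmetric]) (auto simp: d)
    qed auto
    finally show ?thesis by (simp add: sum_negf sum_distrib_left mult.assoc)
  qed
  finally show ?thesis by (simp add: f_def)
qed

text \<open>With s = sqrt d this is the angle at which the tails in \<open>gauss_sum_eq_sqrt\<close>
  start at the earliest. It equals pi (1 - 2/s)/s, slightly below pi/s; s >= 100 comes from d >=
  10000.\<close>

lemma sin_initial_angle_ge:
  assumes s: "s \<ge> (100::real)"
  shows "sin (2 * pi * (s / 2 - 1) / s\<^sup>2) \<ge> 2.95 / s"
proof -
  define t where "t = 2 * pi * (s / 2 - 1) / s\<^sup>2"
  have t_eq: "t = pi * (1 - 2 / s) / s" using s by (simp add: t_def power2_eq_square field_simps)
  have "1 - 2 / s \<ge> 0.98" using s by (simp add: field_simps)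
  hence "pi * (1 - 2 / s) \<ge> 3.14 * 0.98" using pi_approx by (intro mult_mono) auto
  hence "pi * (1 - 2 / s) \<ge> 3.07" by (rule order_trans[rotated]) simp
  hence t_ge: "t \<ge> 3.07 / s" unfolding t_eq using s by (intro divide_right_mono) auto
  have "pi * (1 - 2 / s) \<le> 3.15 * 1" using pi_approx s by (intro mult_mono) (auto simp: field_simps)
  hence "t \<le> 3.15 / s" unfolding t_eq using s by (intro divide_right_mono) auto
  also have "\<dots> \<le> 3.15 / 100" using s by (intro divide_left_mono) auto
  finally have t_le: "t \<le> 0.1" by simp
  have "0 \<le> 3.07 / s" using s by simp
  hence t0: "t \<ge> 0" using t_ge by linarith
  have "t ^ 3 = t * t\<^sup>2" by (simp add: power3_eq_cube power2_eq_square)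
  also have "\<dots> \<le> t * 0.1\<^sup>2" using t_le t0 by (intro mult_left_mono power_mono) auto
  finally have "t - t ^ 3 / 6 \<ge> t * 0.99" using t0 by (simp add: power2_eq_square)
  moreover have "t * 0.99 \<ge> (3.07 / s) * 0.99" using t_ge by (intro mult_right_mono) auto
  moreover have "(3.07 / s) * 0.99 \<ge> 2.95 / s" using s by (simp add: field_simps)
  ultimately show ?thesis using sin_ge_cubic[OF t0] unfolding t_def by linarith
qed

text \<open>Only the two signs are possible, so it is enough that the real part exceeds -s, s = sqrt
  d. Up to m, about s/2, the phases stay in the first quadrant and contribute non-negatively to
  \<open>Re A\<close> and \<open>Im B\<close>; the first s/4 terms of \<open>A\<close> contribute at
  least 7/8 each. The two tails cost at most 17s/50 each, so the total is at least 1 + 2 (7/8)(s/4 -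
  1) - 4 (17/50) s = -0.9225 s - 0.75.\<close>

theorem gauss_sum_eq_sqrt:
  assumes d: "squarefree d" "d mod 8 = 1" "d \<ge> 10000"
  shows "gauss_sum d 1 = of_real (sqrt d)"
proof -
  obtain c where c: "d = 8 * c + 1" using d(2) by (metis div_mult_mod_eq mult.commute)
  define s where "s = sqrt (real d)"
  have s2: "s\<^sup>2 = real d" by (simp add: s_def)
  have s100: "s \<ge> 100"
  proof -
    have "sqrt (100\<^sup>2) \<le> sqrt (real d)" using d(3) by (intro real_sqrt_le_mono) simp
    thus ?thesis by (simp add: s_def)
  qed
  define m where "m = nat \<lfloor>s / 2\<rfloor>"
  define k where "k = nat \<lfloor>s / 4\<rfloor>"
  have m: "real m \<le> s / 2" "real m \<ge> s / 2 - 1" using s100 unfolding m_def by linarith+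
  have k: "real k \<le> s / 4" "real k \<ge> s / 4 - 1" using s100 unfolding k_def by linarith+
  have "real k + 1 \<le> real m" using m k s100 by linarith
  hence km: "k < m" by linarith
  have s_c: "s \<le> 2 * real c"
  proof -
    have "s * 100 \<le> s * s" using s100 by (intro mult_left_mono) auto
    also have "\<dots> = 8 * real c + 1" using s2 c by (simp add: power2_eq_square)
    finally show ?thesis using s100 by linarith
  qed
  have mc: "m \<ge> 1" "m \<le> 2 * c - 1" "c \<ge> 1" using m s_c s100 by linarith+
  define A where "A = (\<Sum>i=1..2*c. e1 ((real i)\<^sup>2 / real d))"
  define B where "B = (\<Sum>i<2*c. e1 ((real i + 1/2)\<^sup>2 / real d))"
  \<comment> \<open>The constant 17/50 is a rounding of 1/2.95 upwards.\<close>
  have tail: "norm (\<Sum>i=m..n. e1 ((real i + b)\<^sup>2 / real d)) \<le> 17/50 * s"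
    if "0 \<le> b" "m \<le> n" "real n + b \<le> real d / 4" for b n
  proof -
    have "norm (\<Sum>i=m..n. e1 ((real i + b)\<^sup>2 / real d)) \<le> 1 / sin (2 * pi * (real m + b) / real d)"
      using that mc c by (intro norm_quadratic_tail_le) auto
    also have "\<dots> \<le> 1 / (2.95 / s)"
    proof (intro divide_left_mono)
      have le: "2 * pi * (s / 2 - 1) / s\<^sup>2 \<le> 2 * pi * (real m + b) / real d"
        unfolding s2 using m that by (intro divide_right_mono mult_left_mono) auto
      have "2 * pi * (real m + b) / real d \<le> 2 * pi * (real d / 4) / real d"
        using that by (intro divide_right_mono mult_left_mono) auto
      moreover have "2 * pi * (real d / 4) / real d = pi / 2" using c by (simp add: field_simps)
      ultimately have "2 * pi * (real m + b) / real d \<le> pi / 2" by linarith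
      moreover have "0 \<le> 2 * pi * (s / 2 - 1) / s\<^sup>2" using s100 by simp
      ultimately have "sin (2 * pi * (s / 2 - 1) / s\<^sup>2) \<le> sin (2 * pi * (real m + b) / real d)"
        using le by (intro sin_monotone_2pi_le) (auto intro: order_trans[of _ 0])
      hence "2.95 / s \<le> sin (2 * pi * (real m + b) / real d)" using sin_initial_angle_ge[OF s100] by linarith
      moreover have "2.95 / s > 0" using s100 by simp
      ultimately show "2.95 / s \<le> sin (2 * pi * (real m + b) / real d)"
        "0 < sin (2 * pi * (real m + b) / real d) * (2.95 / s)"
        by (blast, intro mult_pos_pos) linarith+
    qed auto
    also have "\<dots> \<le> 17/50 * s" using s100 by simp
    finally show ?thesis .
  qed
  have early: "y\<^sup>2 / real d \<le> 1 / 4" if "0 \<le> y" "y \<le> s / 2" for y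
  proof -
    have "y\<^sup>2 \<le> (s / 2)\<^sup>2" using that by (intro power_mono)
    thus ?thesis using s2 c by (simp add: power_divide field_simps)
  qed
  have "Re A \<ge> 7/8 * (s / 4 - 1) - 17/50 * s"
  proof -
    have eq: "{1..2*c} = {1..<m} \<union> {m..2*c}" using mc by auto
    have "A = (\<Sum>i\<in>{1..<m}. e1 ((real i)\<^sup>2 / real d)) + (\<Sum>i=m..2*c. e1 ((real i + 0)\<^sup>2 / real d))"
      unfolding A_def eq add_0_right by (rule sum.union_disjoint) auto
    moreover have "Re (\<Sum>i\<in>{1..<m}. e1 ((real i)\<^sup>2 / real d)) \<ge> 7/8 * (s / 4 - 1)"
    proof -
      have "Re (e1 ((real i)\<^sup>2 / real d)) \<ge> 0" if "i \<in> {1..<m}" for i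
      proof -
        have "(real i)\<^sup>2 / real d \<le> 1 / 4" using that m by (intro early) auto
        hence "2 * pi * ((real i)\<^sup>2 / real d) \<le> 2 * pi * (1 / 4)" by (intro mult_left_mono) auto
        thus ?thesis unfolding e1_def cis.sel by (intro cos_ge_zero) (auto intro: order_trans[of _ 0])
      qed
      \<comment> \<open>Here the phase is at most pi/8 < 1/2, and cos x >= 1 - x^2/2 gives
        7/8.\<close>
      moreover have "Re (e1 ((real i)\<^sup>2 / real d)) \<ge> 7/8" if "i \<in> {1..k}" for i
      proof -
        have "(real i)\<^sup>2 \<le> (s / 4)\<^sup>2" using that k by (intro power_mono) auto
        hence le: "(real i)\<^sup>2 / real d \<le> 1 / 16" using s2 c by (simp add: power_divide field_simps)
        define x where "x = 2 * pi * ((real i)\<^sup>2 / real d)"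
        have "x \<le> 2 * pi * (1 / 16)" unfolding x_def using le by (intro mult_left_mono) auto
        hence x: "0 \<le> x" "x \<le> 1 / 2" using pi_less_4 by (auto simp: x_def)
        hence "x\<^sup>2 \<le> (1/2)\<^sup>2" by (intro power_mono)
        moreover have "cos x \<ge> 1 - x\<^sup>2 / 2"
        proof -
          have "\<bar>sin (x / 2)\<bar>\<^sup>2 \<le> \<bar>x / 2\<bar>\<^sup>2"
            by (intro power_mono abs_sin_x_le_abs_x) auto
          thus ?thesis using cos_double_sin[of "x / 2"] by (simp add: power2_eq_square)
        qed
        ultimately have "cos x \<ge> 7/8" by (simp add: power2_eq_square)
        thus ?thesis by (simp add: e1_def x_def mult.assoc)
      qed
      ultimately have "(\<Sum>i\<in>{1..<m}. Re (e1 ((real i)\<^sup>2 / real d))) \<ge> (\<Sum>i\<in>{1..k}. Re (e1 ((real i)\<^sup>2 / real d)))"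
        and "(\<Sum>i\<in>{1..k}. Re (e1 ((real i)\<^sup>2 / real d))) \<ge> (\<Sum>i\<in>{1..k}. 7/8)"
        using km by (intro sum_mono2 sum_mono; force)+
      thus ?thesis using k by simp
    qed
    moreover have "\<bar>Re (\<Sum>i=m..2*c. e1 ((real i + 0)\<^sup>2 / real d))\<bar> \<le> 17/50 * s"
      by (rule order_trans[OF abs_Re_le_cmod tail]) (use mc c in auto)
    ultimately show ?thesis by (simp only: plus_complex.sel)
  qed
  moreover have "Im B \<ge> - (17/50 * s)"
  proof -
    have eq: "{..<2*c} = {..<m} \<union> {m..2*c-1}" using mc by auto
    have "B = (\<Sum>i<m. e1 ((real i + 1/2)\<^sup>2 / real d)) + (\<Sum>i=m..2*c-1. e1 ((real i + 1/2)\<^sup>2 / real d))"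
      unfolding B_def eq by (rule sum.union_disjoint) auto
    moreover have "Im (\<Sum>i<m. e1 ((real i + 1/2)\<^sup>2 / real d)) \<ge> 0"
      unfolding Im_sum
    proof (intro sum_nonneg)
      fix i assume "i \<in> {..<m}"
      hence "real i + 1 \<le> real m" by auto
      hence "(real i + 1/2)\<^sup>2 / real d \<le> 1 / 4" using m by (intro early) auto
      hence "2 * pi * ((real i + 1/2)\<^sup>2 / real d) \<le> 2 * pi * (1 / 4)" by (intro mult_left_mono) auto
      also have "\<dots> \<le> pi" by simp
      finally show "0 \<le> Im (e1 ((real i + 1/2)\<^sup>2 / real d))"
        unfolding e1_def cis.sel by (intro sin_ge_zero) auto
    qed
    moreover have "real (2 * c - 1) + 1/2 \<le> real d / 4" using mc c by (simp add: of_nat_diff)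
    hence "\<bar>Im (\<Sum>i=m..2*c-1. e1 ((real i + 1/2)\<^sup>2 / real d))\<bar> \<le> 17/50 * s"
      by (intro order_trans[OF abs_Im_le_cmod tail]) (use mc in auto)
    ultimately show ?thesis by (simp only: plus_complex.sel)
  qed
  moreover have "gauss_sum d 1 = 1 + 2 * A - 2 * \<i> * B"
  proof -
    have "odd d" using c by simp
    thus ?thesis using gauss_sum_eq_quadratic[OF d(1)] quadratic_sum_split[OF c]
      by (simp add: A_def B_def)
  qed
  hence "Re (gauss_sum d 1) = 1 + 2 * Re A + 2 * Im B" by simp
  ultimately have "Re (gauss_sum d 1) > - s" using s100 by (simp add: field_simps)
  moreover have "d mod 4 = 1" using c by presburger
  ultimately show ?thesis using gauss_sum_cases[OF d(1)] by (auto simp: s_def)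
qed

section \<open>The value at 1/2\<close>

text \<open>Logarithmic differentiation of the reflection formula gives pi cot(pi z) as a difference
  of digamma values; subtracting their series termwise leaves these fractions. Pairing z + k with 1
  - z + k makes the series converge without a principal value.\<close>

lemma cot_partial_fractions:
  fixes z :: complex
  assumes z: "z \<notin> \<int>"
  shows "(\<lambda>k. inverse (z + of_nat k) - inverse (1 - z + of_nat k)) sums (of_real pi * cot (of_real pi * z))"
proof -
  have z0: "z \<noteq> 0" "1 - z \<noteq> 0" using z by auto
  have nonpos: "z \<notin> \<int>\<^sub>\<le>\<^sub>0" "1 - z \<notin> \<int>\<^sub>\<le>\<^sub>0"
    using z nonpos_Ints_Int Ints_diff[of 1 "1 - z"] by auto
  have sin: "sin (of_real pi * z) \<noteq> 0"
    using z by (auto simp: sin_eq_0 mult.commute)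
  have Gamma_nz: "Gamma z \<noteq> 0" "Gamma (1 - z) \<noteq> 0" using nonpos by (auto simp: Gamma_eq_zero_iff)
  have "((\<lambda>z. Gamma z * Gamma (1 - z)) has_field_derivative
      Gamma z * Gamma (1 - z) * (Digamma z - Digamma (1 - z))) (at z)"
    using nonpos by (auto intro!: derivative_eq_intros simp: algebra_simps)
  moreover have "((\<lambda>z. of_real pi / sin (of_real pi * z)) has_field_derivative
      - (of_real pi * (of_real pi * cos (of_real pi * z))) / (sin (of_real pi * z))\<^sup>2) (at z)"
    using sin by (auto intro!: derivative_eq_intros simp: power2_eq_square)
  ultimately have "Gamma z * Gamma (1 - z) * (Digamma z - Digamma (1 - z)) =
      - (of_real pi * (of_real pi * cos (of_real pi * z))) / (sin (of_real pi * z))\<^sup>2"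
    unfolding Gamma_reflection_complex by (rule DERIV_unique)
  also have "\<dots> = - (of_real pi / sin (of_real pi * z)) * (of_real pi * cot (of_real pi * z))"
    by (simp add: cot_def power2_eq_square)
  also have "of_real pi / sin (of_real pi * z) = Gamma z * Gamma (1 - z)"
    by (rule Gamma_reflection_complex[symmetric])
  finally have "Gamma z * Gamma (1 - z) * (Digamma z - Digamma (1 - z)) =
      Gamma z * Gamma (1 - z) * (- (of_real pi * cot (of_real pi * z)))" by simp
  hence "Digamma z - Digamma (1 - z) = - (of_real pi * cot (of_real pi * z))"
    using Gamma_nz by (subst (asm) mult_left_cancel) auto
  hence cot: "of_real pi * cot (of_real pi * z) = Digamma (1 - z) - Digamma z"
    by (simp add: algebra_simps)
  have "(\<lambda>k. (inverse (of_nat (Suc k)) - inverse (1 - z + of_nat k)) -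
          (inverse (of_nat (Suc k)) - inverse (z + of_nat k))) sums
        ((\<Sum>k. inverse (of_nat (Suc k)) - inverse (1 - z + of_nat k)) -
         (\<Sum>k. inverse (of_nat (Suc k)) - inverse (z + of_nat k)))"
    using z0 by (intro sums_diff summable_sums summable_Digamma)
  also have "(\<Sum>k. inverse (of_nat (Suc k)) - inverse (1 - z + of_nat k)) -
         (\<Sum>k. inverse (of_nat (Suc k)) - inverse (z + of_nat k)) = of_real pi * cot (of_real pi * z)"
    by (simp add: cot Digamma_def)
  finally show ?thesis by simp
qed

text \<open>The integral for Gamma(1/2) = sqrt pi, rescaled; it turns n^(-1/2) into an
  exponential.\<close>

lemma has_integral_powr_exp:
  assumes a: "a > (0::real)"
  shows "((\<lambda>t. t powr (-1/2) * exp (- a * t)) has_integral sqrt pi / sqrt a) {0..}"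
proof -
  define f where "f t = t powr (-1/2) * exp (- t)" for t :: real
  have "((\<lambda>t. t powr (1/2 - 1) / exp t) has_integral Gamma (1/2 :: real)) {0..}"
    by (rule Gamma_integral_real) simp
  hence f: "(f has_integral sqrt pi) {0..}"
    by (simp add: f_def[abs_def] Gamma_one_half_real exp_minus field_simps)
  hence "f absolutely_integrable_on {0..}"
    by (intro nonnegative_absolutely_integrable_1) (auto simp: f_def integrable_on_def)
  moreover have "(\<lambda>t. a * t) ` {0..} = {0..}"
  proof (intro equalityI subsetI)
    fix x :: real assume "x \<in> {0..}"
    thus "x \<in> (\<lambda>t. a * t) ` {0..}" using a by (intro image_eqI[of _ _ "x / a"]) auto
  qed (use a in auto)
  ultimately have "f absolutely_integrable_on ((\<lambda>t. a * t) ` {0..}) \<and> integral ((\<lambda>t. a * t) ` {0..}) f = sqrt pi"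
    using f by (simp add: integral_unique)
  hence "(\<lambda>t. \<bar>a\<bar> * f (a * t)) absolutely_integrable_on {0..} \<and>
         integral {0..} (\<lambda>t. \<bar>a\<bar> * f (a * t)) = sqrt pi"
    by (subst has_absolute_integral_change_of_variables_1')
       (use a in \<open>auto intro!: derivative_eq_intros simp: inj_on_def\<close>)
  hence "((\<lambda>t. \<bar>a\<bar> * f (a * t)) has_integral sqrt pi) {0..}"
    by (metis has_integral_integral set_lebesgue_integral_eq_integral(1))
  hence "((\<lambda>t. (1 / sqrt a) * (\<bar>a\<bar> * f (a * t))) has_integral (1 / sqrt a) * sqrt pi) {0..}"
    by (rule has_integral_mult_right)
  moreover have "(1 / sqrt a) * (\<bar>a\<bar> * f (a * t)) = t powr (-1/2) * exp (- a * t)" if "t \<in> {0..}" for t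
  proof -
    have "(a * t) powr (-1/2) = a powr (-1/2) * t powr (-1/2)" using a that by (simp add: powr_mult)
    moreover have "a * a powr (-1/2) / sqrt a = 1"
      using a by (simp add: powr_minus powr_half_sqrt field_simps)
    ultimately show ?thesis using a by (simp add: f_def field_simps)
  qed
  ultimately show ?thesis by (subst has_integral_cong[symmetric]) (auto simp: mult.commute)
qed


section \<open>Continuation of Dirichlet series with periodic coefficients of mean zero\<close>

lemma norm_powr_diff_le:
  fixes w :: complex
  assumes N: "N \<ge> 1" "x \<ge> N" and w: "Re w \<ge> 1/4" "norm w \<le> R"
  shows "norm (of_real x powr (-w) - of_real N powr (-w)) \<le> R * N powr (-5/4) * (x - N)"
proof -
  have R: "R \<ge> 0" using w(2) norm_ge_zero[of w] by linarith
  define S where "S = closed_segment (complex_of_real N) (of_real x)"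
  have S_eq: "S = complex_of_real ` {N..x}"
    using N by (simp add: S_def closed_segment_of_real closed_segment_eq_real_ivl)
  have "norm (complex_of_real x powr (-w) - of_real N powr (-w)) \<le>
      (R * N powr (-5/4)) * norm (complex_of_real x - of_real N)"
  proof (rule field_differentiable_bound[of S])
    fix z assume "z \<in> S"
    then obtain y where y: "z = of_real y" "y \<ge> N" by (auto simp: S_eq)
    show "((\<lambda>z. z powr (-w)) has_field_derivative (-w) * z powr (-w - 1)) (at z within S)"
      by (rule has_field_derivative_at_within[OF has_field_derivative_powr]) (use y N in simp)
    have "norm ((-w) * z powr (-w - 1)) = norm w * y powr (- Re w - 1)"
      using y N by (simp add: norm_mult norm_powr_real_powr)
    also have "\<dots> \<le> R * N powr (-5/4)"
    proof (intro mult_mono)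
      have "y powr (- Re w - 1) \<le> y powr (-5/4)" using y N w by (intro powr_mono) auto
      also have "\<dots> \<le> N powr (-5/4)" using y N by (intro powr_mono2') auto
      finally show "y powr (- Re w - 1) \<le> N powr (-5/4)" .
    qed (use w R in auto)
    finally show "norm ((-w) * z powr (-w - 1)) \<le> R * N powr (-5/4)" .
  qed (auto simp: S_def)
  also have "norm (complex_of_real x - of_real N) = x - N"
    using N by (simp flip: of_real_diff)
  finally show ?thesis .
qed

context
  fixes c :: "nat \<Rightarrow> complex" and d :: nat
  assumes d_pos: "d > 0" and periodic: "\<And>k n. c (k * d + n) = c n"
    and norm_c: "\<And>n. norm (c n) \<le> 1" and sum_c: "(\<Sum>j<d. c (Suc j)) = 0"
begin

text \<open>The coefficients of one period sum to 0, so the power at the start of the block may be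
  subtracted from every term. The differences gain one power of the index, and 1/4 + 1 = 5/4 is
  summable.\<close>

lemma norm_period_block_le:
  assumes w: "Re w \<ge> 1/4" "norm w \<le> R"
  shows "norm (\<Sum>j<d. c (Suc j) * of_nat (k * d + Suc j) powr (-w)) \<le>
    R * real d ^ 2 * real (Suc k) powr (-5/4)"
proof -
  define N where "N = real (k * d + 1)"
  have R: "R \<ge> 0" using w norm_ge_zero[of w] by linarith
  have "k \<le> k * d" using d_pos by simp
  hence "Suc k \<le> k * d + 1" by simp
  hence N: "N \<ge> real (Suc k)" unfolding N_def of_nat_le_iff .
  hence N1: "N \<ge> 1" by simp
  have "(\<Sum>j<d. c (Suc j) * of_nat (k * d + Suc j) powr (-w)) =
        (\<Sum>j<d. c (Suc j) * (of_nat (k * d + Suc j) powr (-w) - of_real N powr (-w)))"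
    by (simp only: right_diff_distrib sum_subtractf sum_distrib_right[symmetric] sum_c) simp
  also have "norm \<dots> \<le> (\<Sum>j<d. R * real (Suc k) powr (-5/4) * real d)"
  proof (intro sum_norm_le)
    fix j assume j: "j \<in> {..<d}"
    define x where "x = real (k * d + Suc j)"
    have "norm (of_real x powr (-w) - of_real N powr (-w)) \<le> R * N powr (-5/4) * (x - N)"
      using N1 w by (intro norm_powr_diff_le) (auto simp: x_def N_def)
    also have "\<dots> \<le> R * real (Suc k) powr (-5/4) * real d"
      using R N j by (intro mult_mono powr_mono2') (auto simp: x_def N_def)
    finally have "norm (c (Suc j)) * norm (of_real x powr (-w) - of_real N powr (-w)) \<le>
        1 * (R * real (Suc k) powr (-5/4) * real d)"
      using norm_c R by (intro mult_mono) auto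
    thus "norm (c (Suc j) * (of_nat (k * d + Suc j) powr (-w) - of_real N powr (-w))) \<le>
        R * real (Suc k) powr (-5/4) * real d"
      by (simp add: norm_mult x_def)
  qed
  also have "\<dots> = R * real d ^ 2 * real (Suc k) powr (-5/4)" by (simp add: power2_eq_square)
  finally show ?thesis .
qed

lemma summable_Suc_powr: "summable (\<lambda>k. C * real (Suc k) powr (-5/4))"
proof -
  have "summable (\<lambda>k. real k powr (-5/4))" by (subst summable_real_powr_iff) simp
  hence "summable (\<lambda>k. real (Suc k) powr (-5/4))" by (subst summable_Suc_iff)
  thus ?thesis by (rule summable_mult)
qed

text \<open>Summed period by period, the series converges locally uniformly for Re w > 1/4, a
  half-plane containing 1/2. For Re w > 1 the grouping does not change the absolutely convergent
  sum.\<close>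

lemma periodic_L_continuation:
  "dirichlet_L_continuation c (1/4) (1/2)
     (\<lambda>w. \<Sum>k. \<Sum>j<d. c (Suc j) * of_nat (k * d + Suc j) powr (-w))"
proof -
  define b where "b k w = (\<Sum>j<d. c (Suc j) * of_nat (k * d + Suc j) powr (-w))" for k w
  define S where "S = {w. 1/4 < Re w}"
  have "(\<lambda>w. \<Sum>k. b k w) holomorphic_on S"
  proof (rule holomorphic_uniform_sequence)
    show "open S" unfolding S_def by (rule open_halfspace_Re_gt)
    show "(\<lambda>w. \<Sum>k<n. b k w) holomorphic_on S" for n
      unfolding b_def by (intro holomorphic_intros)
    fix x assume x: "x \<in> S"
    \<comment> \<open>Half the distance from \<open>x\<close> to the line Re w = 1/4; the closed
      ball then stays at distance at least \<open>e\<close> from that line.\<close>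
    define e where "e = (Re x - 1/4) / 2"
    define R where "R = norm x + e"
    have e: "e > 0" using x by (simp add: e_def S_def)
    have ball: "Re w \<ge> 1/4 + e" "norm w \<le> R" if "w \<in> cball x e" for w
    proof -
      have "norm (w - x) \<le> e" using that by (simp add: dist_norm norm_minus_commute)
      thus "norm w \<le> R" using norm_triangle_sub[of w x] by (simp add: R_def)
      have "\<bar>Re (w - x)\<bar> \<le> e" using \<open>norm (w - x) \<le> e\<close> abs_Re_le_cmod order_trans by blast
      hence "Re w \<ge> Re x - e" by (simp add: abs_le_iff)
      moreover have "Re x = 1/4 + 2 * e" by (simp add: e_def field_simps)
      ultimately show "Re w \<ge> 1/4 + e" by linarith
    qed
    have "uniform_limit (cball x e) (\<lambda>n w. \<Sum>k<n. b k w) (\<lambda>w. \<Sum>k. b k w) sequentially"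
    proof (rule Weierstrass_m_test)
      fix k w assume "w \<in> cball x e"
      thus "norm (b k w) \<le> R * real d ^ 2 * real (Suc k) powr (-5/4)"
        unfolding b_def using ball[of w] e by (intro norm_period_block_le) auto
    qed (rule summable_Suc_powr)
    moreover have "cball x e \<subseteq> S"
    proof
      fix w assume "w \<in> cball x e"
      thus "w \<in> S" using ball(1)[of w] e unfolding S_def mem_Collect_eq by linarith
    qed
    ultimately show "\<exists>e>0. cball x e \<subseteq> S \<and>
        uniform_limit (cball x e) (\<lambda>n w. \<Sum>k<n. b k w) (\<lambda>w. \<Sum>k. b k w) sequentially"
      using e by blast
  qed
  hence hol: "(\<lambda>w. \<Sum>k. b k w) holomorphic_on insert (1/2) ({w. 1/4 < Re w} - {1})"
    by (rule holomorphic_on_subset) (auto simp: S_def)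
  have "(\<lambda>n. c (Suc n) / of_nat (Suc n) powr w) sums (\<Sum>k. b k w)" if w: "Re w > 1" for w
  proof -
    have "summable (\<lambda>n. c (Suc n) / of_nat (Suc n) powr w)"
    proof (rule summable_comparison_test')
      have "summable (\<lambda>k. real k powr (- Re w))" using w by (subst summable_real_powr_iff) simp
      thus "summable (\<lambda>k. real (Suc k) powr (- Re w))" by (subst summable_Suc_iff)
      fix n :: nat
      have "norm (c (Suc n) / of_nat (Suc n) powr w) = norm (c (Suc n)) * real (Suc n) powr (- Re w)"
        by (simp add: norm_mult norm_inverse norm_powr_real_powr powr_minus divide_inverse del: of_nat_Suc)
      also have "\<dots> \<le> 1 * real (Suc n) powr (- Re w)" by (intro mult_right_mono norm_c) auto
      finally show "norm (c (Suc n) / of_nat (Suc n) powr w) \<le> real (Suc n) powr (- Re w)" by simp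
    qed
    then obtain s where s: "(\<lambda>n. c (Suc n) / of_nat (Suc n) powr w) sums s" by (auto simp: summable_def)
    have "(\<lambda>k. \<Sum>n\<in>{k * d..<k * d + d}. c (Suc n) / of_nat (Suc n) powr w) sums s"
      by (rule sums_group[OF s d_pos])
    moreover have "(\<Sum>n\<in>{k * d..<k * d + d}. c (Suc n) / of_nat (Suc n) powr w) = b k w" for k
    proof -
      have "(\<Sum>n\<in>{k * d..<k * d + d}. c (Suc n) / of_nat (Suc n) powr w) =
            (\<Sum>j<d. c (k * d + Suc j) / of_nat (k * d + Suc j) powr w)"
        by (rule sum.reindex_bij_witness[of _ "\<lambda>j. k * d + j" "\<lambda>n. n - k * d"]) auto
      also have "\<dots> = b k w" unfolding b_def periodic
        by (intro sum.cong refl) (simp add: powr_minus divide_inverse)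
      finally show ?thesis .
    qed
    ultimately have "(\<lambda>k. b k w) sums s" by simp
    hence "s = (\<Sum>k. b k w)" by (rule sums_unique)
    thus ?thesis using s by (simp only:)
  qed
  with hol show ?thesis unfolding dirichlet_L_continuation_def b_def by simp
qed

end

section \<open>The exponential series of the character and its dual form\<close>

lemma exp_ratio_eq_cot:
  fixes z :: complex
  assumes "exp (2 * of_real pi * \<i> * z) \<noteq> 1"
  shows "exp (2 * of_real pi * \<i> * z) / (1 - exp (2 * of_real pi * \<i> * z)) =
    (\<i> * cot (of_real pi * z) - 1) / 2"
proof -
  define u where "u = exp (\<i> * (of_real pi * z))"
  have u: "u \<noteq> 0" by (simp add: u_def)
  have q: "exp (2 * of_real pi * \<i> * z) = u\<^sup>2"
    by (simp add: u_def power2_eq_square mult_ac flip: exp_add)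
  have inv_u: "exp (- (\<i> * (of_real pi * z))) = 1 / u" by (simp add: u_def exp_minus divide_inverse)
  have nz: "1 - u\<^sup>2 \<noteq> 0" using assms q by simp
  have "sin (of_real pi * z) = (u - 1 / u) / (2 * \<i>)"
    using inv_u by (simp add: sin_exp_eq u_def)
  moreover have "cos (of_real pi * z) = (u + 1 / u) / 2"
    using inv_u by (simp add: cos_exp_eq u_def)
  moreover have "(A / 2) / (B / (2 * \<i>)) = \<i> * A / B" for A B :: complex
    by (cases "B = 0") (simp_all add: field_simps)
  ultimately have "cot (of_real pi * z) = \<i> * (u + 1 / u) / (u - 1 / u)"
    by (simp only: cot_def)
  also have "u + 1 / u = (u\<^sup>2 + 1) / u" using u by (simp add: field_simps power2_eq_square)
  also have "u - 1 / u = (u\<^sup>2 - 1) / u" using u by (simp add: field_simps power2_eq_square)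
  finally have "cot (of_real pi * z) = \<i> * (u\<^sup>2 + 1) / (u\<^sup>2 - 1)" using u by simp
  hence "\<i> * cot (of_real pi * z) = - (u\<^sup>2 + 1) / (u\<^sup>2 - 1)" by simp
  also have "\<dots> = (1 + u\<^sup>2) / (1 - u\<^sup>2)"
    by (metis add.commute minus_diff_eq minus_divide_divide minus_minus)
  finally have "(\<i> * cot (of_real pi * z) - 1) / 2 = ((1 + u\<^sup>2) / (1 - u\<^sup>2) - 1) / 2" by simp
  also have "\<dots> = u\<^sup>2 / (1 - u\<^sup>2)" using nz by (simp add: field_simps)
  finally show ?thesis unfolding q ..
qed

text \<open>
  The lower bound on \<open>d\<close> is an artefact of the crude estimates that determine the sign of the Gauss
  sum.
\<close>
locale real_character =
  fixes d :: nat
  assumes sqf: "squarefree d" and d8: "d mod 8 = 1" and d_ge: "d \<ge> 10000"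
begin

definition chi :: "nat \<Rightarrow> int" where
  "chi n = jacobi (int n) d"

lemma d_pos: "d > 0"
  using d_ge by simp

lemma odd_d: "odd d"
  using d8 by presburger

lemma chi_cong: "[int m = int n] (mod int d) \<Longrightarrow> chi m = chi n"
  unfolding chi_def by (rule jacobi_cong[OF _ d_pos])

lemma chi_periodic: "chi (k * d + n) = chi n"
  by (rule chi_cong) (simp add: cong_def)

lemma chi_0 [simp]: "chi 0 = 0"
  using d_ge by (simp add: chi_def jacobi_eq_0_iff)

lemma chi_d [simp]: "chi d = 0"
  using chi_periodic[of 1 0] by simp

lemma abs_chi_le: "\<bar>chi n\<bar> \<le> 1"
  by (simp add: chi_def jacobi_abs_le_1)

lemma chi_reflect:
  assumes "a \<le> d"
  shows "chi (d - a) = chi a"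
proof -
  have "[int (d - a) = -1 * int a] (mod int d)"
    using assms by (simp add: cong_iff_dvd_diff of_nat_diff)
  hence "chi (d - a) = jacobi (-1 * int a) d" unfolding chi_def by (rule jacobi_cong[OF _ d_pos])
  also have "\<dots> = jacobi (-1) d * chi a" unfolding jacobi_mult_left chi_def ..
  also have "jacobi (-1) d = 1" using d8 mod_mod_cancel[of 4 8 d] by (intro jacobi_minus_1) simp
  finally show ?thesis by simp
qed

lemma kronecker_eq_chi: "n > 0 \<Longrightarrow> kronecker (int d) n = chi n"
  unfolding chi_def by (rule kronecker_eq_jacobi[OF d8])

text \<open>The finite Fourier expansion of the character, with the sign of the Gauss sum resolved.
  This is how that sign reaches \<open>Phi_dual\<close>.\<close>

lemma sqrt_mult_chi:
  "of_real (sqrt d) * of_int (chi n) = (\<Sum>a\<in>{1..<d}. of_int (chi a) * e1 (real a * real n / real d))"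
proof -
  have "of_real (sqrt d) * of_int (chi n) = gauss_sum d (int n)"
    using gauss_sum_eq[OF sqf odd_d, of "int n"] gauss_sum_eq_sqrt[OF sqf d8 d_ge]
    by (simp add: chi_def mult.commute)
  also have "\<dots> = (\<Sum>a\<in>{0..<d}. of_int (chi a) * e1 (real a * real n / real d))"
    unfolding gauss_sum_def
    by (rule sum.reindex_bij_witness[of _ int nat]) (auto simp: chi_def)
  also have "{0..<d} = insert 0 {1..<d}" using d_pos by auto
  finally show ?thesis by simp
qed

lemma sum_chi_interior: "(\<Sum>a\<in>{1..<d}. chi a) = 0"
proof -
  have "complex_of_int (\<Sum>a\<in>{1..<d}. chi a) = 0" using sqrt_mult_chi[of 0] by simp
  thus ?thesis by (simp only: of_int_eq_0_iff)
qed

lemma sum_block_eq_interior: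
  fixes f :: "nat \<Rightarrow> 'a::comm_ring_1"
  shows "(\<Sum>j<d. of_int (chi (Suc j)) * f (Suc j)) = (\<Sum>a\<in>{1..<d}. of_int (chi a) * f a)"
proof -
  have "(\<Sum>j<d. of_int (chi (Suc j)) * f (Suc j)) = (\<Sum>a\<in>{1..d}. of_int (chi a) * f a)"
    by (rule sum.reindex_bij_witness[of _ "\<lambda>a. a - 1" Suc]) auto
  also have "{1..d} = insert d {1..<d}" using d_pos by auto
  finally show ?thesis by simp
qed

lemma sum_chi_block: "(\<Sum>j<d. chi (Suc j)) = 0"
  using sum_block_eq_interior[of "\<lambda>_. 1 :: int"] sum_chi_interior by simp

definition chi_poly :: "real \<Rightarrow> real" where
  "chi_poly t = (\<Sum>j<d. of_int (chi (Suc j)) * exp (- (real (Suc j) * t)))"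

text \<open>The closed form of the sum of chi(n) exp(-n t): by periodicity the periods form a
  geometric series, as \<open>Phi_sums\<close> confirms.\<close>

definition Phi :: "real \<Rightarrow> real" where
  "Phi t = chi_poly t / (1 - exp (- (real d * t)))"

text \<open>Since chi sums to 0 over a period, exp(-t) can be subtracted from each exponential. Each
  difference then carries the factor 1 - exp(-d t), which cancels the denominator and its zero at t
  = 0.\<close>

lemma abs_Phi_le:
  assumes t: "t > 0"
  shows "\<bar>chi_poly t\<bar> / (1 - exp (- (real d * t))) \<le> real d * exp (-t)" "1 - exp (- (real d * t)) > 0"
proof -
  show pos: "1 - exp (- (real d * t)) > 0" using t d_pos by simp
  have "chi_poly t = (\<Sum>j<d. of_int (chi (Suc j)) * (exp (- (real (Suc j) * t)) - exp (- t)))"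
    using sum_chi_block by (simp add: chi_poly_def right_diff_distrib sum_subtractf
        sum_distrib_right[symmetric] of_int_sum[symmetric] del: of_int_sum)
  also have "\<bar>\<dots>\<bar> \<le> (\<Sum>j<d. exp (-t) * (1 - exp (- (real d * t))))"
  proof (intro order_trans[OF sum_abs] sum_mono)
    fix j assume j: "j \<in> {..<d}"
    have eq: "exp (- (real (Suc j) * t)) - exp (- t) = - (exp (-t) * (1 - exp (- (real j * t))))"
      by (simp add: algebra_simps flip: exp_add)
    have "real j * t \<le> real d * t" using j t by (intro mult_right_mono) auto
    hence *: "exp (- (real d * t)) \<le> exp (- (real j * t))" "exp (- (real j * t)) \<le> 1" using t by auto
    have "\<bar>of_int (chi (Suc j)) * (exp (- (real (Suc j) * t)) - exp (- t))\<bar> \<le>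
        1 * (exp (-t) * (1 - exp (- (real d * t))))"
      unfolding abs_mult eq abs_minus_cancel using * abs_chi_le[of "Suc j"]
      by (intro mult_mono) (auto simp flip: of_int_abs)
    thus "\<bar>of_int (chi (Suc j)) * (exp (- (real (Suc j) * t)) - exp (- t))\<bar> \<le>
        exp (-t) * (1 - exp (- (real d * t)))" by simp
  qed
  finally show "\<bar>chi_poly t\<bar> / (1 - exp (- (real d * t))) \<le> real d * exp (-t)"
    using pos by (simp add: field_simps)
qed

lemma sum_blocks_eq:
  "(\<Sum>k<K. \<Sum>j<d. of_int (chi (Suc j)) * exp (- (real (k * d + Suc j) * t))) =
    chi_poly t * (\<Sum>k<K. exp (- (real d * t)) ^ k)"
proof -
  have "exp (- (real (k * d + Suc j) * t)) = exp (- (real (Suc j) * t)) * exp (- (real d * t)) ^ k" for k j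
    by (simp add: algebra_simps flip: exp_add exp_of_nat_mult)
  thus ?thesis
    unfolding chi_poly_def sum_distrib_left sum_distrib_right by (simp add: mult.assoc)
qed

lemma Phi_sums:
  assumes t: "t > 0"
  shows "(\<lambda>n. of_int (chi (Suc n)) * exp (- (real (Suc n) * t))) sums Phi t"
proof -
  let ?f = "\<lambda>n. of_int (chi (Suc n)) * exp (- (real (Suc n) * t))"
  have "summable ?f"
  proof (rule summable_comparison_test')
    show "summable (\<lambda>n. exp (-t) ^ Suc n)"
      using t by (subst summable_Suc_iff) (auto intro: summable_geometric)
    fix n :: nat
    have "\<bar>of_int (chi (Suc n)) * exp (- (real (Suc n) * t))\<bar> \<le> 1 * exp (- (real (Suc n) * t))"
      unfolding abs_mult using abs_chi_le[of "Suc n"] by (intro mult_mono) (auto simp flip: of_int_abs)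
    moreover have "exp (-t) ^ Suc n = exp (- (real (Suc n) * t))"
      by (simp only: exp_of_nat_mult[symmetric] mult_minus_right)
    ultimately show "norm (?f n) \<le> exp (-t) ^ Suc n" by (simp only: real_norm_def mult_1)
  qed
  then obtain s where s: "?f sums s" by (auto simp: summable_def)
  have "(\<lambda>k. \<Sum>n\<in>{k * d..<k * d + d}. ?f n) sums s" by (rule sums_group[OF s d_pos])
  moreover have "(\<Sum>n\<in>{k * d..<k * d + d}. ?f n) = chi_poly t * exp (- (real d * t)) ^ k" for k
  proof -
    have "(\<Sum>n\<in>{k * d..<k * d + d}. ?f n) =
          (\<Sum>j<d. of_int (chi (k * d + Suc j)) * exp (- (real (k * d + Suc j) * t)))"
      by (rule sum.reindex_bij_witness[of _ "\<lambda>j. k * d + j" "\<lambda>n. n - k * d"]) auto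
    also have "\<dots> = chi_poly t * exp (- (real d * t)) ^ k"
      unfolding chi_periodic chi_poly_def sum_distrib_right
      by (intro sum.cong refl) (simp add: algebra_simps flip: exp_add exp_of_nat_mult)
    finally show ?thesis .
  qed
  ultimately have "(\<lambda>k. chi_poly t * exp (- (real d * t)) ^ k) sums s" by simp
  moreover have "(\<lambda>k. chi_poly t * exp (- (real d * t)) ^ k) sums (chi_poly t * (1 / (1 - exp (- (real d * t)))))"
    using t d_pos by (intro sums_mult geometric_sums) auto
  ultimately have "s = Phi t" by (simp add: sums_unique2 Phi_def)
  thus ?thesis using s by simp
qed

text \<open>Cutting the series after \<open>K\<close> full periods multiplies \<open>Phi t\<close>
  by 1 - exp(-d t)^K, so all cut integrands are dominated by d t^(-1/2) exp(-t). Their integrals are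
  sqrt pi times the partial sums of the grouped series that defines the continuation at 1/2.\<close>

theorem L_half_eq_integral:
  shows "(\<lambda>t. t powr (-1/2) * Phi t) integrable_on {0..}"
    and "sqrt pi * Re (L_kronecker (int d) (1/2)) = integral {0..} (\<lambda>t. t powr (-1/2) * Phi t)"
proof -
  define g where "g k = (\<Sum>j<d. of_int (chi (Suc j)) / sqrt (real (k * d + Suc j)))" for k
  define f where "f K t = t powr (-1/2) *
      (\<Sum>k<K. \<Sum>j<d. of_int (chi (Suc j)) * exp (- (real (k * d + Suc j) * t)))" for K t
  have f_int: "(f K has_integral sqrt pi * (\<Sum>k<K. g k)) {0..}" for K
  proof -
    have "((\<lambda>t. \<Sum>k<K. \<Sum>j<d. of_int (chi (Suc j)) * (t powr (-1/2) * exp (- real (k * d + Suc j) * t)))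
        has_integral (\<Sum>k<K. \<Sum>j<d. of_int (chi (Suc j)) * (sqrt pi / sqrt (real (k * d + Suc j))))) {0..}"
      by (intro has_integral_sum has_integral_mult_right has_integral_powr_exp) (auto intro: add_pos_nonneg)
    moreover have "(\<lambda>t. \<Sum>k<K. \<Sum>j<d. of_int (chi (Suc j)) * (t powr (-1/2) * exp (- real (k * d + Suc j) * t))) = f K"
      by (intro ext) (simp only: f_def sum_distrib_left mult_minus_left mult.left_commute)
    moreover have "(\<Sum>k<K. \<Sum>j<d. of_int (chi (Suc j)) * (sqrt pi / sqrt (real (k * d + Suc j)))) =
        sqrt pi * (\<Sum>k<K. g k)"
      by (simp only: g_def sum_distrib_left times_divide_eq_right mult.commute)
    ultimately show ?thesis by (simp only:)
  qed
  define h where "h t = real d * (t powr (-1/2) * exp (- 1 * t))" for t :: real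
  have h: "h integrable_on {0..}"
    unfolding h_def using has_integral_powr_exp[of 1]
    by (intro integrable_on_mult_right) (auto simp: integrable_on_def)
  have f_eq: "f K t = t powr (-1/2) * (Phi t * (1 - exp (- (real d * t)) ^ K))" for K t
  \<comment> \<open>At 0 both sides vanish, since \<open>0 powr (-1/2)\<close> is 0.\<close>
  proof (cases "t = 0")
    case False
    hence ne: "exp (- (real d * t)) \<noteq> 1" using d_pos by simp
    have "(\<Sum>k<K. exp (- (real d * t)) ^ k) = (1 - exp (- (real d * t)) ^ K) / (1 - exp (- (real d * t)))"
      using ne by (simp add: sum_gp_strict)
    thus ?thesis unfolding f_def sum_blocks_eq Phi_def by simp
  qed (simp add: f_def)
  have le: "norm (f K t) \<le> h t" if "t \<in> {0..}" for K and t :: real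
  proof -
    show ?thesis
    proof (cases "t = 0")
      case False
      hence t: "t > 0" using that by simp
      have E: "0 \<le> exp (- (real d * t)) ^ K" "exp (- (real d * t)) ^ K \<le> 1" using t by (auto intro!: power_le_one)
      have "\<bar>Phi t\<bar> \<le> real d * exp (-t)" using abs_Phi_le[OF t] by (simp add: Phi_def abs_divide)
      hence "\<bar>Phi t\<bar> * \<bar>1 - exp (- (real d * t)) ^ K\<bar> \<le> real d * exp (-t) * 1"
        using E by (intro mult_mono) auto
      hence "t powr (-1/2) * (\<bar>Phi t\<bar> * \<bar>1 - exp (- (real d * t)) ^ K\<bar>) \<le> t powr (-1/2) * (real d * exp (-t) * 1)"
        by (intro mult_left_mono) auto
      thus ?thesis by (simp add: f_eq h_def abs_mult mult_ac)
    qed (simp add: f_def h_def)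
  qed
  have lim: "(\<lambda>K. f K t) \<longlonglongrightarrow> t powr (-1/2) * Phi t" if "t \<in> {0..}" for t :: real
  proof -
    show ?thesis
    proof (cases "t = 0")
      case False
      hence "exp (- (real d * t)) < 1" using that d_pos by simp
      hence "(\<lambda>K. exp (- (real d * t)) ^ K) \<longlonglongrightarrow> 0" by (intro LIMSEQ_realpow_zero) auto
      hence "(\<lambda>K. t powr (-1/2) * (Phi t * (1 - exp (- (real d * t)) ^ K))) \<longlonglongrightarrow>
          t powr (-1/2) * (Phi t * (1 - 0))" by (intro tendsto_mult tendsto_diff tendsto_const)
      thus ?thesis by (simp add: f_eq[abs_def])
    qed (simp add: f_def)
  qed
  have f_integrable: "f K integrable_on {0..}" for K using f_int by (auto simp: integrable_on_def)
  note conv = dominated_convergence[OF f_integrable h le lim]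
  show "(\<lambda>t. t powr (-1/2) * Phi t) integrable_on {0..}" by (rule conv(1))
  have "(\<lambda>K. sqrt pi * (\<Sum>k<K. g k)) \<longlonglongrightarrow> integral {0..} (\<lambda>t. t powr (-1/2) * Phi t)"
    using conv(2) integral_unique[OF f_int] by (simp only:)
  hence "(\<lambda>K. (1 / sqrt pi) * (sqrt pi * (\<Sum>k<K. g k))) \<longlonglongrightarrow>
      (1 / sqrt pi) * integral {0..} (\<lambda>t. t powr (-1/2) * Phi t)" by (rule tendsto_mult_left)
  hence g_sums: "g sums ((1 / sqrt pi) * integral {0..} (\<lambda>t. t powr (-1/2) * Phi t))"
    by (simp add: sums_def)
  define c where "c n = (of_int (chi n) :: complex)" for n
  have "dirichlet_L_continuation c (1/4) (1/2)
     (\<lambda>w. \<Sum>k. \<Sum>j<d. c (Suc j) * of_nat (k * d + Suc j) powr (-w))"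
  proof (rule periodic_L_continuation[OF d_pos])
    show "c (k * d + n) = c n" for k n by (simp add: c_def chi_periodic)
    show "norm (c n) \<le> 1" for n using abs_chi_le[of n] by (simp add: c_def flip: of_int_abs)
    show "(\<Sum>j<d. c (Suc j)) = 0" using sum_chi_block by (simp add: c_def flip: of_int_sum)
  qed
  hence "dirichlet_L_continuation (\<lambda>n. of_int (kronecker (int d) n)) (1/4) (1/2)
     (\<lambda>w. \<Sum>k. \<Sum>j<d. c (Suc j) * of_nat (k * d + Suc j) powr (-w))"
    by (simp add: dirichlet_L_continuation_def c_def kronecker_eq_chi)
  hence "L_kronecker (int d) (1/2) = (\<Sum>k. \<Sum>j<d. c (Suc j) * of_nat (k * d + Suc j) powr (-(1/2)))"
    by (rule dirichlet_L_eqI)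
  also have "(\<lambda>k. \<Sum>j<d. c (Suc j) * of_nat (k * d + Suc j) powr (-(1/2))) = (\<lambda>k. complex_of_real (g k))"
  proof (intro ext)
    fix k
    have "complex_of_nat m powr (-(1/2)) = of_real (1 / sqrt (real m))" if "m > 0" for m
    proof -
      have "complex_of_nat m powr (-(1/2)) = complex_of_real (real m powr (-(1/2)))"
        using powr_of_real[of "real m" "-(1/2)"] by simp
      also have "real m powr (-(1/2)) = 1 / sqrt (real m)"
        by (simp only: powr_minus_divide powr_half_sqrt of_nat_0_le_iff)
      finally show ?thesis .
    qed
    thus "(\<Sum>j<d. c (Suc j) * of_nat (k * d + Suc j) powr (-(1/2))) = complex_of_real (g k)"
      unfolding g_def of_real_sum by (intro sum.cong refl) (simp add: c_def del: of_nat_add of_nat_Suc)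
  qed
  also have "(\<Sum>k. complex_of_real (g k)) = of_real ((1 / sqrt pi) * integral {0..} (\<lambda>t. t powr (-1/2) * Phi t))"
    using sums_of_real[OF g_sums] by (rule sums_unique[symmetric])
  finally show "sqrt pi * Re (L_kronecker (int d) (1/2)) = integral {0..} (\<lambda>t. t powr (-1/2) * Phi t)"
    by simp
qed

lemma summable_dual: "summable (\<lambda>n. of_int (chi (Suc n)) / (real (Suc n) ^ 2 + y\<^sup>2) :: real)"
proof (rule summable_comparison_test')
  have "summable (\<lambda>n. 1 / real n ^ 2)" using inverse_power_summable[of 2, where 'a = real] by (simp add: divide_inverse)
  thus "summable (\<lambda>n. 1 / real (Suc n) ^ 2)" by (subst summable_Suc_iff)
  fix n :: nat
  have "norm (of_int (chi (Suc n)) / (real (Suc n) ^ 2 + y\<^sup>2)) \<le> 1 / (real (Suc n) ^ 2 + y\<^sup>2)"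
    using abs_chi_le[of "Suc n"] unfolding norm_divide by (intro frac_le) (auto simp flip: of_int_abs intro: add_pos_nonneg)
  also have "\<dots> \<le> 1 / real (Suc n) ^ 2" by (intro divide_left_mono) (auto intro!: mult_pos_pos add_pos_nonneg)
  finally show "norm (of_int (chi (Suc n)) / (real (Suc n) ^ 2 + y\<^sup>2)) \<le> 1 / real (Suc n) ^ 2" .
qed

text \<open>The functional equation for \<open>Phi\<close>. Inserting the Fourier expansion of chi
  makes the sum over n geometric in q = e(a/d) exp(-t), whose value is a cotangent at a/d + i t/(2
  pi). Its partial fractions recombine to a series over n with the kernel y/(n^2 + y^2). This kernel
  is positive, so the signs of the dual terms are those of chi.\<close>

theorem Phi_dual:
  assumes t: "t > 0"
  defines "y \<equiv> real d * t / (2 * pi)"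
  shows "Phi t = sqrt d * y / pi * (\<Sum>n. of_int (chi (Suc n)) / (real (Suc n) ^ 2 + y\<^sup>2))"
proof -
  define D where "D = {1..<d}"
  define z where "z a = of_real (real a / real d) + \<i> * of_real (t / (2 * pi))" for a
  define q where "q a = exp (2 * of_real pi * \<i> * z a)" for a
  define S where "S = (\<Sum>n. of_int (chi (Suc n)) / (real (Suc n) ^ 2 + y\<^sup>2))"
  have y: "y > 0" using t d_pos by (simp add: y_def)
  have q_eq: "q a = e1 (real a / real d) * of_real (exp (-t))" for a
  proof -
    have "2 * of_real pi * \<i> * z a = \<i> * of_real (2 * pi * (real a / real d)) + of_real (-t)"
      by (simp add: z_def algebra_simps)
    hence "q a = exp (\<i> * of_real (2 * pi * (real a / real d))) * exp (of_real (-t))"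
      by (simp only: q_def exp_add)
    thus ?thesis by (simp only: e1_def cis_conv_exp exp_of_real)
  qed
  have norm_q: "norm (q a) < 1" for a using t by (simp add: q_eq norm_mult)
  have z_nint: "z a \<notin> \<int>" if "a \<in> D" for a
  proof
    assume "z a \<in> \<int>"
    then obtain m where "z a = of_int m" by (auto elim: Ints_cases)
    hence "Im (z a) = 0" by simp
    thus False using t by (simp add: z_def)
  qed
  have "(\<lambda>n. of_real (sqrt d) * of_real (of_int (chi (Suc n)) * exp (- (real (Suc n) * t))) :: complex)
      sums (of_real (sqrt d) * of_real (Phi t))"
    by (intro sums_mult sums_of_real Phi_sums t)
  moreover have "of_real (sqrt d) * of_real (of_int (chi (Suc n)) * exp (- (real (Suc n) * t))) =
      (\<Sum>a\<in>D. of_int (chi a) * q a ^ Suc n)" for n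
  proof -
    have "q a ^ Suc n = e1 (real a * real (Suc n) / real d) * of_real (exp (- (real (Suc n) * t)))" for a
    proof -
      have "e1 (real a / real d) ^ Suc n = e1 (real (Suc n) * (real a / real d))"
        unfolding e1_def by (subst Complex.DeMoivre) (simp add: mult_ac)
      moreover have "exp (-t) ^ Suc n = exp (- (real (Suc n) * t))"
        by (simp only: exp_of_nat_mult[symmetric] mult_minus_right)
      moreover have "q a ^ Suc n = e1 (real a / real d) ^ Suc n * of_real (exp (-t) ^ Suc n)"
        by (simp only: q_eq power_mult_distrib of_real_power)
      ultimately show ?thesis by (simp only: mult_ac times_divide_eq_right)
    qed
    moreover have "complex_of_real (sqrt d) * of_real (of_int (chi (Suc n)) * exp (- (real (Suc n) * t))) =
        (of_real (sqrt d) * of_int (chi (Suc n))) * of_real (exp (- (real (Suc n) * t)))" by simp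
    ultimately show ?thesis
      by (simp only: sqrt_mult_chi D_def sum_distrib_right mult.assoc)
  qed
  moreover have "(\<lambda>n. \<Sum>a\<in>D. of_int (chi a) * q a ^ Suc n) sums
      (\<Sum>a\<in>D. of_int (chi a) * (q a * (1 / (1 - q a))))"
    unfolding power_Suc by (intro sums_sum sums_mult geometric_sums norm_q)
  ultimately have "of_real (sqrt d) * of_real (Phi t) = (\<Sum>a\<in>D. of_int (chi a) * (q a * (1 / (1 - q a))))"
    by (simp add: sums_unique2)
  also have "\<dots> = (\<Sum>a\<in>D. \<i> / (2 * of_real pi) * (of_int (chi a) * (of_real pi * cot (of_real pi * z a))) -
       of_int (chi a) / 2)"
  proof (intro sum.cong refl)
    fix a
    have "q a \<noteq> 1" using norm_q[of a] by auto
    hence eq: "q a * (1 / (1 - q a)) = (\<i> * cot (of_real pi * z a) - 1) / 2"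
      using exp_ratio_eq_cot[of "z a"] by (simp add: q_def)
    show "of_int (chi a) * (q a * (1 / (1 - q a))) =
       \<i> / (2 * of_real pi) * (of_int (chi a) * (of_real pi * cot (of_real pi * z a))) - of_int (chi a) / 2"
      unfolding eq by (simp add: field_simps)
  qed
  \<comment> \<open>The constants -1/2 from the cotangent form drop out, as chi sums to 0.\<close>
  also have "\<dots> = \<i> / (2 * of_real pi) * (\<Sum>a\<in>D. of_int (chi a) * (of_real pi * cot (of_real pi * z a)))"
  proof -
    have "(\<Sum>a\<in>D. of_int (chi a) / 2 :: complex) = 0"
      using sum_chi_interior unfolding D_def sum_divide_distrib[symmetric] of_int_sum[symmetric] by simp
    thus ?thesis by (simp add: sum_subtractf sum_distrib_left)
  qed
  also have "(\<Sum>a\<in>D. of_int (chi a) * (of_real pi * cot (of_real pi * z a))) =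
      of_real (S) * (- 2 * \<i> * of_real (real d * y))"
  proof -
    have "(\<lambda>k. \<Sum>a\<in>D. of_int (chi a) * (inverse (z a + of_nat k) - inverse (1 - z a + of_nat k))) sums
        (\<Sum>a\<in>D. of_int (chi a) * (of_real pi * cot (of_real pi * z a)))"
      by (intro sums_sum sums_mult cot_partial_fractions z_nint)
    moreover have "(\<Sum>a\<in>D. of_int (chi a) * (inverse (z a + of_nat k) - inverse (1 - z a + of_nat k))) =
        of_real (\<Sum>n\<in>{k * d..<k * d + d}. of_int (chi (Suc n)) / (real (Suc n) ^ 2 + y\<^sup>2)) *
          (- 2 * \<i> * of_real (real d * y))" for k
    proof -
      \<comment> \<open>\<open>w a\<close> is d (z_a + k), whose imaginary part d t/(2 pi) is
        \<open>y\<close>.\<close>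
      define w where "w a = complex_of_real (real (k * d + a)) + \<i> * of_real y" for a
      have w_nz: "w a \<noteq> 0" "cnj (w a) \<noteq> 0" for a using y by (auto simp: w_def complex_eq_iff)
      have inv1: "inverse (z a + of_nat k) = of_nat d / w a" for a
      proof -
        have "z a + of_nat k = w a / of_nat d"
          using d_pos by (simp add: z_def w_def y_def field_simps)
        thus ?thesis by simp
      qed
      have inv2: "inverse (1 - z a + of_nat k) = of_nat d / cnj (w (d - a))" if "a \<in> D" for a
      proof -
        have "1 - z a + of_nat k = cnj (w (d - a)) / of_nat d"
          using d_pos that by (simp add: z_def w_def y_def field_simps of_nat_diff D_def)
        thus ?thesis by simp
      qed
      have "(\<Sum>a\<in>D. of_int (chi a) * (inverse (z a + of_nat k) - inverse (1 - z a + of_nat k))) =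
          (\<Sum>a\<in>D. of_int (chi a) * (of_nat d / w a)) - (\<Sum>a\<in>D. of_int (chi a) * (of_nat d / cnj (w (d - a))))"
        by (simp add: inv1 inv2 right_diff_distrib sum_subtractf cong: sum.cong)
      \<comment> \<open>Reflecting a -> d - a, under which chi is invariant, turns the second
        fraction into the conjugate of the first; only imaginary parts remain.\<close>
      also have "(\<Sum>a\<in>D. of_int (chi a) * (of_nat d / cnj (w (d - a)))) =
          (\<Sum>a\<in>D. of_int (chi a) * (of_nat d / cnj (w a)))"
        by (rule sum.reindex_bij_witness[of _ "\<lambda>a. d - a" "\<lambda>a. d - a"]) (auto simp: D_def chi_reflect)
      also have "(\<Sum>a\<in>D. of_int (chi a) * (of_nat d / w a)) - \<dots> =
          (\<Sum>a\<in>D. of_int (chi a) * (of_real (1 / (real (k * d + a) ^ 2 + y\<^sup>2)) * (- 2 * \<i> * of_real (real d * y))))"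
        unfolding sum_subtractf[symmetric] right_diff_distrib[symmetric]
      proof (intro sum.cong refl arg_cong2[where f = "(*)"])
        fix a
        have "of_nat d / w a - of_nat d / cnj (w a) = of_nat d * (cnj (w a) - w a) / (w a * cnj (w a))"
          using w_nz[of a] by (simp add: field_simps)
        also have "cnj (w a) - w a = - 2 * \<i> * of_real y" by (simp add: w_def complex_eq_iff)
        also have "w a * cnj (w a) = of_real (real (k * d + a) ^ 2 + y\<^sup>2)"
          by (simp add: w_def complex_eq_iff power2_eq_square)
        finally show "of_nat d / w a - of_nat d / cnj (w a) =
            of_real (1 / (real (k * d + a) ^ 2 + y\<^sup>2)) * (- 2 * \<i> * of_real (real d * y))"
          by simp
      qed
      also have "\<dots> = (\<Sum>j<d. of_int (chi (Suc j)) * (of_real (1 / (real (k * d + Suc j) ^ 2 + y\<^sup>2)) *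
          (- 2 * \<i> * of_real (real d * y))))"
        unfolding D_def by (rule sum_block_eq_interior[symmetric])
      also have "\<dots> = (\<Sum>n\<in>{k * d..<k * d + d}. of_int (chi (Suc n)) * (of_real (1 / (real (Suc n) ^ 2 + y\<^sup>2)) *
          (- 2 * \<i> * of_real (real d * y))))"
        by (rule sum.reindex_bij_witness[of _ "\<lambda>n. n - k * d" "\<lambda>j. k * d + j"])
           (auto simp: chi_periodic simp flip: add_Suc_right)
      also have "\<dots> = of_real (\<Sum>n\<in>{k * d..<k * d + d}. of_int (chi (Suc n)) / (real (Suc n) ^ 2 + y\<^sup>2)) *
          (- 2 * \<i> * of_real (real d * y))"
        unfolding of_real_sum sum_distrib_right by (intro sum.cong refl) simp
      finally show ?thesis .
    qed
    ultimately have 1: "(\<lambda>k. of_real (\<Sum>n\<in>{k * d..<k * d + d}. of_int (chi (Suc n)) / (real (Suc n) ^ 2 + y\<^sup>2)) *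
          (- 2 * \<i> * of_real (real d * y))) sums
        (\<Sum>a\<in>D. of_int (chi a) * (of_real pi * cot (of_real pi * z a)))" by simp
    have "(\<lambda>k. \<Sum>n\<in>{k * d..<k * d + d}. of_int (chi (Suc n)) / (real (Suc n) ^ 2 + y\<^sup>2)) sums S"
      unfolding S_def by (intro sums_group summable_sums summable_dual d_pos)
    hence "(\<lambda>k. of_real (\<Sum>n\<in>{k * d..<k * d + d}. of_int (chi (Suc n)) / (real (Suc n) ^ 2 + y\<^sup>2)) *
          (- 2 * \<i> * of_real (real d * y))) sums (of_real S * (- 2 * \<i> * of_real (real d * y)))"
      by (intro sums_mult2 sums_of_real)
    thus ?thesis using 1 sums_unique2 by blast
  qed
  also have "\<i> / (2 * of_real pi) * (of_real S * (- 2 * \<i> * of_real (real d * y))) =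
      of_real (real d * y / pi * S)"
    by (simp add: field_simps)
  finally have "complex_of_real (sqrt d * Phi t) = of_real (real d * y / pi * S)"
    by (simp only: of_real_mult)
  hence "sqrt d * Phi t = real d * y / pi * S" by (simp only: of_real_eq_iff)
  also have "\<dots> = sqrt d * (sqrt d * y / pi * S)"
  proof -
    have "sqrt d * (sqrt d * y / pi * S) = (sqrt d * sqrt d) * (y / pi * S)" by (simp only: mult_ac times_divide_eq_right)
    thus ?thesis by simp
  qed
  finally have "Phi t = sqrt d * y / pi * S" using d_pos by (subst (asm) mult_left_cancel) auto
  thus ?thesis by (simp only: S_def)
qed

end

section \<open>Character sums over squarefree moduli\<close>

lemma odd_square_mod_8: "odd a \<Longrightarrow> (a\<^sup>2) mod 8 = (1::nat)"
proof -
  assume "odd a"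
  hence "a mod 8 = 1 \<or> a mod 8 = 3 \<or> a mod 8 = 5 \<or> a mod 8 = 7" by presburger
  moreover have "(a * a) mod 8 = ((a mod 8) * (a mod 8)) mod 8" by (rule mod_mult_eq[symmetric])
  ultimately show ?thesis unfolding power2_eq_square by (elim disjE) simp_all
qed

abbreviation perfect_square :: "nat \<Rightarrow> bool" where
  "perfect_square n \<equiv> \<exists>s. n = s\<^sup>2"

definition progression :: "nat \<Rightarrow> nat \<Rightarrow> nat set" where
  "progression \<rho> B = {b. b \<le> B \<and> b mod 8 = \<rho>}"

lemma finite_progression [simp]: "finite (progression \<rho> B)"
  by (rule finite_subset[of _ "{..B}"]) (auto simp: progression_def)

lemma sum_progression:
  assumes "\<rho> < 8"
  shows "\<exists>N. \<forall>f :: nat \<Rightarrow> int. sum f (progression \<rho> B) = (\<Sum>c<N. f (8 * c + \<rho>))"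
proof -
  define N where "N = (if \<rho> \<le> B then (B - \<rho>) div 8 + 1 else 0)"
  have iff: "8 * c + \<rho> \<le> B \<longleftrightarrow> c < N" for c
  proof (cases "\<rho> \<le> B")
    case True
    have "c < N \<longleftrightarrow> c \<le> (B - \<rho>) div 8" using True by (simp add: N_def less_Suc_eq_le)
    also have "\<dots> \<longleftrightarrow> c * 8 \<le> B - \<rho>" by (simp add: less_eq_div_iff_mult_less_eq)
    also have "\<dots> \<longleftrightarrow> 8 * c + \<rho> \<le> B" using True by linarith
    finally show ?thesis by simp
  qed (simp add: N_def)
  have "sum f (progression \<rho> B) = (\<Sum>c<N. f (8 * c + \<rho>))" for f :: "nat \<Rightarrow> int"
  proof (rule sum.reindex_bij_witness[of _ "\<lambda>c. 8 * c + \<rho>" "\<lambda>b. b div 8"])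
    fix b assume "b \<in> progression \<rho> B"
    hence b: "b \<le> B" "b mod 8 = \<rho>" by (simp_all add: progression_def)
    show eq: "8 * (b div 8) + \<rho> = b" using b(2) mult_div_mod_eq[of 8 b] by simp
    show "b div 8 \<in> {..<N}" using b(1) iff[of "b div 8"] eq by simp
    show "f (8 * (b div 8) + \<rho>) = f b" by (simp only: eq)
  next
    fix c assume "c \<in> {..<N}"
    thus "(8 * c + \<rho>) div 8 = c" "8 * c + \<rho> \<in> progression \<rho> B"
      using iff[of c] assms by (simp_all add: progression_def)
  qed
  thus ?thesis by blast
qed

text \<open>With w an inverse of 8 modulo r, 8c + \<rho> is 8 (w \<rho> + c) modulo r. So the sum is
  (8|r) times a sum over consecutive integers.\<close>

lemma progression_jacobi_sum_le:
  assumes r: "squarefree r" "odd r" "r > 1" and \<rho>: "\<rho> < 8"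
  shows "\<bar>\<Sum>b\<in>progression \<rho> B. jacobi (int b) r\<bar> \<le> 2 * sqrt r * (1 + ln r)"
proof -
  obtain N where N: "(\<Sum>b\<in>progression \<rho> B. jacobi (int b) r) = (\<Sum>c<N. jacobi (int (8 * c + \<rho>)) r)"
    using sum_progression[OF \<rho>, of B] by blast
  have "coprime (int 2) (int r)" using r(2) by simp
  hence "coprime ((int 2) ^ 3) (int r)" by (simp only: coprime_power_left_iff) simp
  hence "coprime 8 (int r)" by simp
  then obtain w where w: "[8 * w = 1] (mod int r)" using cong_solve_coprime_int by blast
  have eq: "jacobi (int (8 * c + \<rho>)) r = jacobi 8 r * jacobi (w * int \<rho> + int c) r" for c
  proof -
    have "[8 * w * int \<rho> + 8 * int c = 1 * int \<rho> + 8 * int c] (mod int r)"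
      by (intro cong_add cong_mult w cong_refl)
    moreover have "8 * w * int \<rho> + 8 * int c = 8 * (w * int \<rho> + int c)"
      "1 * int \<rho> + 8 * int c = int (8 * c + \<rho>)" by (simp_all add: algebra_simps)
    ultimately have "[int (8 * c + \<rho>) = 8 * (w * int \<rho> + int c)] (mod int r)"
      using cong_sym by metis
    hence "jacobi (int (8 * c + \<rho>)) r = jacobi (8 * (w * int \<rho> + int c)) r"
      using r by (intro jacobi_cong) auto
    thus ?thesis by (simp only: jacobi_mult_left)
  qed
  have "\<bar>\<Sum>b\<in>progression \<rho> B. jacobi (int b) r\<bar> = \<bar>jacobi 8 r\<bar> * \<bar>\<Sum>c<N. jacobi (w * int \<rho> + int c) r\<bar>"
    unfolding N eq sum_distrib_left[symmetric] abs_mult ..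
  also have "\<dots> \<le> 1 * \<bar>\<Sum>c<N. jacobi (w * int \<rho> + int c) r\<bar>"
    by (intro mult_right_mono jacobi_abs_le_1) auto
  finally have "real_of_int \<bar>\<Sum>b\<in>progression \<rho> B. jacobi (int b) r\<bar> \<le>
      real_of_int \<bar>\<Sum>c<N. jacobi (w * int \<rho> + int c) r\<bar>" by (simp only: of_int_le_iff mult_1)
  also have "\<dots> \<le> 2 * sqrt r * (1 + ln r)" by (rule polya_vinogradov[OF r])
  finally show ?thesis .
qed

text \<open>Each sieving prime p splits off the multiples of p, again a sum of the same kind times
  (p|r), so the bound doubles. The class modulo 8 and the length change on the way, hence the
  induction over arbitrary \<rho> and B.\<close>

lemma sifted_jacobi_sum_le:
  assumes r: "squarefree r" "odd r" "r > 1"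
    and Q: "finite Q" "\<And>q. q \<in> Q \<Longrightarrow> prime q \<and> odd q" and \<rho>: "\<rho> < 8" "odd \<rho>"
  shows "\<bar>\<Sum>b | b \<in> progression \<rho> B \<and> (\<forall>q\<in>Q. \<not> q dvd b). jacobi (int b) r\<bar> \<le>
    2 ^ card Q * (2 * sqrt r * (1 + ln r))"
  using Q \<rho>
proof (induction Q arbitrary: \<rho> B rule: finite_induct)
  case empty
  thus ?case using progression_jacobi_sum_le[OF r, of \<rho> B] by simp
next
  case (insert p Q)
  let ?A = "\<lambda>Q \<rho> B. {b. b \<in> progression \<rho> B \<and> (\<forall>q\<in>Q. \<not> q dvd b)}"
  let ?M = "2 * sqrt r * (1 + ln r)"
  \<comment> \<open>An odd p is its own inverse modulo 8, so p b lies in class \<rho> exactly if b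
    lies in class p \<rho>.\<close>
  define \<rho>' where "\<rho>' = (p * \<rho>) mod 8"
  have p: "prime p" "odd p" "p > 0" using insert.prems by (auto intro: prime_gt_0_nat)
  have "even \<rho>' \<longleftrightarrow> even (p * \<rho>)" unfolding \<rho>'_def by (rule dvd_mod_iff) simp
  hence \<rho>': "\<rho>' < 8" "odd \<rho>'" using insert.prems p by (auto simp: \<rho>'_def)
  have fin: "finite (?A Q \<rho> B)" for Q \<rho> B
    by (rule finite_subset[OF _ finite_progression[of \<rho> B]]) auto
  have p2: "(p * p) mod 8 = 1" using odd_square_mod_8[OF p(2)] by (simp only: power2_eq_square)
  have mod_iff: "(p * b) mod 8 = \<rho> \<longleftrightarrow> b mod 8 = \<rho>'" for b
  proof
    assume "(p * b) mod 8 = \<rho>"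
    hence "\<rho>' = (p * (p * b)) mod 8" using mod_mult_right_eq[of p "p * b" 8] by (simp only: \<rho>'_def)
    also have "\<dots> = ((p * p) mod 8 * b) mod 8" by (simp add: mod_mult_left_eq mult.assoc)
    finally show "b mod 8 = \<rho>'" using p2 by simp
  next
    assume "b mod 8 = \<rho>'"
    hence "(p * b) mod 8 = (p * (p * \<rho>)) mod 8"
      using mod_mult_right_eq[of p b 8] mod_mult_right_eq[of p "p * \<rho>" 8] by (simp only: \<rho>'_def)
    also have "\<dots> = ((p * p) mod 8 * \<rho>) mod 8" by (simp add: mod_mult_left_eq mult.assoc)
    finally show "(p * b) mod 8 = \<rho>" using p2 insert.prems by simp
  qed
  have ndvd: "q dvd p * b \<longleftrightarrow> q dvd b" if "q \<in> Q" for q b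
  proof -
    have "prime q" "q \<noteq> p" using that insert by auto
    thus ?thesis using prime_dvd_mult_iff[of q p b] primes_dvd_imp_eq[of q p] p(1) by blast
  qed
  have split: "?A Q \<rho> B = ?A (insert p Q) \<rho> B \<union> {b \<in> ?A Q \<rho> B. p dvd b}" by auto
  have "(\<Sum>b\<in>?A Q \<rho> B. jacobi (int b) r) =
      (\<Sum>b\<in>?A (insert p Q) \<rho> B. jacobi (int b) r) + (\<Sum>b\<in>{b \<in> ?A Q \<rho> B. p dvd b}. jacobi (int b) r)"
    by (subst split, rule sum.union_disjoint) (use fin in auto)
  also have "(\<Sum>b\<in>{b \<in> ?A Q \<rho> B. p dvd b}. jacobi (int b) r) =
      (\<Sum>b\<in>?A Q \<rho>' (B div p). jacobi (int (p * b)) r)"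
  proof (rule sum.reindex_bij_witness[of _ "\<lambda>b. p * b" "\<lambda>b. b div p"])
    fix b assume "b \<in> {b \<in> ?A Q \<rho> B. p dvd b}"
    then obtain c where c: "b = p * c" "p * c \<le> B" "(p * c) mod 8 = \<rho>" "\<forall>q\<in>Q. \<not> q dvd p * c"
      by (auto simp: progression_def elim: dvdE)
    have "c \<le> B div p" using c(2) p(3) by (simp add: less_eq_div_iff_mult_less_eq mult.commute)
    thus "b div p \<in> ?A Q \<rho>' (B div p)" using c mod_iff ndvd p(3) by (simp add: progression_def)
    show "p * (b div p) = b" using c(1) p(3) by simp
    thus "jacobi (int (p * (b div p))) r = jacobi (int b) r" by simp
  next
    fix c assume c: "c \<in> ?A Q \<rho>' (B div p)"
    show "p * c div p = c" using p(3) by simp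
    have "p * c \<le> B" using c p(3) by (simp add: progression_def less_eq_div_iff_mult_less_eq mult.commute)
    thus "p * c \<in> {b \<in> ?A Q \<rho> B. p dvd b}" using c mod_iff ndvd by (simp add: progression_def)
  qed
  also have "\<dots> = jacobi (int p) r * (\<Sum>b\<in>?A Q \<rho>' (B div p). jacobi (int b) r)"
    by (simp add: jacobi_mult_left sum_distrib_left)
  finally have "\<bar>\<Sum>b\<in>?A (insert p Q) \<rho> B. jacobi (int b) r\<bar> \<le>
      \<bar>\<Sum>b\<in>?A Q \<rho> B. jacobi (int b) r\<bar> + \<bar>jacobi (int p) r * (\<Sum>b\<in>?A Q \<rho>' (B div p). jacobi (int b) r)\<bar>"
    by linarith
  also have "\<bar>jacobi (int p) r * (\<Sum>b\<in>?A Q \<rho>' (B div p). jacobi (int b) r)\<bar> \<le>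
      1 * \<bar>\<Sum>b\<in>?A Q \<rho>' (B div p). jacobi (int b) r\<bar>"
    unfolding abs_mult by (intro mult_right_mono jacobi_abs_le_1) auto
  finally have "real_of_int \<bar>\<Sum>b\<in>?A (insert p Q) \<rho> B. jacobi (int b) r\<bar> \<le>
      real_of_int \<bar>\<Sum>b\<in>?A Q \<rho> B. jacobi (int b) r\<bar> + real_of_int \<bar>\<Sum>b\<in>?A Q \<rho>' (B div p). jacobi (int b) r\<bar>"
    by linarith
  also have "\<dots> \<le> 2 ^ card Q * ?M + 2 ^ card Q * ?M"
    using insert.prems \<rho>' by (intro add_mono insert.IH) auto
  also have "\<dots> = 2 ^ card (insert p Q) * ?M" using insert.hyps by simp
  finally show ?case .
qed

lemma two_power_card_prime_factors_le:
  assumes "s > 0"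
  shows "2 ^ card (prime_factors s) \<le> (s::nat)"
proof -
  have "(2::nat) ^ card (prime_factors s) = (\<Prod>p\<in>prime_factors s. 2)" by simp
  also have "\<dots> \<le> (\<Prod>p\<in>prime_factors s. p ^ multiplicity p s)"
  proof (intro prod_mono conjI)
    fix p assume p: "p \<in> prime_factors s"
    hence "prime p" "multiplicity p s \<ge> 1" by (auto simp: prime_factors_multiplicity)
    moreover from this have p2: "2 \<le> p" by (simp add: prime_ge_2_nat)
    ultimately have "p ^ 1 \<le> p ^ multiplicity p s" by (intro power_increasing) auto
    thus "2 \<le> p ^ multiplicity p s" using p2 by simp
  qed simp
  also have "\<dots> = s" using prod_prime_factors[of s] assms by simp
  finally show ?thesis .
qed

text \<open>Write l = r s^2 with r squarefree; r > 1 as l is not a square. The symbol modulo l is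
  the one modulo r sifted by the primes of s. The loss 2^omega(s), with omega(s) the number of
  primes dividing s, is at most s, and s sqrt r = sqrt l.\<close>

lemma jacobi_sum_le:
  assumes l: "odd l" "\<not> perfect_square l"
  shows "\<bar>\<Sum>b\<in>progression 1 B. jacobi (int b) l\<bar> \<le> 2 * sqrt l * (1 + ln l)"
proof -
  have l0: "l > 0" using l by (auto intro: Nat.gr0I)
  define r where "r = squarefree_part l"
  define s where "s = square_part l"
  have l_eq: "l = r * s\<^sup>2" unfolding r_def s_def by (rule squarefree_decompose)
  have rs: "r > 0" "s > 0" "odd r" "odd s" using l_eq l l0 by (auto intro!: Nat.gr0I)
  have sq: "squarefree r" using l0 by (simp add: r_def)
  have "r \<noteq> 1" using l(2) l_eq by auto
  hence r1: "r > 1" using rs by simp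
  define Q where "Q = prime_factors s"
  have Q: "finite Q" "\<And>q. q \<in> Q \<Longrightarrow> prime q \<and> odd q"
    using rs(4) dvd_trans[of 2 _ s] by (auto simp: Q_def)
  have jac: "jacobi (int b) l = (if \<forall>q\<in>Q. \<not> q dvd b then jacobi (int b) r else 0)" for b
  proof -
    have "jacobi (int b) l = jacobi (int b) r * (jacobi (int b) s * jacobi (int b) s)"
      unfolding l_eq power2_eq_square using rs by (simp add: jacobi_mult_right)
    also have "jacobi (int b) s * jacobi (int b) s = (if coprime b s then 1 else 0)"
      using jacobi_square[OF rs(2), of "int b"] by simp
    also have "coprime b s \<longleftrightarrow> (\<forall>q\<in>Q. \<not> q dvd b)"
    proof
      assume c: "coprime b s"
      show "\<forall>q\<in>Q. \<not> q dvd b"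
      proof (intro ballI notI)
        fix q assume "q \<in> Q" "q dvd b"
        hence "q dvd gcd b s" "prime q" by (auto simp: Q_def)
        thus False using coprime_imp_gcd_eq_1[OF c] by simp
      qed
    next
      assume Q': "\<forall>q\<in>Q. \<not> q dvd b"
      have "gcd b s = 1"
      proof (rule ccontr)
        assume "gcd b s \<noteq> 1"
        then obtain q where "prime q" "q dvd gcd b s" using prime_factor_nat by blast
        moreover from this have "q dvd b" "q dvd s" using dvd_trans gcd_dvd1 gcd_dvd2 by blast+
        ultimately have "q \<in> Q" using rs by (auto simp: Q_def prime_factors_dvd)
        thus False using Q' \<open>q dvd b\<close> by blast
      qed
      thus "coprime b s" by (rule gcd_eq_1_imp_coprime)
    qed
    finally show ?thesis by simp
  qed
  have "(\<Sum>b\<in>progression 1 B. jacobi (int b) l) =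
      (\<Sum>b | b \<in> progression 1 B \<and> (\<forall>q\<in>Q. \<not> q dvd b). jacobi (int b) r)"
    unfolding jac by (simp add: sum.If_cases Int_def)
  hence "\<bar>\<Sum>b\<in>progression 1 B. jacobi (int b) l\<bar> \<le> 2 ^ card Q * (2 * sqrt r * (1 + ln r))"
    using sifted_jacobi_sum_le[OF sq rs(3) r1 Q, of 1 B] by simp
  also have "\<dots> \<le> real s * (2 * sqrt r * (1 + ln l))"
  proof (intro mult_mono add_left_mono)
    show "2 ^ card Q \<le> real s"
      using of_nat_mono[OF two_power_card_prime_factors_le[OF rs(2)], where 'a = real] by (simp add: Q_def)
    have "r \<le> l" unfolding l_eq using rs by simp
    hence "real r \<le> real l" by simp
    thus "ln (real r) \<le> ln (real l)" using rs by simp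
  qed (use r1 in auto)
  also have "\<dots> = 2 * sqrt l * (1 + ln l)"
    using rs by (simp add: l_eq real_sqrt_mult)
  finally show ?thesis .
qed


section \<open>Detecting squarefree moduli\<close>

definition moebius_mu :: "nat \<Rightarrow> int" where
  "moebius_mu a = (if squarefree a then (-1) ^ card (prime_factors a) else 0)"

lemma abs_moebius_mu_le: "\<bar>moebius_mu a\<bar> \<le> 1"
  by (simp add: moebius_mu_def power_abs)

text \<open>Squarefree a with a^2 dividing n correspond to sets of primes whose squares divide n, so
  the sum is the product of (1 - 1) over these primes.\<close>

lemma sum_moebius_mu_square_divisors:
  assumes n: "n > 0"
  shows "(\<Sum>a | a \<le> n \<and> a\<^sup>2 dvd n. moebius_mu a) = (if squarefree n then 1 else 0)"
proof -
  define P where "P = {p. prime p \<and> p\<^sup>2 dvd n}"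
  have P_sub: "P \<subseteq> prime_factors n"
    using n dvd_trans[of _ "_\<^sup>2" n] by (auto simp: P_def prime_factors_dvd power2_eq_square dest: dvd_mult_left)
  hence finP: "finite P" using finite_subset by blast
  have prime_S: "prime p" if "S \<subseteq> P" "p \<in> S" for S p using that by (auto simp: P_def)
  have pf: "prime_factors (\<Prod>S) = S" if S: "S \<subseteq> P" for S
  proof -
    have "finite S" using S finP finite_subset by blast
    moreover have "0 \<notin> id ` S" using prime_S[OF S, of 0] by auto
    ultimately have "prime_factors (prod id S) = \<Union>((prime_factors \<circ> id) ` S)" by (rule prime_factors_prod)
    also have "\<dots> = S" using prime_S[OF S] by (force simp: prime_prime_factors)
    finally show ?thesis by simp
  qed
  have sqf: "squarefree (\<Prod>S)" if S: "S \<subseteq> P" for S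
    using prime_S[OF S] by (intro squarefree_prod_coprime) (auto intro: primes_coprime squarefree_prime)
  have dvd: "(\<Prod>S)\<^sup>2 dvd n" if S: "S \<subseteq> P" for S
  proof -
    have "finite S" using S finP finite_subset by blast
    thus ?thesis using S
    proof (induction S rule: finite_induct)
      case (insert p S)
      have "coprime p (\<Prod>S)"
      proof (rule prod_coprime_right)
        fix q assume "q \<in> S"
        thus "coprime p q" using insert prime_S[OF insert.prems] by (intro primes_coprime) auto
      qed
      hence "coprime (p\<^sup>2) ((\<Prod>S)\<^sup>2)" by simp
      moreover have "p\<^sup>2 dvd n" using insert.prems by (auto simp: P_def)
      ultimately have "p\<^sup>2 * (\<Prod>S)\<^sup>2 dvd n" using insert by (intro divides_mult) auto
      thus ?case using insert.hyps by (simp add: power_mult_distrib)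
    qed simp
  qed
  have le: "a \<le> n" if "a\<^sup>2 dvd n" for a
  proof -
    have "a dvd n" using that by (simp add: power2_eq_square dvd_mult_left)
    thus ?thesis using n by (rule dvd_imp_le)
  qed
  have fin: "finite {a. a \<le> n \<and> a\<^sup>2 dvd n}" by (rule finite_subset[of _ "{..n}"]) auto
  have "(\<Sum>a | a \<le> n \<and> a\<^sup>2 dvd n. moebius_mu a) = (\<Sum>a | squarefree a \<and> a\<^sup>2 dvd n. moebius_mu a)"
    by (rule sum.mono_neutral_right[OF fin]) (auto simp: le moebius_mu_def)
  also have "\<dots> = (\<Sum>S\<in>Pow P. (-1) ^ card S)"
  proof (rule sum.reindex_bij_witness[of _ "\<lambda>S. \<Prod>S" prime_factors])
    fix a assume "a \<in> {a. squarefree a \<and> a\<^sup>2 dvd n}"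
    hence a: "squarefree a" "a\<^sup>2 dvd n" by auto
    have a0: "a > 0" using a(2) n by (auto intro: Nat.gr0I)
    show "\<Prod>(prime_factors a) = a" using squarefree_eq_prod_prime_factors[OF a(1) a0] by simp
    show "prime_factors a \<in> Pow P"
    proof (intro PowI subsetI)
      fix p assume "p \<in> prime_factors a"
      hence "prime p" "p dvd a" by auto
      hence "p\<^sup>2 dvd a\<^sup>2" by simp
      hence "p\<^sup>2 dvd n" using a(2) dvd_trans by blast
      thus "p \<in> P" using \<open>prime p\<close> by (simp add: P_def)
    qed
    show "(-1) ^ card (prime_factors a) = moebius_mu a" using a by (simp add: moebius_mu_def)
  next
    fix S assume "S \<in> Pow P"
    thus "prime_factors (\<Prod>S) = S" "\<Prod>S \<in> {a. squarefree a \<and> a\<^sup>2 dvd n}"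
      using pf sqf dvd by auto
  qed
  also have "\<dots> = (\<Sum>S\<in>Pow P. (\<Prod>p\<in>S. -1) * (\<Prod>p\<in>P-S. 1))" by simp
  also have "\<dots> = (\<Prod>p\<in>P. -1 + (1::int))" by (rule prod_add[OF finP, symmetric])
  also have "\<dots> = (if P = {} then 1 else 0)" using finP by (simp add: card_gt_0_iff)
  also have "P = {} \<longleftrightarrow> squarefree n"
  proof
    assume P: "P = {}"
    show "squarefree n" unfolding squarefree_def
    proof (intro allI impI)
      fix x assume x: "x\<^sup>2 dvd n"
      show "is_unit x"
      proof (rule ccontr)
        assume "\<not> is_unit x"
        then obtain p where "prime p" "p dvd x" using prime_factor_nat[of x] by auto
        hence "p\<^sup>2 dvd x\<^sup>2" by simp
        hence "p \<in> P" using \<open>prime p\<close> x dvd_trans by (auto simp: P_def)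
        thus False using P by simp
      qed
    qed
  next
    assume "squarefree n"
    thus "P = {}" by (auto simp: P_def squarefree_def)
  qed
  finally show ?thesis .
qed

text \<open>The exponent 1/18 is the gap between 1/2 and 5/9; the latter is chosen so that
  (5/9)(9/20) = 1/4 in \<open>squarefree_jacobi_sum_le\<close>.\<close>

lemma one_plus_ln_le_powr:
  assumes "x \<ge> (1::real)"
  shows "1 + ln x \<le> 18 * x powr (1/18)"
proof -
  have "ln (x powr (1/18)) \<le> x powr (1/18) - 1" using assms by (intro ln_le_minus_one) auto
  thus ?thesis using assms by (simp add: ln_powr)
qed

lemma jacobi_sum_le_powr:
  assumes l: "odd l" "\<not> perfect_square l"
  shows "\<bar>\<Sum>b\<in>progression 1 B. jacobi (int b) l\<bar> \<le> 36 * real l powr (5/9)"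
proof -
  have l0: "real l \<ge> 1" using l by (cases l) auto
  have "real_of_int \<bar>\<Sum>b\<in>progression 1 B. jacobi (int b) l\<bar> \<le> 2 * sqrt l * (1 + ln l)"
    by (rule jacobi_sum_le[OF l])
  also have "\<dots> \<le> 2 * sqrt l * (18 * real l powr (1/18))"
    using one_plus_ln_le_powr[OF l0] by (intro mult_left_mono) auto
  also have "sqrt l = real l powr (1/2)" using l0 by (simp add: powr_half_sqrt)
  also have "2 * real l powr (1/2) * (18 * real l powr (1/18)) = 36 * real l powr (5/9)"
    using l0 by (simp flip: powr_add)
  finally show ?thesis .
qed

lemma card_progression_le: "card (progression 1 B) \<le> B"
proof -
  have "progression 1 B \<subseteq> {1..B}" unfolding progression_def by (auto intro: Nat.gr0I)
  hence "card (progression 1 B) \<le> card {1..B}" by (intro card_mono) auto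
  thus ?thesis by simp
qed

lemma min_le_powr_mult:
  fixes x a b :: real
  assumes "0 \<le> x" "x \<le> a" "x \<le> b" "0 \<le> t" "t \<le> 1"
  shows "x \<le> a powr t * b powr (1 - t)"
proof (cases "x = 0")
  case False
  hence "x = x powr t * x powr (1 - t)" using assms by (simp flip: powr_add)
  also have "\<dots> \<le> a powr t * b powr (1 - t)" using assms by (intro mult_mono powr_mono2) auto
  finally show ?thesis .
qed simp

definition squarefree_progression :: "nat \<Rightarrow> nat set" where
  "squarefree_progression D = {d \<in> progression 1 D. squarefree d}"

text \<open>Detect squarefree d by square divisors a^2. Even a do not occur for odd d, and for odd a
  division by a^2 keeps the class 1 modulo 8. The inner sum is at most D/a^2 trivially and at most
  36 l^(5/9) by Polya-Vinogradov; an interpolation of the two is summable over a and has a small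
  exponent of l.\<close>

theorem squarefree_jacobi_sum_le:
  "\<exists>C>0. \<forall>D l. odd l \<longrightarrow> \<not> perfect_square l \<longrightarrow>
    \<bar>\<Sum>d\<in>squarefree_progression D. jacobi (int d) l\<bar> \<le> C * real D powr (11/20) * real l powr (1/4)"
proof -
  have summ: "summable (\<lambda>a. real a powr (-11/10))" by (subst summable_real_powr_iff) simp
  define Z where "Z = (\<Sum>a. real a powr (-11/10))"
  have Z: "(\<Sum>a\<in>A. real a powr (-11/10)) \<le> Z" if "finite A" for A
    unfolding Z_def using summ that by (intro sum_le_suminf) auto
  have Z0: "Z \<ge> 0" using Z[of "{}"] by simp
  have main: "\<bar>\<Sum>d\<in>squarefree_progression D. jacobi (int d) l\<bar> \<le> (36 * Z + 1) * real D powr (11/20) * real l powr (1/4)"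
    if l: "odd l" "\<not> perfect_square l" for D l
  proof -
    have l0: "real l \<ge> 1" using l by (cases l) auto
    define T where "T a = (\<Sum>d | d \<in> progression 1 D \<and> a\<^sup>2 dvd d. jacobi (int d) l)" for a
    have pos: "d > 0" if "d \<in> progression 1 D" for d using that by (auto simp: progression_def intro: Nat.gr0I)
    have "(\<Sum>d\<in>squarefree_progression D. jacobi (int d) l) =
        (\<Sum>d\<in>progression 1 D. (if squarefree d then 1 else 0) * jacobi (int d) l)"
      unfolding squarefree_progression_def by (subst sum.inter_filter) (auto intro!: sum.cong)
    also have "\<dots> = (\<Sum>d\<in>progression 1 D. \<Sum>a\<in>{1..D}. if a\<^sup>2 dvd d then moebius_mu a * jacobi (int d) l else 0)"
    proof (intro sum.cong refl)
      fix d assume d: "d \<in> progression 1 D"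
      have "(\<Sum>a | a \<le> d \<and> a\<^sup>2 dvd d. moebius_mu a) = (\<Sum>a\<in>{a \<in> {1..D}. a\<^sup>2 dvd d}. moebius_mu a)"
      proof (rule arg_cong[where f = "sum moebius_mu"], intro equalityI subsetI)
        fix a assume a: "a \<in> {a. a \<le> d \<and> a\<^sup>2 dvd d}"
        hence "a > 0" using pos[OF d] by (auto intro: Nat.gr0I)
        thus "a \<in> {a \<in> {1..D}. a\<^sup>2 dvd d}" using a d by (auto simp: progression_def)
      next
        fix a assume a: "a \<in> {a \<in> {1..D}. a\<^sup>2 dvd d}"
        hence "a dvd d" by (auto simp: power2_eq_square intro: dvd_mult_left)
        thus "a \<in> {a. a \<le> d \<and> a\<^sup>2 dvd d}" using a pos[OF d] dvd_imp_le by auto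
      qed
      hence "(if squarefree d then 1 else 0) = (\<Sum>a\<in>{a \<in> {1..D}. a\<^sup>2 dvd d}. moebius_mu a)"
        using sum_moebius_mu_square_divisors[OF pos[OF d]] by simp
      also have "\<dots> = (\<Sum>a\<in>{1..D}. if a\<^sup>2 dvd d then moebius_mu a else 0)"
        by (subst sum.inter_filter) auto
      finally show "(if squarefree d then 1 else 0) * jacobi (int d) l =
          (\<Sum>a\<in>{1..D}. if a\<^sup>2 dvd d then moebius_mu a * jacobi (int d) l else 0)"
        by (simp only: sum_distrib_right if_distrib[where f = "\<lambda>x. x * jacobi (int d) l"] mult_zero_left)
    qed
    also have "\<dots> = (\<Sum>a\<in>{1..D}. moebius_mu a * T a)"
      unfolding T_def sum_distrib_left
      by (subst sum.swap) (auto intro!: sum.cong simp: sum.inter_filter[symmetric])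
    finally have eq: "(\<Sum>d\<in>squarefree_progression D. jacobi (int d) l) = (\<Sum>a\<in>{1..D}. moebius_mu a * T a)" .
    have T_le: "\<bar>T a\<bar> \<le> 36 * real D powr (11/20) * real l powr (1/4) * real a powr (-11/10)" if a: "a \<in> {1..D}" for a
    proof (cases "even a")
      case True
      have "\<not> a\<^sup>2 dvd d" if "d \<in> progression 1 D" for d
      proof
        assume "a\<^sup>2 dvd d"
        hence "even d" using True dvd_trans[of 2 "a\<^sup>2" d] by simp
        moreover have "odd d" using that unfolding progression_def mem_Collect_eq by presburger
        ultimately show False by simp
      qed
      hence "{d. d \<in> progression 1 D \<and> a\<^sup>2 dvd d} = {}" by blast
      hence "T a = 0" by (simp only: T_def sum.empty)
      thus ?thesis by simp
    next
      case False
      define B where "B = D div a\<^sup>2"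
      have a2: "(a\<^sup>2) mod 8 = 1" using False by (intro odd_square_mod_8) simp
      have mod_eq: "(a\<^sup>2 * b) mod 8 = b mod 8" for b
      proof -
        have "(a\<^sup>2 * b) mod 8 = ((a\<^sup>2) mod 8 * b) mod 8" by (rule mod_mult_left_eq[symmetric])
        thus ?thesis by (simp only: a2 mult_1)
      qed
      have a0: "a\<^sup>2 > 0" using a by simp
      have "T a = (\<Sum>b\<in>progression 1 B. jacobi (int (a\<^sup>2 * b)) l)"
        unfolding T_def
      proof (rule sum.reindex_bij_witness[of _ "\<lambda>b. a\<^sup>2 * b" "\<lambda>d. d div a\<^sup>2"])
        fix d assume "d \<in> {d. d \<in> progression 1 D \<and> a\<^sup>2 dvd d}"
        then obtain b where b: "d = a\<^sup>2 * b" "d \<le> D" "d mod 8 = 1" by (auto simp: progression_def elim: dvdE)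
        have "b \<le> B" using b a0 by (simp add: B_def less_eq_div_iff_mult_less_eq mult.commute)
        thus "d div a\<^sup>2 \<in> progression 1 B" using b a0 mod_eq[of b] by (simp add: progression_def)
        show "a\<^sup>2 * (d div a\<^sup>2) = d" using b a0 by simp
        thus "jacobi (int (a\<^sup>2 * (d div a\<^sup>2))) l = jacobi (int d) l" by simp
      next
        fix b assume "b \<in> progression 1 B"
        thus "a\<^sup>2 * b div a\<^sup>2 = b" "a\<^sup>2 * b \<in> {d. d \<in> progression 1 D \<and> a\<^sup>2 dvd d}"
          using a0 mod_eq[of b] by (auto simp: progression_def B_def less_eq_div_iff_mult_less_eq mult.commute)
      qed
      also have "\<dots> = jacobi (int (a\<^sup>2)) l * (\<Sum>b\<in>progression 1 B. jacobi (int b) l)"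
        by (simp only: of_nat_mult jacobi_mult_left sum_distrib_left)
      finally have "\<bar>T a\<bar> = \<bar>jacobi (int (a\<^sup>2)) l\<bar> * \<bar>\<Sum>b\<in>progression 1 B. jacobi (int b) l\<bar>"
        by (simp only: abs_mult)
      also have "\<dots> \<le> 1 * \<bar>\<Sum>b\<in>progression 1 B. jacobi (int b) l\<bar>"
        by (intro mult_right_mono jacobi_abs_le_1) auto
      finally have T1: "\<bar>T a\<bar> \<le> \<bar>\<Sum>b\<in>progression 1 B. jacobi (int b) l\<bar>" by simp
      have "real_of_int \<bar>T a\<bar> \<le> real_of_int \<bar>\<Sum>b\<in>progression 1 B. jacobi (int b) l\<bar>"
        using T1 by (simp only: of_int_le_iff)
      also have "\<dots> \<le> 36 * real l powr (5/9)" by (rule jacobi_sum_le_powr[OF l])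
      finally have b1: "real_of_int \<bar>T a\<bar> \<le> 36 * real l powr (5/9)" .
      have "\<bar>\<Sum>b\<in>progression 1 B. jacobi (int b) l\<bar> \<le> (\<Sum>b\<in>progression 1 B. 1)"
        by (intro order_trans[OF sum_abs] sum_mono jacobi_abs_le_1)
      also have "\<dots> \<le> int B" using card_progression_le[of B] by simp
      finally have "real_of_int \<bar>T a\<bar> \<le> real B" using T1 by linarith
      also have "real B \<le> real D / real (a\<^sup>2)" unfolding B_def by (rule of_nat_div_le_of_nat)
      finally have b2: "real_of_int \<bar>T a\<bar> \<le> real D / real (a\<^sup>2)" .
      \<comment> \<open>The weight 11/20 on the trivial bound yields a^(-11/10), just summable, and
        leaves l the exponent (5/9)(9/20) = 1/4.\<close>
      have "real_of_int \<bar>T a\<bar> \<le> (real D / real (a\<^sup>2)) powr (11/20) * (36 * real l powr (5/9)) powr (1 - 11/20)"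
        using b1 b2 by (intro min_le_powr_mult) auto
      also have "(real D / real (a\<^sup>2)) powr (11/20) = real D powr (11/20) * real a powr (-11/10)"
      proof -
        have "real (a\<^sup>2) = real a powr 2" using a by (simp add: powr_numeral)
        hence "real (a\<^sup>2) powr (11/20) = real a powr (11/10)" by (simp only: powr_powr) simp
        moreover have "real a powr (-11/10) = 1 / real a powr (11/10)"
          using powr_minus_divide[of "real a" "11/10"] by simp
        ultimately show ?thesis
          by (simp only: powr_divide of_nat_0_le_iff times_divide_eq_right mult_1_right)
      qed
      also have "(36 * real l powr (5/9)) powr (1 - 11/20) = 36 powr (9/20) * real l powr (1/4)"
        by (simp add: powr_mult powr_powr)
      also have "real D powr (11/20) * real a powr (-11/10) * (36 powr (9/20) * real l powr (1/4)) \<le>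
          real D powr (11/20) * real a powr (-11/10) * (36 * real l powr (1/4))"
        using powr_mono[of "9/20" 1 "36::real"] by (intro mult_left_mono mult_right_mono) auto
      finally show ?thesis by (simp only: mult_ac)
    qed
    have "real_of_int \<bar>\<Sum>a\<in>{1..D}. moebius_mu a * T a\<bar> \<le> (\<Sum>a\<in>{1..D}. real_of_int \<bar>T a\<bar>)"
    proof -
      have "\<bar>\<Sum>a\<in>{1..D}. moebius_mu a * T a\<bar> \<le> (\<Sum>a\<in>{1..D}. 1 * \<bar>T a\<bar>)"
        by (intro order_trans[OF sum_abs] sum_mono) (simp add: abs_mult mult_right_mono abs_moebius_mu_le del: mult_1)
      hence "real_of_int \<bar>\<Sum>a\<in>{1..D}. moebius_mu a * T a\<bar> \<le> real_of_int (\<Sum>a\<in>{1..D}. \<bar>T a\<bar>)"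
        by (simp only: of_int_le_iff mult_1)
      thus ?thesis by (simp only: of_int_sum)
    qed
    also have "\<dots> \<le> (\<Sum>a\<in>{1..D}. 36 * real D powr (11/20) * real l powr (1/4) * real a powr (-11/10))"
      by (intro sum_mono T_le)
    also have "\<dots> = 36 * real D powr (11/20) * real l powr (1/4) * (\<Sum>a\<in>{1..D}. real a powr (-11/10))"
      by (simp only: sum_distrib_left)
    also have "\<dots> \<le> 36 * real D powr (11/20) * real l powr (1/4) * Z"
      by (intro mult_left_mono Z) auto
    also have "\<dots> \<le> (36 * Z + 1) * real D powr (11/20) * real l powr (1/4)"
      by (simp add: algebra_simps)
    finally show ?thesis by (simp only: eq)
  qed
  thus ?thesis using Z0 by (intro exI[of _ "36 * Z + 1"]) auto
qed

section \<open>Square products of rough numbers\<close>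

lemma sum_Un_nonneg_le:
  fixes f :: "'a \<Rightarrow> real"
  assumes "finite A" "finite B" "\<And>x. f x \<ge> 0"
  shows "sum f (A \<union> B) \<le> sum f A + sum f B"
proof -
  have "sum f (A \<inter> B) \<ge> 0" by (intro sum_nonneg assms(3))
  thus ?thesis using sum.union_inter[OF assms(1,2), of f] by linarith
qed

lemma sum_UN_nonneg_le:
  fixes f :: "'a \<Rightarrow> real"
  assumes "finite I" "\<And>i. i \<in> I \<Longrightarrow> finite (A i)" "\<And>x. f x \<ge> 0"
  shows "sum f (\<Union>i\<in>I. A i) \<le> (\<Sum>i\<in>I. sum f (A i))"
  using assms
proof (induction I rule: finite_induct)
  case (insert i I)
  have "sum f (A i \<union> (\<Union>i\<in>I. A i)) \<le> sum f (A i) + sum f (\<Union>i\<in>I. A i)"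
    using insert by (intro sum_Un_nonneg_le) auto
  thus ?case using insert by simp
qed simp

definition rough_upto :: "nat \<Rightarrow> nat \<Rightarrow> nat set" where
  "rough_upto z x = {n. 0 < n \<and> n \<le> x \<and> (\<forall>p. prime p \<longrightarrow> p \<le> z \<longrightarrow> \<not> p dvd n)}"

lemma finite_rough_upto [simp]: "finite (rough_upto z x)"
  by (rule finite_subset[of _ "{..x}"]) (auto simp: rough_upto_def)

lemma rough_upto_div:
  assumes "n \<in> rough_upto z x" "e dvd n"
  shows "n div e \<in> rough_upto z x"
proof -
  obtain c where c: "n = e * c" using assms(2) by (elim dvdE)
  have pos: "e > 0" "c > 0" using assms(1) c by (auto simp: rough_upto_def)
  have "c \<le> n" using c pos by simp
  hence "c \<le> x" using assms(1) by (simp add: rough_upto_def)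
  moreover have "n div e = c" using c pos by simp
  ultimately show ?thesis using assms(1) c pos by (auto simp: rough_upto_def)
qed

text \<open>Dividing out the pattern \<open>e\<close> coordinatewise is injective, and a completely
  multiplicative weight splits off the weight of \<open>e\<close>. It serves the weight n^(-1/2) for
  square tuples and 1/n for coprime ones.\<close>

lemma sum_tuples_div_le:
  fixes w :: "nat \<Rightarrow> real" and e :: "'i \<Rightarrow> nat"
  assumes I: "finite I" and w: "\<And>a b. w (a * b) = w a * w b" "\<And>a. w a \<ge> 0"
    and e: "\<And>i. i \<in> I \<Longrightarrow> e i > 0"
    and F: "F \<subseteq> extensional I" "\<And>f i. f \<in> F \<Longrightarrow> i \<in> I \<Longrightarrow> e i dvd f i"
    and G: "finite G" "\<And>f. f \<in> F \<Longrightarrow> (\<lambda>i\<in>I. f i div e i) \<in> G"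
  shows "(\<Sum>f\<in>F. \<Prod>i\<in>I. w (f i)) \<le> (\<Prod>i\<in>I. w (e i)) * (\<Sum>f\<in>G. \<Prod>i\<in>I. w (f i))"
proof -
  define g where "g f = (\<lambda>i\<in>I. f i div e i)" for f
  have inj: "inj_on g F"
  proof (rule inj_onI)
    fix f f' assume f: "f \<in> F" "f' \<in> F" "g f = g f'"
    show "f = f'"
    proof (rule extensionalityI[of _ I])
      fix i assume i: "i \<in> I"
      have "f i div e i = f' i div e i" using fun_cong[OF f(3), of i] i by (simp add: g_def)
      thus "f i = f' i" using F(2)[OF f(1) i] F(2)[OF f(2) i] by (metis dvd_div_mult_self)
    qed (use f F in auto)
  qed
  have "(\<Sum>f\<in>F. \<Prod>i\<in>I. w (f i)) = (\<Sum>f\<in>F. (\<Prod>i\<in>I. w (e i)) * (\<Prod>i\<in>I. w (g f i)))"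
  proof (intro sum.cong refl)
    fix f assume f: "f \<in> F"
    have "w (f i) = w (e i) * w (g f i)" if i: "i \<in> I" for i
    proof -
      have "f i = e i * g f i" using F(2)[OF f i] i by (simp add: g_def)
      thus ?thesis using w(1) by metis
    qed
    thus "(\<Prod>i\<in>I. w (f i)) = (\<Prod>i\<in>I. w (e i)) * (\<Prod>i\<in>I. w (g f i))"
      by (simp add: prod.distrib)
  qed
  also have "\<dots> = (\<Prod>i\<in>I. w (e i)) * (\<Sum>f\<in>g ` F. \<Prod>i\<in>I. w (f i))"
    using inj by (simp add: sum_distrib_left sum.reindex)
  also have "\<dots> \<le> (\<Prod>i\<in>I. w (e i)) * (\<Sum>f\<in>G. \<Prod>i\<in>I. w (f i))"
    using w(2) G by (intro mult_left_mono sum_mono2 prod_nonneg) (auto simp: g_def)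
  finally show ?thesis .
qed

text \<open>Telescoping. The bound 1/z is how excluding the small primes makes every coprimality
  loss small.\<close>

lemma sum_inverse_squares_le:
  assumes "finite P" "\<And>p. p \<in> P \<Longrightarrow> p > z" "z > 0"
  shows "(\<Sum>p\<in>P. 1 / real p ^ 2) \<le> 1 / real z"
proof -
  define M where "M = Max (insert (Suc z) P)"
  have "(\<Sum>p\<in>P. 1 / real p ^ 2) \<le> (\<Sum>p\<in>{z<..M}. 1 / real p ^ 2)"
    using assms by (intro sum_mono2) (auto simp: M_def)
  also have "\<dots> \<le> 1 / real z - 1 / real M"
  proof -
    have "(\<Sum>p\<in>{z<..n}. 1 / real p ^ 2) \<le> 1 / real z - 1 / real n" if "n \<ge> z" for n
      using that
    proof (induction n rule: dec_induct)
      case (step n)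
      have "{z<..Suc n} = insert (Suc n) {z<..n}" using step.hyps by auto
      hence "(\<Sum>p\<in>{z<..Suc n}. 1 / real p ^ 2) = 1 / real (Suc n) ^ 2 + (\<Sum>p\<in>{z<..n}. 1 / real p ^ 2)" by simp
      also have "\<dots> \<le> 1 / real (Suc n) ^ 2 + (1 / real z - 1 / real n)" using step.IH by simp
      also have "1 / real (Suc n) ^ 2 \<le> 1 / (real n * real (Suc n))"
        using step.hyps assms(3) by (intro divide_left_mono) (auto simp: power2_eq_square)
      also have "\<dots> = 1 / real n - 1 / real (Suc n)"
        using step.hyps assms(3) by (simp add: field_simps)
      finally show ?case by simp
    qed simp
    moreover have "Suc z \<le> M" unfolding M_def using assms(1) by (intro Max_ge) auto
    hence "M \<ge> z" by simp
    ultimately show ?thesis by blast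
  qed
  also have "\<dots> \<le> 1 / real z" by simp
  finally show ?thesis .
qed

definition square_tuples :: "'i set \<Rightarrow> nat \<Rightarrow> nat \<Rightarrow> ('i \<Rightarrow> nat) set" where
  "square_tuples I z x = {f \<in> PiE I (\<lambda>_. rough_upto z x). perfect_square (\<Prod>i\<in>I. f i)}"

definition inv_sqrt :: "nat \<Rightarrow> real" where
  "inv_sqrt n = 1 / sqrt n"

lemma inv_sqrt_mult: "inv_sqrt (a * b) = inv_sqrt a * inv_sqrt b"
  by (simp add: inv_sqrt_def real_sqrt_mult)

lemma inv_sqrt_nonneg [simp]: "inv_sqrt a \<ge> 0"
  by (simp add: inv_sqrt_def)

lemma prod_inv_sqrt: "(\<Prod>i\<in>I. inv_sqrt (f i)) = inv_sqrt (\<Prod>i\<in>I. f i)"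
  by (induction I rule: infinite_finite_induct) (simp_all add: inv_sqrt_mult, simp_all add: inv_sqrt_def)

text \<open>This is the quantity T of the overview when \<open>I\<close> has k elements.\<close>

definition square_sum :: "'i set \<Rightarrow> nat \<Rightarrow> nat \<Rightarrow> real" where
  "square_sum I z x = (\<Sum>f\<in>square_tuples I z x. \<Prod>i\<in>I. inv_sqrt (f i))"

lemma finite_square_tuples [simp]: "finite I \<Longrightarrow> finite (square_tuples I z x)"
  unfolding square_tuples_def by (rule finite_subset[of _ "PiE I (\<lambda>_. rough_upto z x)"]) (auto intro: finite_PiE)

lemma square_sum_nonneg: "square_sum I z x \<ge> 0"
  unfolding square_sum_def by (intro sum_nonneg prod_nonneg) auto

lemma square_cancel:
  assumes "p\<^sup>2 * m = (s::nat)\<^sup>2" "prime p"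
  shows "perfect_square m"
proof -
  have "p dvd s\<^sup>2" using assms(1) by (metis dvd_triv_left dvd_mult_left power2_eq_square mult.assoc)
  hence "p dvd s" using assms(2) prime_dvd_power by blast
  then obtain t where "s = p * t" by (elim dvdE)
  hence "p\<^sup>2 * m = p\<^sup>2 * t\<^sup>2" using assms(1) by (simp add: power_mult_distrib)
  hence "m = t\<^sup>2" using prime_gt_0_nat[OF assms(2)] by simp
  thus ?thesis by blast
qed

text \<open>
  A prime dividing a square product divides two of the factors, or its square divides one of them;
  removing it there gains the factor \<open>1 / p\<close>.
\<close>
lemma square_tuples_prime_dvd_le:
  assumes I: "finite I" and p: "prime p"
  shows "(\<Sum>f | f \<in> square_tuples I z x \<and> p dvd (\<Prod>i\<in>I. f i). \<Prod>i\<in>I. inv_sqrt (f i)) \<le>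
    real (card I) ^ 2 / real p * square_sum I z x"
proof -
  \<comment> \<open>The pattern to divide out: p^2 at i if i = j, otherwise p at both i and j. Its
    product is p^2 in either case, so the quotient tuple still has a square product and the weight
    gained is 1/p.\<close>
  define e where "e i j l = (if i = j then (if l = i then p\<^sup>2 else 1) else (if l = i \<or> l = j then p else 1))" for i j l :: 'a
  define F where "F ij = {f \<in> square_tuples I z x. \<forall>l\<in>I. e (fst ij) (snd ij) l dvd f l}" for ij
  have p0: "p > 0" using p by (rule prime_gt_0_nat)
  have fin: "finite (F ij)" for ij
    by (rule finite_subset[OF _ finite_square_tuples[OF I, of z x]]) (auto simp: F_def)
  have prod_e: "(\<Prod>l\<in>I. e i j l) = p\<^sup>2" if "i \<in> I" "j \<in> I" for i j
  proof (cases "i = j")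
    case True
    thus ?thesis using that I by (simp add: e_def)
  next
    case False
    have "(\<Prod>l\<in>I. e i j l) = (\<Prod>l\<in>{i, j}. e i j l)"
      using that I by (intro prod.mono_neutral_right) (auto simp: e_def)
    thus ?thesis using False by (simp add: e_def power2_eq_square)
  qed
  have sum_F: "(\<Sum>f\<in>F (i, j). \<Prod>l\<in>I. inv_sqrt (f l)) \<le> 1 / real p * square_sum I z x"
    if ij: "i \<in> I" "j \<in> I" for i j
  proof -
    have "(\<Sum>f\<in>F (i, j). \<Prod>l\<in>I. inv_sqrt (f l)) \<le>
        (\<Prod>l\<in>I. inv_sqrt (e i j l)) * (\<Sum>f\<in>square_tuples I z x. \<Prod>l\<in>I. inv_sqrt (f l))"
    proof (rule sum_tuples_div_le[OF I inv_sqrt_mult inv_sqrt_nonneg])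
      show "F (i, j) \<subseteq> extensional I" by (auto simp: F_def square_tuples_def PiE_def)
      show "e i j l > 0" for l using p0 by (simp add: e_def)
      show "e i j l dvd f l" if "f \<in> F (i, j)" "l \<in> I" for f l using that by (simp add: F_def)
      fix f assume f: "f \<in> F (i, j)"
      define g where "g = (\<lambda>l\<in>I. f l div e i j l)"
      have fl: "f l = e i j l * g l" if "l \<in> I" for l using f that by (simp add: F_def g_def)
      have "(\<Prod>l\<in>I. f l) = (\<Prod>l\<in>I. e i j l) * (\<Prod>l\<in>I. g l)"
        unfolding prod.distrib[symmetric] by (intro prod.cong refl fl)
      moreover obtain s where "(\<Prod>l\<in>I. f l) = s\<^sup>2" using f by (auto simp: F_def square_tuples_def)
      ultimately have "p\<^sup>2 * (\<Prod>l\<in>I. g l) = s\<^sup>2" using prod_e[OF ij] by simp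
      hence "perfect_square (\<Prod>l\<in>I. g l)" using p by (rule square_cancel)
      moreover have "g \<in> PiE I (\<lambda>_. rough_upto z x)"
        using f unfolding g_def F_def square_tuples_def by (auto intro!: rough_upto_div)
      ultimately show "(\<lambda>l\<in>I. f l div e i j l) \<in> square_tuples I z x"
        by (simp add: square_tuples_def g_def)
    qed (use I in auto)
    also have "(\<Prod>l\<in>I. inv_sqrt (e i j l)) = 1 / real p"
      unfolding prod_inv_sqrt prod_e[OF ij] by (simp add: inv_sqrt_def)
    finally show ?thesis by (simp add: square_sum_def)
  qed
  have "{f \<in> square_tuples I z x. p dvd (\<Prod>i\<in>I. f i)} \<subseteq> (\<Union>ij\<in>I \<times> I. F ij)"
  proof
    fix f assume "f \<in> {f \<in> square_tuples I z x. p dvd (\<Prod>i\<in>I. f i)}"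
    hence f: "f \<in> square_tuples I z x" "p dvd (\<Prod>i\<in>I. f i)" by auto
    obtain i where i: "i \<in> I" "p dvd f i" using f(2) I p by (auto simp: prime_dvd_prod_iff)
    show "f \<in> (\<Union>ij\<in>I \<times> I. F ij)"
    proof (cases "p\<^sup>2 dvd f i")
      case True
      hence "f \<in> F (i, i)" using f(1) by (auto simp: F_def e_def)
      thus ?thesis using i by blast
    next
      case False
      \<comment> \<open>If p divided only this coordinate, and only once, the product would contain
        p to the first power exactly.\<close>
      have "\<exists>j\<in>I. j \<noteq> i \<and> p dvd f j"
      proof (rule ccontr)
        assume *: "\<not> (\<exists>j\<in>I. j \<noteq> i \<and> p dvd f j)"
        obtain c where c: "f i = p * c" using i by (elim dvdE)
        define m where "m = c * (\<Prod>j\<in>I-{i}. f j)"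
        have "\<not> p dvd c" using False c by (auto simp: power2_eq_square)
        moreover have "\<not> p dvd (\<Prod>j\<in>I-{i}. f j)" using * I p by (auto simp: prime_dvd_prod_iff)
        ultimately have "\<not> p dvd m" using p by (simp add: m_def prime_dvd_mult_iff)
        have "(\<Prod>j\<in>I. f j) = p * m" using prod.remove[OF I i(1), of f] c by (simp add: m_def)
        then obtain s where s: "p * m = s\<^sup>2" using f(1) by (auto simp: square_tuples_def)
        hence "p dvd s\<^sup>2" by (metis dvd_triv_left)
        hence "p dvd s" using p prime_dvd_power by blast
        then obtain t where "s = p * t" by (elim dvdE)
        hence "p * m = p * (p * t\<^sup>2)" using s by (simp only: power2_eq_square mult_ac)
        hence "m = p * t\<^sup>2" using p0 by simp
        thus False using \<open>\<not> p dvd m\<close> by simp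
      qed
      then obtain j where j: "j \<in> I" "j \<noteq> i" "p dvd f j" by blast
      hence "f \<in> F (i, j)" using f(1) i by (auto simp: F_def e_def)
      thus ?thesis using i j by blast
    qed
  qed
  hence "(\<Sum>f | f \<in> square_tuples I z x \<and> p dvd (\<Prod>i\<in>I. f i). \<Prod>i\<in>I. inv_sqrt (f i)) \<le>
      (\<Sum>f\<in>(\<Union>ij\<in>I \<times> I. F ij). \<Prod>i\<in>I. inv_sqrt (f i))"
    using I fin by (intro sum_mono2 prod_nonneg) auto
  also have "\<dots> \<le> (\<Sum>ij\<in>I \<times> I. \<Sum>f\<in>F ij. \<Prod>i\<in>I. inv_sqrt (f i))"
    using I fin by (intro sum_UN_nonneg_le prod_nonneg) auto
  also have "\<dots> \<le> (\<Sum>ij\<in>I \<times> I. 1 / real p * square_sum I z x)"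
    using sum_F by (intro sum_mono) auto
  also have "\<dots> = real (card I) ^ 2 / real p * square_sum I z x"
    by (simp add: card_cartesian_product power2_eq_square)
  finally show ?thesis .
qed

text \<open>After interchanging sums, each prime p > z contributes 1/p times the k^2/p of the
  preceding lemma, where k is the number of coordinates. It controls the average loss from requiring
  d to be coprime to the tuple.\<close>

lemma square_tuples_prime_reciprocals_le:
  assumes I: "finite I" and z: "z > 0"
  shows "(\<Sum>f\<in>square_tuples I z x. (\<Prod>i\<in>I. inv_sqrt (f i)) * (\<Sum>p\<in>prime_factors (\<Prod>i\<in>I. f i). 1 / real p)) \<le>
    real (card I) ^ 2 / real z * square_sum I z x"
proof -
  define T where "T = square_tuples I z x"
  define P where "P = (\<Union>f\<in>T. prime_factors (\<Prod>i\<in>I. f i))"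
  have finT: "finite T" using I by (simp add: T_def)
  hence finP: "finite P" by (auto simp: P_def)
  have prime_P: "prime p" if "p \<in> P" for p using that by (auto simp: P_def)
  have P_gt: "p > z" if p: "p \<in> P" for p
  proof -
    obtain f where f0: "f \<in> T" "p \<in> prime_factors (\<Prod>i\<in>I. f i)"
      using p unfolding P_def by blast
    have f: "f \<in> T" "prime p" "p dvd (\<Prod>i\<in>I. f i)"
      using f0 in_prime_factors_imp_prime in_prime_factors_imp_dvd by blast+
    then obtain i where "i \<in> I" "p dvd f i" using I by (auto simp: prime_dvd_prod_iff)
    moreover have "f i \<in> rough_upto z x" using f(1) \<open>i \<in> I\<close> by (auto simp: T_def square_tuples_def)
    ultimately show ?thesis using f(2) by (auto simp: rough_upto_def intro: ccontr)
  qed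
  have prod_pos: "(\<Prod>i\<in>I. f i) > 0" if "f \<in> T" for f
    using that by (intro prod_pos) (auto simp: T_def square_tuples_def rough_upto_def PiE_def Pi_def)
  have "(\<Sum>f\<in>T. (\<Prod>i\<in>I. inv_sqrt (f i)) * (\<Sum>p\<in>prime_factors (\<Prod>i\<in>I. f i). 1 / real p)) =
      (\<Sum>f\<in>T. \<Sum>p\<in>P. if p dvd (\<Prod>i\<in>I. f i) then (\<Prod>i\<in>I. inv_sqrt (f i)) * (1 / real p) else 0)"
  proof (intro sum.cong refl)
    fix f assume f: "f \<in> T"
    have "prime_factors (\<Prod>i\<in>I. f i) = {p \<in> P. p dvd (\<Prod>i\<in>I. f i)}"
    proof (intro equalityI subsetI)
      fix p assume "p \<in> prime_factors (\<Prod>i\<in>I. f i)"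
      thus "p \<in> {p \<in> P. p dvd (\<Prod>i\<in>I. f i)}"
        using f unfolding P_def by (blast dest: in_prime_factors_imp_dvd)
    next
      fix p assume "p \<in> {p \<in> P. p dvd (\<Prod>i\<in>I. f i)}"
      thus "p \<in> prime_factors (\<Prod>i\<in>I. f i)"
        using prime_P[of p] prod_pos[OF f] by (intro prime_factorsI) auto
    qed
    thus "(\<Prod>i\<in>I. inv_sqrt (f i)) * (\<Sum>p\<in>prime_factors (\<Prod>i\<in>I. f i). 1 / real p) =
        (\<Sum>p\<in>P. if p dvd (\<Prod>i\<in>I. f i) then (\<Prod>i\<in>I. inv_sqrt (f i)) * (1 / real p) else 0)"
      by (subst sum_distrib_left) (simp only: sum.inter_filter[OF finP])
  qed
  also have "\<dots> = (\<Sum>p\<in>P. 1 / real p * (\<Sum>f | f \<in> T \<and> p dvd (\<Prod>i\<in>I. f i). \<Prod>i\<in>I. inv_sqrt (f i)))"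
  proof (subst sum.swap, intro sum.cong refl)
    fix p
    show "(\<Sum>f\<in>T. if p dvd (\<Prod>i\<in>I. f i) then (\<Prod>i\<in>I. inv_sqrt (f i)) * (1 / real p) else 0) =
        1 / real p * (\<Sum>f | f \<in> T \<and> p dvd (\<Prod>i\<in>I. f i). \<Prod>i\<in>I. inv_sqrt (f i))"
      by (subst sum.inter_filter[OF finT, symmetric]) (simp add: sum_distrib_left)
  qed
  also have "\<dots> \<le> (\<Sum>p\<in>P. 1 / real p * (real (card I) ^ 2 / real p * square_sum I z x))"
    unfolding T_def by (intro sum_mono mult_left_mono square_tuples_prime_dvd_le I prime_P) auto
  also have "\<dots> = real (card I) ^ 2 * square_sum I z x * (\<Sum>p\<in>P. 1 / real p ^ 2)"
    unfolding sum_distrib_left by (intro sum.cong refl) (simp add: power2_eq_square)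
  also have "\<dots> \<le> real (card I) ^ 2 * square_sum I z x * (1 / real z)"
    using finP P_gt z square_sum_nonneg[of I z x] by (intro mult_left_mono sum_inverse_squares_le) auto
  finally show ?thesis by (simp add: T_def)
qed

section \<open>Lower bound for the square sum\<close>

definition rough_harmonic :: "nat \<Rightarrow> nat \<Rightarrow> real" where
  "rough_harmonic z y = (\<Sum>n\<in>rough_upto z y. 1 / real n)"

text \<open>Without coprimality the sum factors completely. A violating pair of coordinates shares a
  prime p > z; dividing both by it shows that such tuples have at most the share 1/p^2. Over all
  pairs and primes this is at most card(E)^2 / z, hence at most one half.\<close>

lemma coprime_tuples_sum_ge:
  assumes E: "finite E" and z: "z > 0" "z \<ge> 2 * card E ^ 2"
  shows "(\<Sum>v | v \<in> PiE E (\<lambda>_. rough_upto z y) \<and> (\<forall>a\<in>E. \<forall>b\<in>E. a \<noteq> b \<longrightarrow> coprime (v a) (v b)).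
      \<Prod>a\<in>E. 1 / real (v a)) \<ge> 1 / 2 * rough_harmonic z y ^ card E"
proof -
  define V where "V = PiE E (\<lambda>_. rough_upto z y)"
  define H where "H = rough_harmonic z y ^ card E"
  define w where "w n = 1 / real n" for n :: nat
  define good where "good v \<longleftrightarrow> (\<forall>a\<in>E. \<forall>b\<in>E. a \<noteq> b \<longrightarrow> coprime (v a) (v b))" for v :: "'a \<Rightarrow> nat"
  define P where "P = {p. prime p \<and> z < p \<and> p \<le> y}"
  define F where "F p ab = {v \<in> V. fst ab \<noteq> snd ab \<and> p dvd v (fst ab) \<and> p dvd v (snd ab)}" for p and ab :: "'a \<times> 'a"
  have finV: "finite V" using E by (auto simp: V_def intro!: finite_PiE)
  have finP: "finite P" by (rule finite_subset[of _ "{..y}"]) (auto simp: P_def)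
  have finF: "finite (F p ab)" for p ab by (rule finite_subset[OF _ finV]) (auto simp: F_def)
  have total: "(\<Sum>v\<in>V. \<Prod>a\<in>E. w (v a)) = H"
    unfolding V_def using prod_sum_PiE[OF E, of "\<lambda>_. rough_upto z y" "\<lambda>_. w"]
    by (simp add: w_def H_def rough_harmonic_def)
  have w_nonneg: "w n \<ge> 0" for n by (simp add: w_def)
  have sum_F: "(\<Sum>v\<in>F p (a, b). \<Prod>l\<in>E. w (v l)) \<le> 1 / real p ^ 2 * H"
    if ab: "a \<in> E" "b \<in> E" and p: "p \<in> P" for a b p
  proof (cases "a = b")
    case True
    thus ?thesis using total w_nonneg by (auto simp: F_def H_def rough_harmonic_def intro!: mult_nonneg_nonneg divide_nonneg_nonneg sum_nonneg zero_le_power)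
  next
    case False
    define e where "e l = (if l = a \<or> l = b then p else 1)" for l
    have p0: "p > 0" using p by (simp add: P_def prime_gt_0_nat)
    have "(\<Sum>v\<in>F p (a, b). \<Prod>l\<in>E. w (v l)) \<le> (\<Prod>l\<in>E. w (e l)) * (\<Sum>v\<in>V. \<Prod>l\<in>E. w (v l))"
    proof (rule sum_tuples_div_le[OF E])
      show "F p (a, b) \<subseteq> extensional E" by (auto simp: F_def V_def PiE_def)
      show "e l dvd v l" if "v \<in> F p (a, b)" "l \<in> E" for v l using that by (auto simp: F_def e_def)
      show "(\<lambda>l\<in>E. v l div e l) \<in> V" if "v \<in> F p (a, b)" for v
        using that unfolding F_def V_def by (auto intro!: rough_upto_div simp: e_def)
    qed (use p0 finV in \<open>auto simp: w_def e_def\<close>)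
    also have "(\<Prod>l\<in>E. w (e l)) = (\<Prod>l\<in>{a, b}. w (e l))"
      using ab E by (intro prod.mono_neutral_right) (auto simp: e_def w_def)
    also have "\<dots> = 1 / real p ^ 2" using False by (simp add: e_def w_def power2_eq_square)
    finally show ?thesis using total by simp
  qed
  have "V \<subseteq> {v \<in> V. good v} \<union> (\<Union>ab\<in>E \<times> E. \<Union>p\<in>P. F p ab)"
  proof
    fix v assume v: "v \<in> V"
    show "v \<in> {v \<in> V. good v} \<union> (\<Union>ab\<in>E \<times> E. \<Union>p\<in>P. F p ab)"
    proof (cases "good v")
      case False
      then obtain a b where ab: "a \<in> E" "b \<in> E" "a \<noteq> b" "\<not> coprime (v a) (v b)" by (auto simp: good_def)
      hence "gcd (v a) (v b) \<noteq> 1" using gcd_eq_1_imp_coprime by blast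
      then obtain p where p: "prime p" "p dvd gcd (v a) (v b)" using prime_factor_nat by blast
      have dvd: "p dvd v a" "p dvd v b" using p(2) gcd_dvd1 gcd_dvd2 dvd_trans by blast+
      have "v a \<in> rough_upto z y" using v ab by (auto simp: V_def)
      hence "p > z" "p \<le> y" using p(1) dvd(1) dvd_imp_le[of p "v a"]
        by (auto simp: rough_upto_def intro: ccontr)
      hence "p \<in> P" using p(1) by (simp add: P_def)
      moreover have "v \<in> F p (a, b)" using v ab dvd by (simp add: F_def)
      ultimately show ?thesis using ab by blast
    qed (use v in auto)
  qed
  hence "H \<le> (\<Sum>v\<in>{v \<in> V. good v} \<union> (\<Union>ab\<in>E \<times> E. \<Union>p\<in>P. F p ab). \<Prod>l\<in>E. w (v l))"
    unfolding total[symmetric] using E finP finF finV w_nonneg by (intro sum_mono2 prod_nonneg) auto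
  also have "\<dots> \<le> (\<Sum>v\<in>{v \<in> V. good v}. \<Prod>l\<in>E. w (v l)) + (\<Sum>v\<in>(\<Union>ab\<in>E \<times> E. \<Union>p\<in>P. F p ab). \<Prod>l\<in>E. w (v l))"
    using E finP finF finV w_nonneg by (intro sum_Un_nonneg_le prod_nonneg) auto
  also have "(\<Sum>v\<in>(\<Union>ab\<in>E \<times> E. \<Union>p\<in>P. F p ab). \<Prod>l\<in>E. w (v l)) \<le> 1 / 2 * H"
  proof -
    have "(\<Sum>v\<in>(\<Union>ab\<in>E \<times> E. \<Union>p\<in>P. F p ab). \<Prod>l\<in>E. w (v l)) \<le>
        (\<Sum>ab\<in>E \<times> E. \<Sum>v\<in>(\<Union>p\<in>P. F p ab). \<Prod>l\<in>E. w (v l))"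
      using E finP finF w_nonneg by (intro sum_UN_nonneg_le prod_nonneg) auto
    also have "\<dots> \<le> (\<Sum>ab\<in>E \<times> E. \<Sum>p\<in>P. \<Sum>v\<in>F p ab. \<Prod>l\<in>E. w (v l))"
      using finP finF w_nonneg by (intro sum_mono sum_UN_nonneg_le prod_nonneg) auto
    also have "\<dots> \<le> (\<Sum>ab\<in>E \<times> E. \<Sum>p\<in>P. 1 / real p ^ 2 * H)"
      using sum_F by (intro sum_mono) auto
    also have "\<dots> = real (card E) ^ 2 * ((\<Sum>p\<in>P. 1 / real p ^ 2) * H)"
      by (simp add: card_cartesian_product power2_eq_square sum_distrib_right)
    also have "\<dots> \<le> real (card E) ^ 2 * (1 / real z * H)"
      using finP z by (intro mult_left_mono mult_right_mono sum_inverse_squares_le)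
        (auto simp: P_def H_def rough_harmonic_def intro!: zero_le_power sum_nonneg)
    also have "\<dots> = (real (card E) ^ 2 / real z) * H" by simp
    also have "\<dots> \<le> 1 / 2 * H"
    proof (rule mult_right_mono)
      have "real (2 * card E ^ 2) \<le> real z" using z(2) by (simp only: of_nat_le_iff)
      thus "real (card E) ^ 2 / real z \<le> 1 / 2" using z(1) by (simp add: field_simps)
    qed (auto simp: H_def rough_harmonic_def intro!: zero_le_power sum_nonneg)
    finally show ?thesis .
  qed
  finally have "1 / 2 * H \<le> (\<Sum>v\<in>{v \<in> V. good v}. \<Prod>l\<in>E. w (v l))" by simp
  thus ?thesis by (simp add: H_def V_def good_def w_def)
qed

lemma rough_harmonic_ge:
  assumes "y > 0"
  shows "rough_harmonic z y \<ge> 1 / fact z * ln (real y / fact z)"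
proof -
  define Z where "Z = (fact z :: nat)"
  have Z: "Z > 0" by (simp add: Z_def)
  define J where "J = y div Z"
  have sub: "(\<lambda>j. 1 + Z * j) ` {..<J} \<subseteq> rough_upto z y"
  proof
    fix n assume "n \<in> (\<lambda>j. 1 + Z * j) ` {..<J}"
    then obtain j where j: "j < J" "n = 1 + Z * j" by auto
    have "Z * Suc j \<le> Z * J" using j by (intro mult_left_mono) auto
    also have "\<dots> \<le> y" unfolding J_def by (rule times_div_less_eq_dividend)
    finally have "n \<le> y" using j Z by simp
    moreover have "\<not> p dvd n" if p: "prime p" "p \<le> z" for p
    proof
      assume "p dvd n"
      moreover have "p dvd Z" unfolding Z_def using p by (intro dvd_fact) (auto simp: prime_gt_0_nat Suc_le_eq)
      ultimately have "p dvd 1" using j(2) by (metis dvd_add_left_iff dvd_mult2)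
      thus False using p(1) by auto
    qed
    ultimately show "n \<in> rough_upto z y" using j by (simp add: rough_upto_def)
  qed
  have "1 / real Z * ln (real y / real Z) \<le> 1 / real Z * ln (real J + 1)"
  proof (intro mult_left_mono)
    have "y < Z * (J + 1)" unfolding J_def using Z by (metis Suc_eq_plus1 dividend_less_times_div mult.commute mult_Suc_right add.commute mult_Suc)
    hence "real y \<le> real Z * (real J + 1)" by (metis less_imp_le of_nat_1 of_nat_add of_nat_le_iff of_nat_mult)
    thus "ln (real y / real Z) \<le> ln (real J + 1)" using assms Z by (simp add: field_simps)
  qed auto
  also have "\<dots> \<le> 1 / real Z * harm J" by (intro mult_left_mono harm_ge_ln) auto
  also have "\<dots> = (\<Sum>j<J. 1 / (real Z * real (Suc j)))"
    unfolding harm_def sum_distrib_left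
    by (rule sum.reindex_bij_witness[of _ Suc "\<lambda>j. j - 1"]) (auto simp: field_simps)
  also have "\<dots> \<le> (\<Sum>j<J. 1 / real (1 + Z * j))"
  proof (intro sum_mono divide_left_mono)
    fix j :: nat
    have "1 + Z * j \<le> Z * Suc j" using Z by simp
    hence "real (1 + Z * j) \<le> real (Z * Suc j)" by (simp only: of_nat_le_iff)
    thus "real (1 + Z * j) \<le> real Z * real (Suc j)" by (simp only: of_nat_mult)
  qed (use Z in \<open>auto intro!: mult_pos_pos add_pos_nonneg\<close>)
  also have "\<dots> = (\<Sum>n\<in>(\<lambda>j. 1 + Z * j) ` {..<J}. 1 / real n)"
    using Z by (subst sum.reindex) (auto simp: inj_on_def)
  also have "\<dots> \<le> rough_harmonic z y"
    unfolding rough_harmonic_def using sub by (intro sum_mono2) auto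
  finally show ?thesis by (simp add: Z_def)
qed


text \<open>The upper triangle with the diagonal. Each index contributes one harmonic sum, so its
  size k(k+1)/2 becomes the exponent of the logarithm.\<close>

definition pair_index :: "nat \<Rightarrow> (nat \<times> nat) set" where
  "pair_index k = (SIGMA i:{..<k}. {i..<k})"

lemma finite_pair_index [simp]: "finite (pair_index k)"
  by (simp add: pair_index_def)

lemma card_pair_index: "card (pair_index k) = k * (k + 1) div 2"
proof -
  have "card (pair_index k) = (\<Sum>i<k. k - i)" by (simp add: pair_index_def)
  also have "\<dots> = (\<Sum>i<k. Suc (k - Suc i))" by (intro sum.cong refl) auto
  also have "\<dots> = (\<Sum>i<k. Suc i)" by (rule sum.nat_diff_reindex)
  also have "2 * \<dots> = k * (k + 1)" by (induction k) auto
  hence "(\<Sum>i<k. Suc i) = k * (k + 1) div 2" by simp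
  finally show ?thesis .
qed

definition sorted_pair :: "nat \<Rightarrow> nat \<Rightarrow> nat \<times> nat" where
  "sorted_pair i j = (min i j, max i j)"

text \<open>
  Each off-diagonal entry \<open>v (i, j)\<close> is shared by the coordinates \<open>i\<close> and \<open>j\<close>. If the entries are
  pairwise coprime, it is recovered as their greatest common divisor.
\<close>
definition tuple_of_pairs :: "nat \<Rightarrow> (nat \<times> nat \<Rightarrow> nat) \<Rightarrow> nat \<Rightarrow> nat" where
  "tuple_of_pairs k v = (\<lambda>i\<in>{..<k}. v (i, i) ^ 2 * (\<Prod>j\<in>{..<k} - {i}. v (sorted_pair i j)))"

text \<open>Each entry is used twice: a diagonal one through its square, an off-diagonal one in two
  coordinates.\<close>

lemma prod_tuple_of_pairs:
  "(\<Prod>i<k. tuple_of_pairs k v i) = (\<Prod>a\<in>pair_index k. v a)\<^sup>2"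
proof -
  define E where "E = {(i, j). i < j \<and> j < k}"
  define E' where "E' = {(i, j). j < i \<and> i < k}"
  have fin: "finite E" "finite E'"
    by (rule finite_subset[of _ "{..<k} \<times> {..<k}"]; auto simp: E_def E'_def)+
  have "(\<Prod>i<k. tuple_of_pairs k v i) =
      (\<Prod>i<k. v (i, i)) ^ 2 * (\<Prod>i<k. \<Prod>j\<in>{..<k} - {i}. v (sorted_pair i j))"
    by (simp add: tuple_of_pairs_def prod.distrib prod_power_distrib)
  also have "(\<Prod>i<k. \<Prod>j\<in>{..<k} - {i}. v (sorted_pair i j)) =
      (\<Prod>(i, j)\<in>(SIGMA i:{..<k}. {..<k} - {i}). v (sorted_pair i j))"
    by (rule prod.Sigma) auto
  also have "(SIGMA i:{..<k}. {..<k} - {i}) = E \<union> E'" by (auto simp: E_def E'_def)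
  also have "(\<Prod>(i, j)\<in>E \<union> E'. v (sorted_pair i j)) =
      (\<Prod>(i, j)\<in>E. v (sorted_pair i j)) * (\<Prod>(i, j)\<in>E'. v (sorted_pair i j))"
    using fin by (intro prod.union_disjoint) (auto simp: E_def E'_def)
  also have "(\<Prod>(i, j)\<in>E. v (sorted_pair i j)) = (\<Prod>a\<in>E. v a)"
    by (intro prod.cong refl) (auto simp: E_def sorted_pair_def)
  also have "(\<Prod>(i, j)\<in>E'. v (sorted_pair i j)) = (\<Prod>a\<in>E. v a)"
    by (rule prod.reindex_bij_witness[of _ prod.swap prod.swap]) (auto simp: E_def E'_def sorted_pair_def)
  also have "(\<Prod>i<k. v (i, i)) ^ 2 * ((\<Prod>a\<in>E. v a) * (\<Prod>a\<in>E. v a)) = ((\<Prod>i<k. v (i, i)) * (\<Prod>a\<in>E. v a)) ^ 2"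
    by (simp add: power2_eq_square)
  also have "(\<Prod>i<k. v (i, i)) * (\<Prod>a\<in>E. v a) = (\<Prod>a\<in>pair_index k. v a)"
  proof -
    have "pair_index k = (\<lambda>i. (i, i)) ` {..<k} \<union> E" by (auto simp: pair_index_def E_def)
    hence "(\<Prod>a\<in>pair_index k. v a) = (\<Prod>a\<in>(\<lambda>i. (i, i)) ` {..<k}. v a) * (\<Prod>a\<in>E. v a)"
      using fin by (subst prod.union_disjoint[symmetric]) (auto simp: E_def)
    also have "(\<Prod>a\<in>(\<lambda>i. (i, i)) ` {..<k}. v a) = (\<Prod>i<k. v (i, i))"
      by (subst prod.reindex) (auto simp: inj_on_def)
    finally show ?thesis by simp
  qed
  finally show ?thesis .
qed

text \<open>After removing the shared entry, coordinates i and j are built from disjoint sets of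
  indices, so the cofactors are coprime.\<close>

lemma gcd_tuple_of_pairs:
  assumes cop: "\<And>a b. a \<in> pair_index k \<Longrightarrow> b \<in> pair_index k \<Longrightarrow> a \<noteq> b \<Longrightarrow> coprime (v a) (v b)"
    and ij: "i < j" "j < k"
  shows "gcd (tuple_of_pairs k v i) (tuple_of_pairs k v j) = v (i, j)"
proof -
  define A where "A = v (i, i) ^ 2 * (\<Prod>l\<in>{..<k} - {i, j}. v (sorted_pair i l))"
  define B where "B = v (j, j) ^ 2 * (\<Prod>l\<in>{..<k} - {i, j}. v (sorted_pair j l))"
  have eq1: "{..<k} - {i} = insert j ({..<k} - {i, j})" and eq2: "{..<k} - {j} = insert i ({..<k} - {i, j})"
    using ij by auto
  have Ai: "tuple_of_pairs k v i = v (i, j) * A"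
  proof -
    have "tuple_of_pairs k v i = v (i, i) ^ 2 * (\<Prod>j\<in>{..<k} - {i}. v (sorted_pair i j))"
      using ij by (simp add: tuple_of_pairs_def)
    thus ?thesis unfolding eq1 A_def using ij by (simp add: sorted_pair_def)
  qed
  have Bj: "tuple_of_pairs k v j = v (i, j) * B"
  proof -
    have "tuple_of_pairs k v j = v (j, j) ^ 2 * (\<Prod>i\<in>{..<k} - {j}. v (sorted_pair j i))"
      using ij by (simp add: tuple_of_pairs_def)
    thus ?thesis unfolding eq2 B_def using ij by (simp add: sorted_pair_def)
  qed
  have mem: "sorted_pair a b \<in> pair_index k" if "a < k" "b < k" for a b
    using that by (auto simp: sorted_pair_def pair_index_def)
  have c: "coprime (v a) (v b)" if "a \<in> pair_index k" "b \<in> pair_index k" "a \<noteq> b" for a b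
    using cop that by blast
  have diag: "(i, i) \<in> pair_index k" "(j, j) \<in> pair_index k" using ij by (auto simp: pair_index_def)
  have "coprime A B"
    unfolding A_def B_def coprime_mult_left_iff coprime_mult_right_iff
  proof (intro conjI)
    show "coprime (v (i, i) ^ 2) (v (j, j) ^ 2)" using c[OF diag] ij by simp
    show "coprime (v (i, i) ^ 2) (\<Prod>l\<in>{..<k} - {i, j}. v (sorted_pair j l))"
    proof (rule prod_coprime_right)
      fix l assume l: "l \<in> {..<k} - {i, j}"
      have "(i, i) \<noteq> sorted_pair j l" using l ij by (auto simp: sorted_pair_def min_def max_def split: if_splits)
      thus "coprime (v (i, i) ^ 2) (v (sorted_pair j l))" using c[OF diag(1) mem[of j l]] l ij by simp
    qed
    show "coprime (\<Prod>l\<in>{..<k} - {i, j}. v (sorted_pair i l)) (v (j, j) ^ 2)"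
    proof (rule prod_coprime_left)
      fix l assume l: "l \<in> {..<k} - {i, j}"
      have "sorted_pair i l \<noteq> (j, j)" using l ij by (auto simp: sorted_pair_def min_def max_def split: if_splits)
      thus "coprime (v (sorted_pair i l)) (v (j, j) ^ 2)" using c[OF mem[of i l] diag(2)] l ij by simp
    qed
    show "coprime (\<Prod>l\<in>{..<k} - {i, j}. v (sorted_pair i l)) (\<Prod>l\<in>{..<k} - {i, j}. v (sorted_pair j l))"
    proof (intro prod_coprime_left prod_coprime_right)
      fix l m assume lm: "l \<in> {..<k} - {i, j}" "m \<in> {..<k} - {i, j}"
      have "sorted_pair i l \<noteq> sorted_pair j m" using lm ij
        by (auto simp: sorted_pair_def min_def max_def split: if_splits)
      thus "coprime (v (sorted_pair i l)) (v (sorted_pair j m))" using c mem lm ij by simp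
    qed
  qed
  hence "gcd A B = 1" by (rule coprime_imp_gcd_eq_1)
  thus ?thesis unfolding Ai Bj by (simp only: gcd_mult_distrib_nat[symmetric])
qed

text \<open>The parametrisation is injective: gcds recover the off-diagonal entries, and cancelling
  these recovers the diagonal. A coordinate is a product of k + 1 entries counted with multiplicity,
  whence y^(k+1) <= x. The weight of the image is the product of 1/v over all entries, since the
  total product is the square of theirs.\<close>

lemma square_sum_ge:
  assumes z: "z > 0" "z \<ge> 2 * (k * (k + 1) div 2) ^ 2" and y: "y ^ (k + 1) \<le> x" "y > 0"
  shows "square_sum {..<k} z x \<ge> 1 / 2 * rough_harmonic z y ^ (k * (k + 1) div 2)"
proof -
  define E where "E = pair_index k"
  define G where "G = {v. v \<in> PiE E (\<lambda>_. rough_upto z y) \<and>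
    (\<forall>a\<in>E. \<forall>b\<in>E. a \<noteq> b \<longrightarrow> coprime (v a) (v b))}"
  let ?t = "tuple_of_pairs k"
  have val: "v a \<in> rough_upto z y" if "v \<in> G" "a \<in> E" for v a using that by (auto simp: G_def)
  have mem: "sorted_pair i j \<in> E" if "i < k" "j < k" for i j
    using that by (auto simp: sorted_pair_def pair_index_def E_def)
  have diag: "(i, i) \<in> E" if "i < k" for i using that by (auto simp: pair_index_def E_def)
  have pos: "v a > 0" if "v \<in> G" "a \<in> E" for v a using val[OF that] by (simp add: rough_upto_def)
  have inj: "inj_on ?t G"
  proof (rule inj_onI)
    fix v w assume vw: "v \<in> G" "w \<in> G" "?t v = ?t w"
    have off: "v (i, j) = w (i, j)" if "i < j" "j < k" for i j
      using gcd_tuple_of_pairs[OF _ that, of v] gcd_tuple_of_pairs[OF _ that, of w] vw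
      unfolding G_def E_def by auto
    have dg: "v (i, i) = w (i, i)" if "i < k" for i
    proof -
      have eq: "(\<Prod>j\<in>{..<k} - {i}. v (sorted_pair i j)) = (\<Prod>j\<in>{..<k} - {i}. w (sorted_pair i j))"
        using that by (intro prod.cong refl) (auto simp: sorted_pair_def min_def max_def intro!: off)
      define P where "P = (\<Prod>j\<in>{..<k} - {i}. w (sorted_pair i j))"
      have "P > 0" unfolding P_def
        using that by (intro prod_pos) (auto intro!: pos[OF vw(2)] mem)
      moreover have "?t v i = ?t w i" using vw(3) by simp
      hence "v (i, i) ^ 2 * P = w (i, i) ^ 2 * P" using that by (simp only: tuple_of_pairs_def eq P_def restrict_apply' lessThan_iff)
      ultimately have "v (i, i) ^ 2 = w (i, i) ^ 2" by simp
      thus ?thesis by simp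
    qed
    show "v = w"
    proof (rule extensionalityI[of _ E])
      fix a assume "a \<in> E"
      then obtain i j where a: "a = (i, j)" "i \<le> j" "j < k" by (auto simp: E_def pair_index_def)
      thus "v a = w a" using off[of i j] dg[of j] by (cases "i = j") auto
    qed (use vw in \<open>auto simp: G_def PiE_def\<close>)
  qed
  have sub: "?t ` G \<subseteq> square_tuples {..<k} z x"
  proof
    fix f assume "f \<in> ?t ` G"
    then obtain v where v: "v \<in> G" "f = ?t v" by blast
    have "f i \<in> rough_upto z x" if i: "i < k" for i
    proof -
      have fi: "f i = v (i, i) ^ 2 * (\<Prod>j\<in>{..<k} - {i}. v (sorted_pair i j))"
        using i by (simp add: v tuple_of_pairs_def)
      have "(\<Prod>j\<in>{..<k} - {i}. v (sorted_pair i j)) \<le> (\<Prod>j\<in>{..<k} - {i}. y)"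
      proof (intro prod_mono conjI)
        fix j assume "j \<in> {..<k} - {i}"
        thus "v (sorted_pair i j) \<le> y" using val[OF v(1) mem[of i j]] i by (simp add: rough_upto_def)
      qed simp
      also have "\<dots> = y ^ (k - 1)" using i by simp
      finally have "f i \<le> y ^ 2 * y ^ (k - 1)"
        unfolding fi using val[OF v(1) diag[OF i]] by (intro mult_mono power_mono) (auto simp: rough_upto_def)
      also have "\<dots> = y ^ (k + 1)" using i by (simp flip: power_add)
      finally have "f i \<le> x" using y by linarith
      moreover have "f i > 0" unfolding fi using i
        by (auto intro!: prod_pos pos[OF v(1)] mem diag)
      moreover have "\<not> p dvd f i" if p: "prime p" "p \<le> z" for p
      proof -
        have nd: "\<not> p dvd v a" if "a \<in> E" for a using val[OF v(1) that] p by (simp add: rough_upto_def)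
        have "\<not> p dvd (\<Prod>j\<in>{..<k} - {i}. v (sorted_pair i j))"
          using nd mem i p by (auto simp: prime_dvd_prod_iff)
        thus ?thesis unfolding fi using nd[OF diag[OF i]] p
          by (auto simp: prime_dvd_mult_iff prime_dvd_power_iff)
      qed
      ultimately show ?thesis by (simp add: rough_upto_def)
    qed
    moreover have "f \<in> extensional {..<k}" by (simp add: v tuple_of_pairs_def)
    moreover have "perfect_square (\<Prod>i<k. f i)" unfolding v(2) prod_tuple_of_pairs by blast
    ultimately show "f \<in> square_tuples {..<k} z x" by (auto simp: square_tuples_def PiE_def)
  qed
  have "1 / 2 * rough_harmonic z y ^ card E \<le> (\<Sum>v\<in>G. \<Prod>a\<in>E. 1 / real (v a))"
    unfolding G_def using z by (intro coprime_tuples_sum_ge) (simp_all add: E_def card_pair_index)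
  also have "\<dots> = (\<Sum>v\<in>G. \<Prod>i<k. inv_sqrt (?t v i))"
  proof (intro sum.cong refl)
    fix v
    show "(\<Prod>a\<in>E. 1 / real (v a)) = (\<Prod>i<k. inv_sqrt (?t v i))"
      unfolding prod_inv_sqrt prod_tuple_of_pairs by (simp add: inv_sqrt_def E_def prod_dividef abs_prod)
  qed
  also have "\<dots> = (\<Sum>f\<in>?t ` G. \<Prod>i<k. inv_sqrt (f i))" using inj by (simp add: sum.reindex)
  also have "\<dots> \<le> square_sum {..<k} z x"
    unfolding square_sum_def using sub by (intro sum_mono2 prod_nonneg) auto
  finally show ?thesis by (simp add: E_def card_pair_index)
qed

theorem square_sum_lower_bound:
  assumes z: "z > 0" "z \<ge> 2 * (k * (k + 1) div 2) ^ 2"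
  shows "\<exists>c>0. \<exists>x0. \<forall>x\<ge>x0. square_sum {..<k} z x \<ge> c * ln (real x) ^ (k * (k + 1) div 2)"
proof -
  define N where "N = k * (k + 1) div 2"
  define K where "K = real (k + 1)"
  define Z where "Z = (fact z :: real)"
  have Z: "Z \<ge> 1" by (simp add: Z_def)
  have K: "K \<ge> 1" by (simp add: K_def)
  define c where "c = 1 / 2 * (1 / Z * (1 / (2 * K))) ^ N"
  \<comment> \<open>Makes \<open>ln (2 * Z)\<close> at most half of ln(x)/K. The 2 pays for rounding
    x^(1/K) down to y, and \<open>Z\<close> is the factorial from
    \<open>rough_harmonic_ge\<close>.\<close>
  define x0 where "x0 = nat \<lceil>exp (2 * K * ln (2 * Z))\<rceil> + 1"
  have "square_sum {..<k} z x \<ge> c * ln (real x) ^ N" if x: "x \<ge> x0" for x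
  proof -
    have "exp (2 * K * ln (2 * Z)) \<le> real x" using x unfolding x0_def by linarith
    moreover have x1: "real x \<ge> 1" using x unfolding x0_def by linarith
    ultimately have lnx: "2 * K * ln (2 * Z) \<le> ln (real x)" by (simp add: ln_ge_iff)
    define y where "y = nat \<lfloor>real x powr (1 / K)\<rfloor>"
    have r1: "real x powr (1 / K) \<ge> 1" using x1 K by (intro ge_one_powr_ge_zero) auto
    have y: "real y \<le> real x powr (1 / K)" "real y \<ge> real x powr (1 / K) - 1" "y > 0"
      using r1 unfolding y_def by linarith+
    have "real (y ^ (k + 1)) \<le> (real x powr (1 / K)) ^ (k + 1)"
      unfolding of_nat_power using y by (intro power_mono) auto
    also have "\<dots> = (real x powr (1 / K)) powr K"
      unfolding K_def by (rule powr_realpow[symmetric]) (use x1 in simp)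
    also have "\<dots> = real x" using x1 K by (simp add: powr_powr)
    finally have yx: "y ^ (k + 1) \<le> x" by (simp only: of_nat_le_iff)
    have y2: "real y \<ge> real x powr (1 / K) / 2" using y r1 by (cases "y = 1") linarith+
    have "ln (real x) / K - ln (2 * Z) = ln (real x powr (1 / K) / 2 / Z)"
      using x1 Z by (simp add: ln_div ln_mult ln_powr)
    also have "\<dots> \<le> ln (real y / Z)"
    proof (rule ln_mono)
      show "real x powr (1 / K) / 2 / Z \<le> real y / Z" using y2 Z by (intro divide_right_mono) auto
    qed (use x1 Z y in auto)
    finally have "ln (real y / Z) \<ge> ln (real x) / K - ln (2 * Z)" .
    moreover have "ln (2 * Z) \<le> ln (real x) / (2 * K)" using lnx K by (simp add: field_simps)
    moreover have "ln (real x) / K = 2 * (ln (real x) / (2 * K))" using K by simp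
    ultimately have "ln (real y / Z) \<ge> ln (real x) / (2 * K)" by linarith
    hence "1 / Z * (ln (real x) / (2 * K)) \<le> 1 / Z * ln (real y / Z)"
      using Z by (intro mult_left_mono) auto
    also have "\<dots> \<le> rough_harmonic z y" unfolding Z_def by (rule rough_harmonic_ge[OF y(3)])
    finally have "(1 / Z * (ln (real x) / (2 * K))) ^ N \<le> rough_harmonic z y ^ N"
      using x1 Z K by (intro power_mono) auto
    hence "1 / 2 * (1 / Z * (ln (real x) / (2 * K))) ^ N \<le> 1 / 2 * rough_harmonic z y ^ N" by simp
    also have "\<dots> \<le> square_sum {..<k} z x" unfolding N_def by (rule square_sum_ge[OF z yx y(3)])
    finally show ?thesis by (simp add: c_def power_mult_distrib power_divide mult_ac)
  qed
  moreover have "c > 0" using Z K by (simp add: c_def)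
  ultimately show ?thesis unfolding N_def by blast
qed

section \<open>The twisted first moment\<close>

text \<open>Abel summation. A second version for decreasing weights follows because the dual kernel,
  as a function of d, is an increasing factor times a decreasing one.\<close>

lemma abel_bound_mono:
  fixes c g :: "nat \<Rightarrow> real"
  assumes S: "\<And>D. D \<le> B \<Longrightarrow> \<bar>\<Sum>n\<le>D. c n\<bar> \<le> P"
    and g: "\<And>m n. m \<le> n \<Longrightarrow> n \<le> B \<Longrightarrow> g m \<le> g n" "g 0 \<ge> 0"
  shows "\<bar>\<Sum>n\<le>B. c n * g n\<bar> \<le> 2 * P * g B"
proof -
  have P: "P \<ge> 0" using S[of 0] by linarith
  have "\<bar>(\<Sum>n\<le>D. c n * g n) - (\<Sum>n\<le>D. c n) * g D\<bar> \<le> P * (g D - g 0)" if "D \<le> B" for D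
    using that
  proof (induction D)
    case (Suc D)
    have "(\<Sum>n\<le>Suc D. c n * g n) - (\<Sum>n\<le>Suc D. c n) * g (Suc D) =
        ((\<Sum>n\<le>D. c n * g n) - (\<Sum>n\<le>D. c n) * g D) + - ((\<Sum>n\<le>D. c n) * (g (Suc D) - g D))"
      by (simp add: algebra_simps)
    also have "\<bar>\<dots>\<bar> \<le> P * (g D - g 0) + P * (g (Suc D) - g D)"
    proof (intro order_trans[OF abs_triangle_ineq] add_mono)
      show "\<bar>- ((\<Sum>n\<le>D. c n) * (g (Suc D) - g D))\<bar> \<le> P * (g (Suc D) - g D)"
        unfolding abs_minus_cancel abs_mult using S[of D] g(1)[of D "Suc D"] Suc.prems P
        by (intro mult_mono) auto
    qed (use Suc in auto)
    finally show ?case by (simp add: algebra_simps)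
  qed simp
  from this[of B] have "\<bar>(\<Sum>n\<le>B. c n * g n) - (\<Sum>n\<le>B. c n) * g B\<bar> \<le> P * (g B - g 0)" by simp
  moreover have "\<bar>(\<Sum>n\<le>B. c n) * g B\<bar> \<le> P * g B"
    unfolding abs_mult using S[of B] P g(1)[of 0 B] g(2) by (intro mult_mono) auto
  moreover have "P * g 0 \<ge> 0" using P g(2) by simp
  ultimately show ?thesis by (simp add: algebra_simps)
qed

lemma abel_bound_antimono:
  fixes c f :: "nat \<Rightarrow> real"
  assumes S: "\<And>D. D \<le> B \<Longrightarrow> \<bar>\<Sum>n\<le>D. c n\<bar> \<le> P"
    and f: "\<And>m n. m \<le> n \<Longrightarrow> f n \<le> f m" "\<And>n. f n \<ge> 0"
  shows "\<bar>\<Sum>n\<le>B. c n * f n\<bar> \<le> P * f 0"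
proof -
  have P: "P \<ge> 0" using S[of 0] by linarith
  have "\<bar>(\<Sum>n\<le>D. c n * f n) - (\<Sum>n\<le>D. c n) * f D\<bar> \<le> P * (f 0 - f D)" if "D \<le> B" for D
    using that
  proof (induction D)
    case (Suc D)
    have "(\<Sum>n\<le>Suc D. c n * f n) - (\<Sum>n\<le>Suc D. c n) * f (Suc D) =
        ((\<Sum>n\<le>D. c n * f n) - (\<Sum>n\<le>D. c n) * f D) + (\<Sum>n\<le>D. c n) * (f D - f (Suc D))"
      by (simp add: algebra_simps)
    also have "\<bar>\<dots>\<bar> \<le> P * (f 0 - f D) + P * (f D - f (Suc D))"
    proof (intro order_trans[OF abs_triangle_ineq] add_mono)
      show "\<bar>(\<Sum>n\<le>D. c n) * (f D - f (Suc D))\<bar> \<le> P * (f D - f (Suc D))"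
        unfolding abs_mult using S[of D] f(1)[of D "Suc D"] Suc.prems P
        by (intro mult_mono) auto
    qed (use Suc in auto)
    finally show ?case by (simp add: algebra_simps)
  qed simp
  from this[of B] have "\<bar>(\<Sum>n\<le>B. c n * f n) - (\<Sum>n\<le>B. c n) * f B\<bar> \<le> P * (f 0 - f B)" by simp
  moreover have "\<bar>(\<Sum>n\<le>B. c n) * f B\<bar> \<le> P * f B"
    unfolding abs_mult using S[of B] P f(2) by (intro mult_mono) auto
  ultimately show ?thesis by (simp add: algebra_simps)
qed

section \<open>The family of discriminants\<close>

definition family :: "nat \<Rightarrow> nat set" where
  "family X = {d \<in> squarefree_progression X. X < 2 * d}"

lemma finite_squarefree_progression [simp]: "finite (squarefree_progression D)"
  by (simp add: squarefree_progression_def)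

lemma finite_family [simp]: "finite (family X)"
  by (simp add: family_def)

lemma family_D:
  assumes "d \<in> family X"
  shows "squarefree d" "d mod 8 = 1" "d \<le> X" "X < 2 * d" "d > 0"
  using assms by (auto simp: family_def squarefree_progression_def progression_def intro: Nat.gr0I)

text \<open>Thanks to the dyadic range, d > X/2 already exceeds the threshold needed for the sign of
  the Gauss sum.\<close>

lemma real_character_family:
  assumes "X \<ge> 20000" "d \<in> family X"
  shows "real_character d"
  using family_D[OF assms(2)] assms(1) by unfold_locales auto

text \<open>Since \<open>\<chi>\<^sub>d(2) = 1\<close> throughout the family, only the odd part of the argument matters.\<close>
lemma jacobi_odd_part:
  assumes "m > 0"
  shows "\<exists>m'. odd m' \<and> m' \<le> m \<and> (\<forall>\<nu> d. d mod 8 = 1 \<longrightarrow> jacobi (int (\<nu> * m)) d = jacobi (int (\<nu> * m')) d)"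
  using assms
proof (induction m rule: less_induct)
  case (less m)
  show ?case
  proof (cases "odd m")
    case False
    hence "even m" by simp
    then obtain c where c: "m = 2 * c" by (elim evenE)
    then obtain m' where m': "odd m'" "m' \<le> c"
      "\<And>\<nu> d. d mod 8 = 1 \<Longrightarrow> jacobi (int (\<nu> * c)) d = jacobi (int (\<nu> * m')) d"
      using less.IH[of c] less.prems by auto
    have "jacobi (int (\<nu> * m)) d = jacobi (int (\<nu> * m')) d" if "d mod 8 = 1" for \<nu> d
    proof -
      have "int (\<nu> * m) = 2 * int (\<nu> * c)" by (simp add: c)
      hence "jacobi (int (\<nu> * m)) d = jacobi 2 d * jacobi (int (\<nu> * c)) d" by (simp only: jacobi_mult_left)
      thus ?thesis using m'(3)[OF that, of \<nu>] jacobi_2[OF that] by simp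
    qed
    thus ?thesis using m' c by (intro exI[of _ m']) auto
  qed auto
qed

lemma jacobi_flip:
  assumes "d mod 8 = 1" "odd l"
  shows "jacobi (int l) d = jacobi (int d) l"
  using jacobi_reciprocity[of d l] assms mod_mod_cancel[of 4 8 d] by simp

lemma jacobi_square_nonneg:
  assumes "perfect_square l" "l > 0"
  shows "jacobi a l \<ge> 0"
proof -
  obtain s where s: "l = s * s" using assms by (auto simp: power2_eq_square)
  thus ?thesis using assms(2) by (simp add: jacobi_mult_right)
qed

text \<open>Chosen once, so that a single constant independent of the length and the modulus can
  appear in the statements that follow.\<close>

definition family_constant :: real where
  "family_constant = (SOME C. C > 0 \<and> (\<forall>D l. odd l \<longrightarrow> \<not> perfect_square l \<longrightarrow>
    \<bar>\<Sum>d\<in>squarefree_progression D. jacobi (int d) l\<bar> \<le> C * real D powr (11/20) * real l powr (1/4)))"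

lemma family_constant:
  "family_constant > 0"
  "odd l \<Longrightarrow> \<not> perfect_square l \<Longrightarrow> \<bar>\<Sum>d\<in>squarefree_progression D. jacobi (int d) l\<bar> \<le>
     family_constant * real D powr (11/20) * real l powr (1/4)"
  using someI_ex[OF squarefree_jacobi_sum_le] unfolding family_constant_def[symmetric] by blast+

text \<open>After passing to the odd part and flipping the symbol, the modulus is either a square,
  and all terms are 0 or 1, or a non-square, and they cancel. The factor 2 arises because the family
  is a difference of two initial segments of the squarefree progression. Extension by zero to all n
  prepares partial summation in d.\<close>

lemma family_sum_dichotomy:
  fixes X \<nu> m :: nat
  assumes \<nu>: "odd \<nu>" and m: "m > 0"
  defines "c n \<equiv> (if n \<in> family X then of_int (jacobi (int (\<nu> * m)) n) else (0::real))"
  shows "(\<forall>n. c n \<ge> 0) \<or>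
    (\<forall>D\<le>X. \<bar>\<Sum>n\<le>D. c n\<bar> \<le> 2 * family_constant * real X powr (11/20) * real (\<nu> * m) powr (1/4))"
proof -
  obtain m' where m': "odd m'" "m' \<le> m"
    "\<And>\<nu> d. d mod 8 = 1 \<Longrightarrow> jacobi (int (\<nu> * m)) d = jacobi (int (\<nu> * m')) d"
    using jacobi_odd_part[OF m] by blast
  define l where "l = \<nu> * m'"
  have l: "odd l" "l > 0" using \<nu> m' by (auto simp: l_def intro!: Nat.gr0I)
  have jac: "jacobi (int (\<nu> * m)) d = jacobi (int d) l" if "d mod 8 = 1" for d
    using m'(3)[OF that] jacobi_flip[OF that l(1)] by (simp add: l_def)
  have c: "c n = (if n \<in> family X then of_int (jacobi (int n) l) else 0)" for n
    using jac family_D(2) by (auto simp: c_def)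
  show ?thesis
  proof (cases "perfect_square l")
    case True
    thus ?thesis using jacobi_square_nonneg[OF True l(2)] by (auto simp: c)
  next
    case False
    let ?K = "family_constant * real X powr (11/20) * real (\<nu> * m) powr (1/4)"
    have le: "real_of_int \<bar>\<Sum>d\<in>squarefree_progression D. jacobi (int d) l\<bar> \<le> ?K" if "D \<le> X" for D
    proof -
      have "real_of_int \<bar>\<Sum>d\<in>squarefree_progression D. jacobi (int d) l\<bar> \<le>
          family_constant * real D powr (11/20) * real l powr (1/4)"
        by (rule family_constant(2)[OF l(1) False])
      also have "\<dots> \<le> ?K"
      proof -
        have "l \<le> \<nu> * m" unfolding l_def using m' by simp
        hence "real l \<le> real (\<nu> * m)" by (rule of_nat_mono)
        thus ?thesis using that family_constant(1) by (intro mult_mono powr_mono2) auto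
      qed
      finally show ?thesis .
    qed
    have "\<bar>\<Sum>n\<le>D. c n\<bar> \<le> 2 * ?K" if D: "D \<le> X" for D
    proof -
      define D' where "D' = min D (X div 2)"
      have "squarefree_progression D = {n \<in> {..D}. n \<in> family X} \<union> squarefree_progression D'"
        using D by (auto simp: family_def squarefree_progression_def progression_def D'_def)
      moreover have "{n \<in> {..D}. n \<in> family X} \<inter> squarefree_progression D' = {}"
        by (auto simp: family_def squarefree_progression_def progression_def D'_def)
      ultimately have "(\<Sum>d\<in>squarefree_progression D. jacobi (int d) l) =
          (\<Sum>n\<in>{n \<in> {..D}. n \<in> family X}. jacobi (int n) l) + (\<Sum>d\<in>squarefree_progression D'. jacobi (int d) l)"
        by (simp add: sum.union_disjoint)
      moreover have "(\<Sum>n\<le>D. c n) = of_int (\<Sum>n\<in>{n \<in> {..D}. n \<in> family X}. jacobi (int n) l)"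
        unfolding c of_int_sum by (subst sum.inter_filter) auto
      ultimately have "(\<Sum>n\<le>D. c n) = of_int ((\<Sum>d\<in>squarefree_progression D. jacobi (int d) l) -
          (\<Sum>d\<in>squarefree_progression D'. jacobi (int d) l))" by simp
      hence "\<bar>\<Sum>n\<le>D. c n\<bar> \<le> real_of_int \<bar>\<Sum>d\<in>squarefree_progression D. jacobi (int d) l\<bar> +
          real_of_int \<bar>\<Sum>d\<in>squarefree_progression D'. jacobi (int d) l\<bar>"
        by (simp only: of_int_diff of_int_abs abs_triangle_ineq4)
      thus ?thesis using le[of D] le[of D'] D by (simp add: D'_def min_le_iff_disj)
    qed
    thus ?thesis by (simp add: mult.assoc)
  qed
qed

abbreviation Phi :: "nat \<Rightarrow> real \<Rightarrow> real" where
  "Phi d t \<equiv> real_character.Phi d t"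

section \<open>Lower bounds for the twisted exponential series\<close>

definition twisted_Phi :: "nat \<Rightarrow> nat \<Rightarrow> real \<Rightarrow> real" where
  "twisted_Phi X \<nu> t = (\<Sum>d\<in>family X. of_int (jacobi (int \<nu>) d) * Phi d t)"

text \<open>The exponent is 13/10 - 1/4: decay of the kernel in m against growth of the family
  sums.\<close>

definition zeta_21_20 :: real where
  "zeta_21_20 = (\<Sum>m. real (Suc m) powr (-21/20))"

lemma zeta_21_20_sums: "(\<lambda>m. real (Suc m) powr (-21/20)) sums zeta_21_20"
proof -
  have "summable (\<lambda>m. real m powr (-21/20))" by (subst summable_real_powr_iff) simp
  hence "summable (\<lambda>m. real (Suc m) powr (-21/20))" by (subst summable_Suc_iff)
  thus ?thesis unfolding zeta_21_20_def by (rule summable_sums)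
qed

lemma zeta_21_20_pos: "zeta_21_20 > 0"
  using sums_unique[OF zeta_21_20_sums] suminf_pos[of "\<lambda>m. real (Suc m) powr (-21/20)"]
    sums_summable[OF zeta_21_20_sums] by simp

text \<open>This is u^b <= exp(u), valid for b <= e, at b = 13/10.\<close>

lemma exp_minus_le_powr:
  assumes "u > (0::real)"
  shows "exp (-u) \<le> u powr (-13/10)"
proof -
  have "ln (u / (13/10)) \<le> u / (13/10) - 1" using assms by (intro ln_le_minus_one) auto
  moreover have "ln (u / (13/10)) = ln u - ln (13/10)" using assms ln_divide_pos[of u "13/10"] by simp
  moreover have "ln (13/10 :: real) \<le> 13/10 - 1" by (rule ln_le_minus_one) simp
  ultimately have "ln u \<le> u / (13/10)" by linarith
  hence "-u \<le> ln u * (-13/10)" by simp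
  hence "exp (-u) \<le> exp (ln u * (-13/10))" by (subst exp_le_cancel_iff)
  thus ?thesis using assms by (simp add: powr_def mult.commute)
qed

text \<open>For m in \<open>R\<close> with \<nu> m a square, the symbol is the indicator of
  coprimality and the term is kept. Other terms with square odd part are non-negative and are
  discarded. The rest are bounded by the family sums together with exp(-u) <= u^(-13/10), u = m
  t.\<close>

lemma twisted_Phi_direct:
  assumes X: "X \<ge> 20000" and \<nu>: "odd \<nu>" and t: "t > 0" and R: "finite R" "\<And>m. m \<in> R \<Longrightarrow> odd m"
  shows "twisted_Phi X \<nu> t \<ge>
    (\<Sum>m\<in>{m \<in> R. perfect_square (\<nu> * m)}. real (card {d \<in> family X. coprime d (\<nu> * m)}) * exp (- (real m * t))) -
    2 * family_constant * zeta_21_20 * real X powr (11/20) * real \<nu> powr (1/4) * t powr (-13/10)"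
proof -
  define c where "c m = (\<Sum>d\<in>family X. real_of_int (jacobi (int (\<nu> * m)) d))" for m
  define K where "K = 2 * family_constant * real X powr (11/20) * real \<nu> powr (1/4) * t powr (-13/10)"
  define S where "S = {m \<in> R. perfect_square (\<nu> * m)}"
  define main where "main m = (if m \<in> S then real (card {d \<in> family X. coprime d (\<nu> * m)}) * exp (- (real m * t)) else 0)" for m
  have \<nu>0: "\<nu> > 0" using \<nu> by (auto intro: Nat.gr0I)
  have sums: "(\<lambda>m. c (Suc m) * exp (- (real (Suc m) * t))) sums twisted_Phi X \<nu> t"
  proof -
    have "(\<lambda>m. \<Sum>d\<in>family X. of_int (jacobi (int \<nu>) d) * (of_int (jacobi (int (Suc m)) d) * exp (- (real (Suc m) * t))))
        sums twisted_Phi X \<nu> t"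
      unfolding twisted_Phi_def
    proof (intro sums_sum sums_mult)
      fix d assume "d \<in> family X"
      hence rc: "real_character d" by (rule real_character_family[OF X])
      show "(\<lambda>m. of_int (jacobi (int (Suc m)) d) * exp (- (real (Suc m) * t))) sums Phi d t"
        using real_character.Phi_sums[OF rc t] unfolding real_character.chi_def[OF rc] .
    qed
    moreover have "(\<Sum>d\<in>family X. of_int (jacobi (int \<nu>) d) * (of_int (jacobi (int (Suc m)) d) * exp (- (real (Suc m) * t)))) =
        c (Suc m) * exp (- (real (Suc m) * t))" for m
      unfolding c_def sum_distrib_right of_nat_mult jacobi_mult_left by (intro sum.cong refl) simp
    ultimately show ?thesis by simp
  qed
  have c_ge: "c m * exp (- (real m * t)) \<ge> main m - K * real m powr (-21/20)" if m: "m > 0" for m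
  proof (cases "m \<in> S")
    case True
    then obtain s where s: "\<nu> * m = s\<^sup>2" "m \<in> R" by (auto simp: S_def)
    have l: "odd (\<nu> * m)" "\<nu> * m > 0" using \<nu> R(2)[OF s(2)] \<nu>0 m by auto
    have s0: "s > 0" using l(2) s(1) by (auto intro: Nat.gr0I)
    have "jacobi (int (\<nu> * m)) d = (if coprime d (\<nu> * m) then 1 else 0)" if d: "d \<in> family X" for d
    proof -
      have "jacobi (int (\<nu> * m)) d = jacobi (int d) (s * s)"
        using jacobi_flip[OF family_D(2)[OF d] l(1)] s(1) by (simp add: power2_eq_square)
      also have "\<dots> = (if coprime (int d) (int s) then 1 else 0)"
        using s0 by (simp add: jacobi_mult_right jacobi_square)
      also have "coprime (int d) (int s) \<longleftrightarrow> coprime d (\<nu> * m)" unfolding s(1) by simp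
      finally show ?thesis .
    qed
    hence "c m = (\<Sum>d\<in>family X. if coprime d (\<nu> * m) then 1 else 0)"
      unfolding c_def by (intro sum.cong refl) simp
    also have "\<dots> = real (card {d \<in> family X. coprime d (\<nu> * m)})"
      by (simp add: sum.inter_filter[symmetric])
    finally have "c m * exp (- (real m * t)) = main m" using True by (simp add: main_def)
    moreover have "K * real m powr (-21/20) \<ge> 0" using family_constant(1) by (simp add: K_def)
    ultimately show ?thesis by simp
  next
    case False
    have P: "c m \<ge> - (2 * family_constant * real X powr (11/20) * real (\<nu> * m) powr (1/4))"
    proof -
      define c' where "c' n = (if n \<in> family X then real_of_int (jacobi (int (\<nu> * m)) n) else 0)" for n
      have "(\<Sum>n\<le>X. c' n) = (\<Sum>n\<in>{n \<in> {..X}. n \<in> family X}. real_of_int (jacobi (int (\<nu> * m)) n))"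
        unfolding c'_def by (subst sum.inter_filter) auto
      also have "{n \<in> {..X}. n \<in> family X} = family X" using family_D(3) by auto
      finally have eq: "(\<Sum>n\<le>X. c' n) = c m" by (simp add: c_def)
      from family_sum_dichotomy[OF \<nu> m, of X] show ?thesis
      proof
        assume "\<forall>n. 0 \<le> (if n \<in> family X then real_of_int (jacobi (int (\<nu> * m)) n) else 0)"
        hence "(\<Sum>n\<le>X. c' n) \<ge> 0" unfolding c'_def by (intro sum_nonneg) auto
        moreover have "2 * family_constant * real X powr (11/20) * real (\<nu> * m) powr (1/4) \<ge> 0"
          using family_constant(1) by simp
        ultimately show ?thesis using eq by linarith
      next
        assume "\<forall>D\<le>X. \<bar>\<Sum>n\<le>D. (if n \<in> family X then real_of_int (jacobi (int (\<nu> * m)) n) else 0)\<bar> \<le>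
          2 * family_constant * real X powr (11/20) * real (\<nu> * m) powr (1/4)"
        hence "\<bar>\<Sum>n\<le>X. c' n\<bar> \<le> 2 * family_constant * real X powr (11/20) * real (\<nu> * m) powr (1/4)"
          unfolding c'_def by blast
        thus ?thesis using eq by linarith
      qed
    qed
    have "- (K * real m powr (-21/20)) \<le> - (2 * family_constant * real X powr (11/20) * real (\<nu> * m) powr (1/4)) * exp (- (real m * t))"
    proof -
      have "exp (- (real m * t)) \<le> (real m * t) powr (-13/10)" using m t by (intro exp_minus_le_powr) auto
      hence "2 * family_constant * real X powr (11/20) * real (\<nu> * m) powr (1/4) * exp (- (real m * t)) \<le>
          2 * family_constant * real X powr (11/20) * real (\<nu> * m) powr (1/4) * (real m * t) powr (-13/10)"
        using family_constant(1) by (intro mult_left_mono) auto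
      also have "\<dots> = 2 * family_constant * real X powr (11/20) * real \<nu> powr (1/4) * t powr (-13/10) *
          (real m powr (1/4) * real m powr (-13/10))"
        using t by (simp add: powr_mult mult_ac)
      also have "real m powr (1/4) * real m powr (-13/10) = real m powr (-21/20)"
        using m by (simp flip: powr_add)
      finally show ?thesis by (simp add: K_def)
    qed
    also have "\<dots> \<le> c m * exp (- (real m * t))" using P by (intro mult_right_mono) auto
    finally show ?thesis using False by (simp add: main_def)
  qed
  have "(\<lambda>m. main (Suc m)) sums (\<Sum>m\<in>(\<lambda>m. m - 1) ` S. main (Suc m))"
  proof (rule sums_finite)
    show "finite ((\<lambda>m. m - 1) ` S)" using R(1) by (simp add: S_def)
    fix n assume "n \<notin> (\<lambda>m. m - 1) ` S"
    hence "Suc n \<notin> S" by force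
    thus "main (Suc n) = 0" by (simp add: main_def)
  qed
  also have "(\<Sum>m\<in>(\<lambda>m. m - 1) ` S. main (Suc m)) = (\<Sum>m\<in>S. main m)"
  proof (rule sum.reindex_bij_witness[of _ "\<lambda>m. m - 1" Suc])
    have pos: "m > 0" if "m \<in> S" for m using that R(2)[of m] by (auto simp: S_def intro: Nat.gr0I)
    show "Suc a - 1 = a" for a by simp
    show "Suc a \<in> S" if "a \<in> (\<lambda>m. m - 1) ` S" for a using that pos by force
    show "Suc (b - 1) = b" "b - 1 \<in> (\<lambda>m. m - 1) ` S" if "b \<in> S" for b using that pos[of b] by auto
    show "main (Suc a) = main (Suc a)" for a ..
  qed
  finally have "(\<lambda>m. main (Suc m) - K * real (Suc m) powr (-21/20)) sums ((\<Sum>m\<in>S. main m) - K * zeta_21_20)"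
    by (intro sums_diff sums_mult zeta_21_20_sums)
  hence "(\<Sum>m\<in>S. main m) - K * zeta_21_20 \<le> twisted_Phi X \<nu> t"
    using sums_le[OF c_ge[OF zero_less_Suc] _ sums] by blast
  moreover have "(\<Sum>m\<in>S. main m) = (\<Sum>m\<in>S. real (card {d \<in> family X. coprime d (\<nu> * m)}) * exp (- (real m * t)))"
    by (intro sum.cong refl) (simp add: main_def)
  ultimately show ?thesis by (simp add: S_def K_def mult_ac)
qed


text \<open>No main term is extracted here: square terms are non-negative and discarded. For the
  others the kernel is removed by partial summation in d. The X exponent is 11/20 + 13/10 - 1/2 =
  27/20 and the t exponent is 1 - 7/10 = 3/10.\<close>

lemma twisted_Phi_dual:
  assumes X: "X \<ge> 20000" and \<nu>: "odd \<nu>" and t: "t > 0"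
  shows "twisted_Phi X \<nu> t \<ge>
    - (8 * family_constant * zeta_21_20 * real X powr (27/20) * real \<nu> powr (1/4) * t powr (3/10))"
proof -
  define x where "x = real X"
  define \<tau> where "\<tau> = t / (2 * pi)"
  define k where "k d m = (sqrt d * (real d * \<tau>) / pi) / (real m ^ 2 + (real d * \<tau>)\<^sup>2)" for d m :: nat
  define c where "c m = (\<Sum>d\<in>family X. of_int (jacobi (int (\<nu> * m)) d) * k d m)" for m
  define K where "K = 8 * family_constant * x powr (27/20) * real \<nu> powr (1/4) * t powr (3/10)"
  have x: "x > 0" using X by (simp add: x_def)
  have \<tau>: "\<tau> > 0" "\<tau> \<le> t" using t pi_gt3 by (simp_all add: \<tau>_def field_simps)
  have sums: "(\<lambda>m. c (Suc m)) sums twisted_Phi X \<nu> t"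
  proof -
    have "(\<lambda>m. \<Sum>d\<in>family X. of_int (jacobi (int \<nu>) d) * (of_int (jacobi (int (Suc m)) d) * k d (Suc m)))
        sums twisted_Phi X \<nu> t"
      unfolding twisted_Phi_def
    proof (intro sums_sum sums_mult)
      fix d assume "d \<in> family X"
      hence rc: "real_character d" by (rule real_character_family[OF X])
      define y where "y = real d * t / (2 * pi)"
      have y: "y = real d * \<tau>" by (simp add: y_def \<tau>_def)
      have "(\<lambda>m. sqrt d * y / pi * (of_int (real_character.chi d (Suc m)) / (real (Suc m) ^ 2 + y\<^sup>2))) sums
          (sqrt d * y / pi * (\<Sum>m. of_int (real_character.chi d (Suc m)) / (real (Suc m) ^ 2 + y\<^sup>2)))"
        by (intro sums_mult summable_sums real_character.summable_dual[OF rc])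
      also have "sqrt d * y / pi * (\<Sum>m. of_int (real_character.chi d (Suc m)) / (real (Suc m) ^ 2 + y\<^sup>2)) = Phi d t"
        using real_character.Phi_dual[OF rc t] by (simp only: y_def)
      finally have "(\<lambda>m. sqrt d * y / pi * (of_int (jacobi (int (Suc m)) d) / (real (Suc m) ^ 2 + y\<^sup>2))) sums Phi d t"
        unfolding real_character.chi_def[OF rc] .
      moreover have "(\<lambda>m. sqrt d * y / pi * (of_int (jacobi (int (Suc m)) d) / (real (Suc m) ^ 2 + y\<^sup>2))) =
          (\<lambda>m. of_int (jacobi (int (Suc m)) d) * k d (Suc m))"
        unfolding k_def y by (intro ext) (simp only: times_divide_eq_left times_divide_eq_right mult_ac)
      ultimately show "(\<lambda>m. of_int (jacobi (int (Suc m)) d) * k d (Suc m)) sums Phi d t" by (simp only:)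
    qed
    moreover have "(\<Sum>d\<in>family X. of_int (jacobi (int \<nu>) d) * (of_int (jacobi (int (Suc m)) d) * k d (Suc m))) = c (Suc m)" for m
      unfolding c_def of_nat_mult jacobi_mult_left by (intro sum.cong refl) simp
    ultimately show ?thesis by simp
  qed
  have c_ge: "c m \<ge> - (K * real m powr (-21/20))" if m: "m > 0" for m
  proof -
    define c' where "c' n = (if n \<in> family X then real_of_int (jacobi (int (\<nu> * m)) n) else 0)" for n
    \<comment> \<open>The kernel is \<open>q n * f n\<close> up to a constant, with \<open>q\<close>
      increasing and \<open>f\<close> decreasing. On the family \<open>f n\<close> is 1/sqrt n; the
      maximum with x/2 only changes values where the coefficient vanishes and keeps
      \<open>f 0\<close> of order x^(-1/2).\<close>
    define f where "f n = 1 / sqrt (max (real n) (x / 2))" for n :: nat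
    define q where "q n = real n ^ 2 / (real m ^ 2 + (real n * \<tau>)\<^sup>2)" for n :: nat
    define P where "P = 2 * family_constant * x powr (11/20) * real (\<nu> * m) powr (1/4)"
    have K0: "K * real m powr (-21/20) \<ge> 0" using family_constant(1) by (simp add: K_def)
    have k_nonneg: "k d m \<ge> 0" for d using \<tau> by (simp add: k_def)
    have c_eq: "c m = (\<Sum>n\<le>X. c' n * k n m)"
    proof -
      have "(\<Sum>n\<le>X. c' n * k n m) = (\<Sum>n\<in>{..X}. if n \<in> family X then of_int (jacobi (int (\<nu> * m)) n) * k n m else 0)"
        by (intro sum.cong refl) (simp add: c'_def)
      also have "\<dots> = (\<Sum>n\<in>{n \<in> {..X}. n \<in> family X}. of_int (jacobi (int (\<nu> * m)) n) * k n m)"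
        by (subst sum.inter_filter) auto
      also have "{n \<in> {..X}. n \<in> family X} = family X" using family_D(3) by auto
      finally show ?thesis by (simp add: c_def)
    qed
    have q_den: "real m ^ 2 + (real n * \<tau>)\<^sup>2 > 0" for n using m by (intro add_pos_nonneg) auto
    have q_mono: "q n \<le> q n'" if "n \<le> n'" for n n'
    proof -
      have "real n ^ 2 * (real m ^ 2 + (real n' * \<tau>)\<^sup>2) \<le> real n' ^ 2 * (real m ^ 2 + (real n * \<tau>)\<^sup>2)"
        using that by (simp add: algebra_simps power_mult_distrib) (intro mult_mono power_mono; simp)
      thus ?thesis unfolding q_def using q_den[of n] q_den[of n'] by (simp add: divide_le_eq pos_le_divide_eq mult.commute)
    qed
    have f_mono: "f n' \<le> f n" if "n \<le> n'" for n n'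
      unfolding f_def using that x by (intro divide_left_mono mult_pos_pos) (auto simp: less_max_iff_disj)
    have f_nonneg: "f n \<ge> 0" for n using x by (simp add: f_def)
    have k_eq: "c' n * k n m = \<tau> / pi * ((c' n * q n) * f n)" for n
    proof (cases "n \<in> family X")
      case True
      have "x / 2 < real n" using family_D(4)[OF True] unfolding x_def by linarith
      hence fn: "f n = 1 / sqrt (real n)" by (simp add: f_def max_def)
      have "sqrt (real n) * real n = real n ^ 2 / sqrt (real n)"
        using family_D(5)[OF True] by (simp add: field_simps power2_eq_square)
      hence "k n m = \<tau> / pi * (q n * f n)"
        unfolding k_def q_def fn by (simp add: mult_ac)
      thus ?thesis by simp
    qed (simp add: c'_def)
    from family_sum_dichotomy[OF \<nu> m, of X] show ?thesis
    proof
      assume "\<forall>n. 0 \<le> (if n \<in> family X then real_of_int (jacobi (int (\<nu> * m)) n) else 0)"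
      hence "c' n \<ge> 0" for n by (simp add: c'_def)
      hence "c m \<ge> 0" unfolding c_eq using k_nonneg by (intro sum_nonneg mult_nonneg_nonneg) auto
      thus ?thesis using K0 by linarith
    next
      assume "\<forall>D\<le>X. \<bar>\<Sum>n\<le>D. (if n \<in> family X then real_of_int (jacobi (int (\<nu> * m)) n) else 0)\<bar> \<le>
        2 * family_constant * real X powr (11/20) * real (\<nu> * m) powr (1/4)"
      hence P: "\<bar>\<Sum>n\<le>D. c' n\<bar> \<le> P" if "D \<le> X" for D
        using that unfolding c'_def P_def x_def by blast
      have P0: "P \<ge> 0" using P[of 0] by linarith
      have 1: "\<bar>\<Sum>n\<le>D. c' n * q n\<bar> \<le> 2 * P * q X" if D: "D \<le> X" for D
      proof -
        have "\<bar>\<Sum>n\<le>D. c' n * q n\<bar> \<le> 2 * P * q D"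
          using P D q_mono by (intro abel_bound_mono) (auto simp: q_def)
        also have "\<dots> \<le> 2 * P * q X" using q_mono[OF D] P0 by (intro mult_left_mono) auto
        finally show ?thesis .
      qed
      have 2: "\<bar>\<Sum>n\<le>X. (c' n * q n) * f n\<bar> \<le> 2 * P * q X * f 0"
        using 1 f_mono f_nonneg by (intro abel_bound_antimono) auto
      have "\<bar>c m\<bar> = \<tau> / pi * \<bar>\<Sum>n\<le>X. (c' n * q n) * f n\<bar>"
        unfolding c_eq k_eq sum_distrib_left[symmetric] abs_mult using \<tau> by simp
      also have "\<dots> \<le> \<tau> / pi * (2 * P * q X * f 0)" using 2 \<tau> by (intro mult_left_mono) auto
      finally have c1: "\<bar>c m\<bar> \<le> \<tau> / pi * (2 * P * q X * f 0)" .
      have f0: "f 0 = sqrt 2 * x powr (-1/2)"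
        using x by (simp add: f_def max_def real_sqrt_divide powr_minus_divide powr_half_sqrt)
      have qX: "q X \<le> x powr (13/10) * real m powr (-13/10) * \<tau> powr (-7/10)"
      proof -
        define u where "u = x * \<tau>"
        have u: "u > 0" using x \<tau> by (simp add: u_def)
        \<comment> \<open>Both factors are at most powers of max(m, u), and 13/10 + 7/10 = 2. The
          share of m is 13/10 to match the decay on the direct side.\<close>
        have den: "real m powr (13/10) * u powr (7/10) \<le> real m ^ 2 + u\<^sup>2"
        proof (cases "u \<le> real m")
          case True
          have "real m powr (13/10) * u powr (7/10) \<le> real m powr (13/10) * real m powr (7/10)"
            using True u by (intro mult_left_mono powr_mono2) auto
          also have "\<dots> = real m ^ 2" using m by (simp add: powr_add[symmetric] powr_numeral)
          finally show ?thesis using zero_le_power2[of u] by linarith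
        next
          case False
          have "real m powr (13/10) * u powr (7/10) \<le> u powr (13/10) * u powr (7/10)"
            using False by (intro mult_right_mono powr_mono2) auto
          also have "\<dots> = u\<^sup>2" using u by (simp add: powr_add[symmetric] powr_numeral)
          finally show ?thesis using zero_le_power2[of "real m"] by linarith
        qed
        have "q X \<le> x\<^sup>2 / (real m powr (13/10) * u powr (7/10))"
          unfolding q_def x_def[symmetric] u_def[symmetric]
          using den m u by (intro divide_left_mono) (auto intro!: mult_pos_pos add_pos_nonneg)
        also have "x\<^sup>2 = x powr 2" using x by (simp add: powr_numeral)
        also have "u powr (7/10) = x powr (7/10) * \<tau> powr (7/10)" using x \<tau> by (simp add: u_def powr_mult)
        also have "x powr 2 / (real m powr (13/10) * (x powr (7/10) * \<tau> powr (7/10))) =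
            (x powr 2 / x powr (7/10)) * (1 / real m powr (13/10)) * (1 / \<tau> powr (7/10))"
          by (simp add: mult_ac)
        also have "x powr 2 / x powr (7/10) = x powr (13/10)" by (simp add: powr_diff[symmetric])
        also have "1 / real m powr (13/10) = real m powr (-13/10)"
          using powr_minus_divide[of "real m" "13/10"] by simp
        also have "1 / \<tau> powr (7/10) = \<tau> powr (-7/10)"
          using powr_minus_divide[of \<tau> "7/10"] by simp
        finally show ?thesis .
      qed
      have "\<tau> / pi * (2 * P * q X * f 0) \<le>
          \<tau> / pi * (2 * P * (x powr (13/10) * real m powr (-13/10) * \<tau> powr (-7/10)) * f 0)"
        using qX P0 \<tau> f_nonneg by (intro mult_left_mono mult_right_mono) auto
      also have "\<dots> = (4 * sqrt 2 / pi) * family_constant *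
          ((x powr (11/20) * x powr (13/10)) * x powr (-1/2)) * real \<nu> powr (1/4) *
          (real m powr (1/4) * real m powr (-13/10)) * (\<tau> * \<tau> powr (-7/10))"
        by (simp add: P_def f0 powr_mult mult_ac)
      also have "x powr (11/20) * x powr (13/10) * x powr (-1/2) = x powr (27/20)"
        by (simp add: powr_add[symmetric])
      also have "real m powr (1/4) * real m powr (-13/10) = real m powr (-21/20)"
        by (simp add: powr_add[symmetric])
      also have "\<tau> * \<tau> powr (-7/10) = \<tau> powr (3/10)"
        using \<tau> powr_add[of \<tau> 1 "-7/10"] by simp
      also have "(4 * sqrt 2 / pi) * family_constant * x powr (27/20) * real \<nu> powr (1/4) * real m powr (-21/20) * \<tau> powr (3/10) \<le>
          8 * family_constant * x powr (27/20) * real \<nu> powr (1/4) * real m powr (-21/20) * t powr (3/10)"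
      proof -
        define A where "A = family_constant * x powr (27/20) * real \<nu> powr (1/4) * real m powr (-21/20)"
        have "sqrt 2 \<le> (2::real)" using real_sqrt_le_mono[of 2 4] by simp
        hence "4 * sqrt 2 / pi \<le> 8" using pi_gt3 by (simp add: divide_le_eq)
        moreover have "\<tau> powr (3/10) \<le> t powr (3/10)" using \<tau> by (intro powr_mono2) auto
        ultimately have "4 * sqrt 2 / pi * \<tau> powr (3/10) \<le> 8 * t powr (3/10)"
          by (intro mult_mono) auto
        hence "A * (4 * sqrt 2 / pi * \<tau> powr (3/10)) \<le> A * (8 * t powr (3/10))"
          using family_constant(1) by (intro mult_left_mono) (auto simp: A_def)
        thus ?thesis by (simp only: A_def mult_ac)
      qed
      also have "\<dots> = K * real m powr (-21/20)" by (simp add: K_def mult_ac)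
      finally show ?thesis using c1 by linarith
    qed
  qed
  have "(\<lambda>m. - (K * real (Suc m) powr (-21/20))) sums (- (K * zeta_21_20))"
    by (intro sums_minus sums_mult zeta_21_20_sums)
  hence "- (K * zeta_21_20) \<le> twisted_Phi X \<nu> t"
    using sums_le[OF c_ge[OF zero_less_Suc] _ sums] by blast
  thus ?thesis by (simp add: K_def x_def mult_ac)
qed

definition L_half :: "nat \<Rightarrow> real" where
  "L_half d = Re (L_kronecker (int d) (1 / 2))"

text \<open>Integrate t^(-1/2) times the direct bound above t = X^(-1/2) and the dual one below. The
  integrals of t^(-9/5) and t^(-1/5) up to this cut contribute X^(2/5) and X^(-2/5), so both errors
  become X^(19/20). For m^2 <= X the window [1/m, 2/m] lies above the cut, where t^(-1/2) exp(-m t)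
  is at least exp(-2) sqrt(m/2); its length 1/m leaves exp(-2)/sqrt 2 times m^(-1/2).\<close>

theorem twisted_first_moment_ge:
  assumes X: "X \<ge> 20000" and \<nu>: "odd \<nu>" and R: "finite R" "\<And>m. m \<in> R \<Longrightarrow> odd m \<and> m\<^sup>2 \<le> X"
  shows "sqrt pi * (\<Sum>d\<in>family X. of_int (jacobi (int \<nu>) d) * L_half d) \<ge>
    exp (-2) / sqrt 2 * (\<Sum>m\<in>{m \<in> R. perfect_square (\<nu> * m)}. real (card {d \<in> family X. coprime d (\<nu> * m)}) * inv_sqrt m) -
    25 / 2 * family_constant * zeta_21_20 * real X powr (19/20) * real \<nu> powr (1/4)"
proof -
  define x where "x = real X"
  define \<tau> where "\<tau> = x powr (-1/2)"
  define S where "S = {m \<in> R. perfect_square (\<nu> * m)}"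
  define w where "w m = real (card {d \<in> family X. coprime d (\<nu> * m)})" for m
  define B where "B = family_constant * zeta_21_20 * real \<nu> powr (1/4)"
  define E1 where "E1 = 2 * B * x powr (11/20)"
  define E2 where "E2 = 8 * B * x powr (27/20)"
  \<comment> \<open>A minorant with explicit integral. At t = 0 all terms vanish; at the cut both
    errors are subtracted, which only lowers it.\<close>
  define h where "h t = (\<Sum>m\<in>S. if t \<in> {1 / real m..2 / real m} then w m * (exp (-2) * sqrt (real m / 2)) else 0) -
      (E1 * (if t \<in> {\<tau>..} then t powr (-9/5) else 0) + E2 * (if t \<in> {0..\<tau>} then t powr (-1/5) else 0))" for t
  have x: "x > 0" using X by (simp add: x_def)
  have \<tau>: "\<tau> > 0" using x by (simp add: \<tau>_def)
  have B: "B \<ge> 0" using family_constant(1) zeta_21_20_pos by (simp add: B_def)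
  have E: "E1 \<ge> 0" "E2 \<ge> 0" using B by (simp_all add: E1_def E2_def)
  have S: "finite S" "\<And>m. m \<in> S \<Longrightarrow> m > 0" using R by (auto simp: S_def intro: Nat.gr0I)
  have S_le: "\<tau> \<le> 1 / real m" if "m \<in> S" for m
  proof -
    have "real (m\<^sup>2) \<le> x" using R(2)[of m] that unfolding S_def x_def by (auto simp del: of_nat_power)
    hence "sqrt (real m ^ 2) \<le> sqrt x" by (intro real_sqrt_le_mono) simp
    hence "real m \<le> x powr (1/2)" using x by (simp add: powr_half_sqrt)
    moreover have "\<tau> = 1 / x powr (1/2)" using powr_minus_divide[of x "1/2"] by (simp add: \<tau>_def)
    ultimately show ?thesis using S(2)[OF that] x by (simp add: frac_le)
  qed
  have step: "((\<lambda>t. if t \<in> {1 / real m..2 / real m} then w m * (exp (-2) * sqrt (real m / 2)) else 0) has_integral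
      exp (-2) / sqrt 2 * (w m * inv_sqrt m)) {0..}" if "m \<in> S" for m
  proof -
    have m: "m > 0" by (rule S(2)[OF that])
    have "((\<lambda>t::real. w m * (exp (-2) * sqrt (real m / 2))) has_integral
        (w m * (exp (-2) * sqrt (real m / 2))) * (2 / real m - 1 / real m)) {1 / real m..2 / real m}"
      using has_integral_const_real[of "w m * (exp (-2) * sqrt (real m / 2))" "1 / real m" "2 / real m"] m
      by (simp add: divide_right_mono mult.commute)
    also have "(w m * (exp (-2) * sqrt (real m / 2))) * (2 / real m - 1 / real m) = exp (-2) / sqrt 2 * (w m * inv_sqrt m)"
    proof -
      have "2 / real m - 1 / real m = inv_sqrt m * inv_sqrt m"
        using m by (simp add: inv_sqrt_def field_simps)
      moreover have "sqrt (real m / 2) * inv_sqrt m = 1 / sqrt 2"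
        using m by (simp add: inv_sqrt_def real_sqrt_divide)
      moreover have "(w m * (exp (-2) * sqrt (real m / 2))) * (inv_sqrt m * inv_sqrt m) =
          (exp (-2) * (w m * inv_sqrt m)) * (sqrt (real m / 2) * inv_sqrt m)" by (simp only: mult_ac)
      ultimately show ?thesis
        by (simp only: times_divide_eq_left times_divide_eq_right mult_1_right)
    qed
    finally show ?thesis by (subst has_integral_restrict) (use m in auto)
  qed
  have int1: "((\<lambda>t. if t \<in> {\<tau>..} then t powr (-9/5) else 0) has_integral 5 / 4 * x powr (2/5)) {0..}"
  proof -
    have "((\<lambda>t. t powr (-9/5)) has_integral (- (\<tau> powr (-9/5 + 1)) / (-9/5 + 1))) {\<tau>..}"
      by (rule has_integral_powr_to_inf) (use \<tau> in auto)
    moreover have "- (\<tau> powr (-9/5 + 1)) / (-9/5 + 1) = 5 / 4 * x powr (2/5)"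
      by (simp add: \<tau>_def powr_powr)
    ultimately have "((\<lambda>t. t powr (-9/5)) has_integral 5 / 4 * x powr (2/5)) {\<tau>..}" by (simp only:)
    moreover have "{\<tau>..} \<subseteq> {0..}" using \<tau> by auto
    ultimately show ?thesis by (simp only: has_integral_restrict)
  qed
  have int2: "((\<lambda>t. if t \<in> {0..\<tau>} then t powr (-1/5) else 0) has_integral 5 / 4 * x powr (-2/5)) {0..}"
  proof -
    have "((\<lambda>t. t powr (-1/5)) has_integral (\<tau> powr (-1/5 + 1) / (-1/5 + 1))) {0..\<tau>}"
      by (rule has_integral_powr_from_0) (use \<tau> in auto)
    moreover have "\<tau> powr (-1/5 + 1) / (-1/5 + 1) = 5 / 4 * x powr (-2/5)"
      by (simp add: \<tau>_def powr_powr)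
    ultimately have "((\<lambda>t. t powr (-1/5)) has_integral 5 / 4 * x powr (-2/5)) {0..\<tau>}" by (simp only:)
    moreover have "{0..\<tau>} \<subseteq> {0..}" by auto
    ultimately show ?thesis by (simp only: has_integral_restrict)
  qed
  have h_int: "(h has_integral (\<Sum>m\<in>S. exp (-2) / sqrt 2 * (w m * inv_sqrt m)) -
      (E1 * (5 / 4 * x powr (2/5)) + E2 * (5 / 4 * x powr (-2/5)))) {0..}"
    unfolding h_def
    by (intro has_integral_diff has_integral_add has_integral_sum has_integral_mult_right S step int1 int2)
  have main_int: "((\<lambda>t. t powr (-1/2) * twisted_Phi X \<nu> t) has_integral
      sqrt pi * (\<Sum>d\<in>family X. of_int (jacobi (int \<nu>) d) * L_half d)) {0..}"
  proof -
    have "((\<lambda>t. \<Sum>d\<in>family X. of_int (jacobi (int \<nu>) d) * (t powr (-1/2) * Phi d t)) has_integral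
        (\<Sum>d\<in>family X. of_int (jacobi (int \<nu>) d) * (sqrt pi * L_half d))) {0..}"
    proof (intro has_integral_sum has_integral_mult_right finite_family)
      fix d assume "d \<in> family X"
      hence rc: "real_character d" by (rule real_character_family[OF X])
      show "((\<lambda>t. t powr (-1/2) * Phi d t) has_integral sqrt pi * L_half d) {0..}"
        unfolding L_half_def real_character.L_half_eq_integral(2)[OF rc]
        by (rule integrable_integral[OF real_character.L_half_eq_integral(1)[OF rc]])
    qed
    thus ?thesis by (simp add: twisted_Phi_def sum_distrib_left mult_ac)
  qed
  have le: "h t \<le> t powr (-1/2) * twisted_Phi X \<nu> t" if "t \<in> {0..}" for t
  proof -
    consider "t = 0" | "0 < t" "t < \<tau>" | "\<tau> \<le> t" "0 < t" using \<open>t \<in> {0..}\<close> by force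
    thus ?thesis
    proof cases
      case 1
      have "(\<Sum>m\<in>S. if t \<in> {1 / real m..2 / real m} then w m * (exp (-2) * sqrt (real m / 2)) else 0) = 0"
        using 1 S(2) by (intro sum.neutral) auto
      thus ?thesis using 1 by (simp add: h_def)
    next
      case 2
      have "(if t \<in> {1 / real m..2 / real m} then w m * (exp (-2) * sqrt (real m / 2)) else 0) = 0"
        if "m \<in> S" for m
        using S_le[OF that] 2 by auto
      hence "h t = - (E2 * t powr (-1/5))" using 2 by (simp add: h_def)
      also have "E2 * t powr (-1/5) = t powr (-1/2) *
          (8 * family_constant * zeta_21_20 * x powr (27/20) * real \<nu> powr (1/4) * t powr (3/10))"
      proof -
        have "t powr (-1/5) = t powr (-1/2) * t powr (3/10)" by (simp add: powr_add[symmetric])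
        thus ?thesis by (simp add: E2_def B_def mult_ac)
      qed
      also have "- (t powr (-1/2) * (8 * family_constant * zeta_21_20 * x powr (27/20) * real \<nu> powr (1/4) * t powr (3/10))) \<le>
          t powr (-1/2) * twisted_Phi X \<nu> t"
        unfolding mult_minus_right[symmetric] x_def
        using twisted_Phi_dual[OF X \<nu> 2(1)] by (intro mult_left_mono) auto
      finally show ?thesis .
    next
      case 3
      have "h t \<le> (\<Sum>m\<in>S. if t \<in> {1 / real m..2 / real m} then w m * (exp (-2) * sqrt (real m / 2)) else 0) - E1 * t powr (-9/5)"
        using 3 E by (simp add: h_def)
      also have "(\<Sum>m\<in>S. if t \<in> {1 / real m..2 / real m} then w m * (exp (-2) * sqrt (real m / 2)) else 0) \<le>
          (\<Sum>m\<in>S. t powr (-1/2) * (w m * exp (- (real m * t))))"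
      proof (intro sum_mono)
        fix m assume m: "m \<in> S"
        show "(if t \<in> {1 / real m..2 / real m} then w m * (exp (-2) * sqrt (real m / 2)) else 0) \<le>
            t powr (-1/2) * (w m * exp (- (real m * t)))"
        proof (cases "t \<in> {1 / real m..2 / real m}")
          case True
          have "real m * t \<le> 2" using True S(2)[OF m] by (simp add: field_simps)
          moreover have "sqrt (real m / 2) \<le> t powr (-1/2)"
          proof -
            have "sqrt (real m / 2) = (2 / real m) powr (-1/2)"
              using S(2)[OF m] by (simp add: powr_minus powr_half_sqrt real_sqrt_divide divide_simps)
            also have "\<dots> \<le> t powr (-1/2)" using True 3 S(2)[OF m] by (intro powr_mono2') auto
            finally show ?thesis .
          qed
          ultimately have "exp (-2) * sqrt (real m / 2) \<le> exp (- (real m * t)) * t powr (-1/2)"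
            by (intro mult_mono) auto
          hence "w m * (exp (-2) * sqrt (real m / 2)) \<le> w m * (exp (- (real m * t)) * t powr (-1/2))"
            by (intro mult_left_mono) (auto simp: w_def)
          thus ?thesis using True by (simp add: mult_ac)
        next
          case False
          thus ?thesis by (simp only: if_False) (simp add: w_def)
        qed
      qed
      also have "(\<Sum>m\<in>S. t powr (-1/2) * (w m * exp (- (real m * t)))) - E1 * t powr (-9/5) =
          t powr (-1/2) * ((\<Sum>m\<in>S. w m * exp (- (real m * t))) -
          2 * family_constant * zeta_21_20 * x powr (11/20) * real \<nu> powr (1/4) * t powr (-13/10))"
      proof -
        have "t powr (-9/5) = t powr (-1/2) * t powr (-13/10)" by (simp add: powr_add[symmetric])
        thus ?thesis by (simp add: E1_def B_def sum_distrib_left right_diff_distrib mult_ac)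
      qed
      also have "\<dots> \<le> t powr (-1/2) * twisted_Phi X \<nu> t"
        unfolding x_def w_def S_def
        using twisted_Phi_direct[OF X \<nu> 3(2) R(1)] R(2) by (intro mult_left_mono) auto
      finally show ?thesis by simp
    qed
  qed
  have "(\<Sum>m\<in>S. exp (-2) / sqrt 2 * (w m * inv_sqrt m)) - (E1 * (5 / 4 * x powr (2/5)) + E2 * (5 / 4 * x powr (-2/5))) \<le>
      sqrt pi * (\<Sum>d\<in>family X. of_int (jacobi (int \<nu>) d) * L_half d)"
    by (rule has_integral_le[OF h_int main_int le])
  moreover have "E1 * (5 / 4 * x powr (2/5)) + E2 * (5 / 4 * x powr (-2/5)) = 25 / 2 * B * x powr (19/20)"
  proof -
    have "x powr (11/20) * x powr (2/5) = x powr (19/20)" "x powr (27/20) * x powr (-2/5) = x powr (19/20)"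
      by (simp_all add: powr_add[symmetric])
    moreover have "E1 * (5 / 4 * x powr (2/5)) = 5 / 2 * B * (x powr (11/20) * x powr (2/5))"
      "E2 * (5 / 4 * x powr (-2/5)) = 10 * B * (x powr (27/20) * x powr (-2/5))"
      by (simp_all add: E1_def E2_def)
    ultimately show ?thesis by (simp add: field_simps)
  qed
  ultimately show ?thesis
    by (simp add: S_def w_def B_def x_def sum_distrib_left mult_ac)
qed

section \<open>Counting and moments\<close>

lemma card_progression: "card (progression 1 B) = (B + 7) div 8"
proof -
  have "bij_betw (\<lambda>c. 8 * c + 1) {..<(B + 7) div 8} (progression 1 B)"
  proof (rule bij_betwI[where g = "\<lambda>b. b div 8"])
    show "(\<lambda>c. 8 * c + 1) \<in> {..<(B + 7) div 8} \<rightarrow> progression 1 B"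
    proof
      fix c assume "c \<in> {..<(B + 7) div 8}"
      hence "Suc c \<le> (B + 7) div 8" by simp
      hence "Suc c * 8 \<le> B + 7" by (simp only: less_eq_div_iff_mult_less_eq zero_less_numeral)
      thus "8 * c + 1 \<in> progression 1 B" by (simp add: progression_def)
    qed
    show "(\<lambda>b. b div 8) \<in> progression 1 B \<rightarrow> {..<(B + 7) div 8}"
    proof
      fix b assume "b \<in> progression 1 B"
      hence b: "b \<le> B" "b mod 8 = 1" by (auto simp: progression_def)
      have "Suc (b div 8) * 8 \<le> B + 7" using b mult_div_mod_eq[of 8 b] by simp
      hence "Suc (b div 8) \<le> (B + 7) div 8" by (simp only: less_eq_div_iff_mult_less_eq zero_less_numeral)
      thus "b div 8 \<in> {..<(B + 7) div 8}" by simp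
    qed
    show "8 * (b div 8) + 1 = b" if "b \<in> progression 1 B" for b
      using that mult_div_mod_eq[of 8 b] by (simp add: progression_def)
  qed simp
  from bij_betw_same_card[OF this] show ?thesis by simp
qed

lemma card_progression_real_le: "real (card (progression 1 B)) \<le> real B / 8 + 1"
proof -
  have "real (card (progression 1 B)) \<le> real (B + 7) / 8"
    unfolding card_progression using of_nat_div_le_of_nat[of "B + 7" 8, where 'a = real] by simp
  thus ?thesis by simp
qed

lemma card_progression_real_ge: "real (card (progression 1 B)) \<ge> real B / 8"
proof -
  have "B \<le> 8 * ((B + 7) div 8)" using mult_div_mod_eq[of 8 "B + 7"] mod_less_divisor[of 8 "B + 7"] by linarith
  hence "real B \<le> real (8 * ((B + 7) div 8))" by (simp only: of_nat_le_iff)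
  thus ?thesis unfolding card_progression by simp
qed

text \<open>Telescoping, since (2i+1)^2 >= 4 i (i+1).\<close>

lemma sum_odd_inverse_squares_le: "(\<Sum>i=1..n. 1 / real (2 * i + 1) ^ 2) \<le> 1 / 4"
proof -
  have "(\<Sum>i=1..n. 1 / real (2 * i + 1) ^ 2) \<le> 1 / 4 * (1 - 1 / real (n + 1))"
  proof (induction n)
    case (Suc n)
    have "1 / real (2 * Suc n + 1) ^ 2 \<le> 1 / (4 * real (Suc n) * real (Suc n + 1))"
      by (intro divide_left_mono) (auto simp: power2_eq_square algebra_simps intro!: mult_pos_pos add_pos_nonneg)
    also have "\<dots> = 1 / 4 * (1 / real (n + 1) - 1 / real (Suc n + 1))"
      by (simp add: divide_simps)
    finally show ?case using Suc by simp
  qed simp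
  also have "\<dots> \<le> 1 / 4" by simp
  finally show ?thesis .
qed

text \<open>From the progression remove d <= X/2 and, for every odd a >= 3, the multiples of a^2. An
  odd number that is not squarefree has such a divisor a^2.\<close>

lemma card_family_ge:
  assumes X: "X \<ge> 20000"
  shows "real (card (family X)) \<ge> real X / 64"
proof -
  define A where "A = {a. odd a \<and> 3 \<le> a \<and> a\<^sup>2 \<le> X}"
  define F where "F a = {d \<in> progression 1 X. a\<^sup>2 dvd d}" for a
  have A_le: "real a \<le> sqrt X" if "a \<in> A" for a
  proof -
    have "real (a\<^sup>2) \<le> real X" using that by (simp only: A_def mem_Collect_eq of_nat_le_iff)
    hence "sqrt (real a ^ 2) \<le> sqrt X" by (intro real_sqrt_le_mono) simp
    thus ?thesis by simp
  qed
  have A_sub: "A \<subseteq> {1..nat \<lfloor>sqrt X\<rfloor>}"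
    using A_le by (force simp: A_def le_nat_floor)
  hence finA: "finite A" using finite_subset by blast
  have "card A \<le> nat \<lfloor>sqrt X\<rfloor>" using card_mono[OF _ A_sub] by simp
  hence cardA: "real (card A) \<le> sqrt X" using of_nat_floor[of "sqrt X"] by (simp add: le_nat_floor order_trans[OF of_nat_mono])
  have cardF: "real (card (F a)) \<le> real X / 8 * (1 / real a ^ 2) + 1" if a: "a \<in> A" for a
  proof -
    have a0: "a\<^sup>2 > 0" and odd: "odd a" using a by (auto simp: A_def)
    have "F a \<subseteq> (\<lambda>b. a\<^sup>2 * b) ` progression 1 (X div a\<^sup>2)"
    proof
      fix d assume "d \<in> F a"
      then obtain b where b: "d = a\<^sup>2 * b" "a\<^sup>2 * b \<le> X" "(a\<^sup>2 * b) mod 8 = 1" by (auto simp: F_def progression_def elim: dvdE)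
      have "(a\<^sup>2 * b) mod 8 = ((a\<^sup>2) mod 8 * b) mod 8" by (rule mod_mult_left_eq[symmetric])
      hence "b mod 8 = 1" using b(3) odd_square_mod_8[OF odd] by simp
      moreover have "b \<le> X div a\<^sup>2" using b(2) a0 by (simp add: less_eq_div_iff_mult_less_eq mult.commute)
      ultimately show "d \<in> (\<lambda>b. a\<^sup>2 * b) ` progression 1 (X div a\<^sup>2)" using b(1) by (auto simp: progression_def)
    qed
    hence "card (F a) \<le> card ((\<lambda>b. a\<^sup>2 * b) ` progression 1 (X div a\<^sup>2))" by (intro card_mono) auto
    also have "\<dots> \<le> card (progression 1 (X div a\<^sup>2))" by (intro card_image_le) auto
    finally have "real (card (F a)) \<le> real (card (progression 1 (X div a\<^sup>2)))" by simp
    also have "\<dots> \<le> real (X div a\<^sup>2) / 8 + 1" by (rule card_progression_real_le)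
    also have "real (X div a\<^sup>2) \<le> real X / real (a\<^sup>2)" by (rule of_nat_div_le_of_nat)
    finally show ?thesis by (simp add: mult.commute)
  qed
  have sumA: "(\<Sum>a\<in>A. 1 / real a ^ 2) \<le> 1 / 4"
  proof -
    have "A \<subseteq> (\<lambda>i. 2 * i + 1) ` {1..X}"
    proof
      fix a assume a: "a \<in> A"
      then obtain i where i: "a = 2 * i + 1" by (auto simp: A_def elim: oddE)
      have "a * 1 \<le> a * a" by (intro mult_left_mono) (use i in auto)
      moreover have "a * a \<le> X" using a by (simp only: A_def power2_eq_square mem_Collect_eq)
      ultimately have "a \<le> X" by linarith
      moreover have "3 \<le> a" using a by (simp only: A_def mem_Collect_eq)
      ultimately have "i \<in> {1..X}" using i by simp
      thus "a \<in> (\<lambda>i. 2 * i + 1) ` {1..X}" using i by blast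
    qed
    hence "(\<Sum>a\<in>A. 1 / real a ^ 2) \<le> (\<Sum>a\<in>(\<lambda>i. 2 * i + 1) ` {1..X}. 1 / real a ^ 2)"
      by (intro sum_mono2) auto
    also have "\<dots> = (\<Sum>i=1..X. 1 / real (2 * i + 1) ^ 2)" by (subst sum.reindex) (auto simp: inj_on_def)
    also have "\<dots> \<le> 1 / 4" by (rule sum_odd_inverse_squares_le)
    finally show ?thesis .
  qed
  have "progression 1 X \<subseteq> family X \<union> progression 1 (X div 2) \<union> (\<Union>a\<in>A. F a)"
  proof
    fix d assume d: "d \<in> progression 1 X"
    have d0: "d > 0" "odd d" using d unfolding progression_def mem_Collect_eq by (auto intro: Nat.gr0I) presburger
    show "d \<in> family X \<union> progression 1 (X div 2) \<union> (\<Union>a\<in>A. F a)"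
    proof (cases "squarefree d")
      case True
      thus ?thesis using d by (auto simp: family_def squarefree_progression_def progression_def)
    next
      case False
      then obtain a where a: "a\<^sup>2 dvd d" "a \<noteq> 1" by (auto simp: squarefree_def)
      have "odd a" using a(1) d0(2) dvd_trans[of 2 "a\<^sup>2" d] by auto
      moreover have "a \<noteq> 0" using \<open>odd a\<close> by (auto intro: Nat.gr0I)
      ultimately have "3 \<le> a" using a(2) by presburger
      moreover have "a\<^sup>2 \<le> X" using dvd_imp_le[OF a(1) d0(1)] d by (simp add: progression_def)
      ultimately have "a \<in> A" using \<open>odd a\<close> by (simp add: A_def)
      thus ?thesis using a d by (auto simp: F_def)
    qed
  qed
  hence "card (progression 1 X) \<le> card (family X \<union> progression 1 (X div 2) \<union> (\<Union>a\<in>A. F a))"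
    using finA by (intro card_mono) (auto simp: F_def)
  also have "\<dots> \<le> card (family X) + card (progression 1 (X div 2)) + (\<Sum>a\<in>A. card (F a))"
    using card_Un_le[of "family X \<union> progression 1 (X div 2)" "\<Union>a\<in>A. F a"]
      card_Un_le[of "family X" "progression 1 (X div 2)"] card_UN_le[OF finA, of F] by linarith
  finally have "real (card (progression 1 X)) \<le> real (card (family X)) + real (card (progression 1 (X div 2))) + (\<Sum>a\<in>A. real (card (F a)))"
    by (simp only: of_nat_le_iff of_nat_add[symmetric] of_nat_sum[symmetric])
  also have "(\<Sum>a\<in>A. real (card (F a))) \<le> (\<Sum>a\<in>A. real X / 8 * (1 / real a ^ 2) + 1)" by (intro sum_mono cardF)
  also have "\<dots> = real X / 8 * (\<Sum>a\<in>A. 1 / real a ^ 2) + real (card A)" by (simp add: sum.distrib sum_distrib_left)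
  also have "\<dots> \<le> real X / 8 * (1 / 4) + sqrt X" using sumA cardA by (intro add_mono mult_left_mono) auto
  finally have 1: "real (card (progression 1 X)) \<le> real (card (family X)) + real (card (progression 1 (X div 2))) + (real X / 32 + sqrt X)"
    by simp
  have 2: "real (card (progression 1 (X div 2))) \<le> real X / 16 + 1"
    using card_progression_real_le[of "X div 2"] of_nat_div_le_of_nat[of X 2, where 'a = real] by simp
  have 3: "sqrt X \<le> real X / 100"
  proof -
    have "sqrt (100\<^sup>2) \<le> sqrt (real X)" using X by (intro real_sqrt_le_mono) simp
    hence "100 * sqrt X \<le> sqrt X * sqrt X" by (intro mult_right_mono) auto
    thus ?thesis by simp
  qed
  \<comment> \<open>X/8 - X/16 - X/32 - X/100 - 1 is at least X/64 in this range.\<close>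
  show ?thesis using 1 2 3 card_progression_real_ge[of X] X by simp
qed

text \<open>A crude union bound over all integers up to X. It suffices because the primes of the
  tuples exceed z and the sum of 1/p is small on average by
  \<open>square_tuples_prime_reciprocals_le\<close>.\<close>

lemma coprime_family_card_ge:
  assumes l: "l > 0"
  shows "real (card {d \<in> family X. coprime d l}) \<ge> real (card (family X)) - real X * (\<Sum>p\<in>prime_factors l. 1 / real p)"
proof -
  define F where "F p = {d \<in> {1..X}. p dvd d}" for p
  have cardF: "real (card (F p)) \<le> real X * (1 / real p)" if p: "p \<in> prime_factors l" for p
  proof -
    have p0: "p > 0" using p by (auto intro: prime_gt_0_nat)
    have "F p \<subseteq> (\<lambda>b. p * b) ` {1..X div p}"
    proof
      fix d assume "d \<in> F p"
      then obtain b where b: "d = p * b" "1 \<le> p * b" "p * b \<le> X" by (auto simp: F_def elim: dvdE)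
      have "b \<ge> 1" using b(2) by (cases b) auto
      moreover have "b \<le> X div p" using b(3) p0 by (simp add: less_eq_div_iff_mult_less_eq mult.commute)
      ultimately show "d \<in> (\<lambda>b. p * b) ` {1..X div p}" using b(1) by auto
    qed
    hence "card (F p) \<le> card ((\<lambda>b. p * b) ` {1..X div p})" by (intro card_mono) auto
    also have "\<dots> \<le> card {1..X div p}" by (rule card_image_le) simp
    finally have "real (card (F p)) \<le> real (X div p)" by simp
    also have "\<dots> \<le> real X / real p" by (rule of_nat_div_le_of_nat)
    finally show ?thesis by simp
  qed
  have "family X \<subseteq> {d \<in> family X. coprime d l} \<union> (\<Union>p\<in>prime_factors l. F p)"
  proof
    fix d assume d: "d \<in> family X"
    show "d \<in> {d \<in> family X. coprime d l} \<union> (\<Union>p\<in>prime_factors l. F p)"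
    proof (cases "coprime d l")
      case False
      hence "gcd d l \<noteq> 1" using gcd_eq_1_imp_coprime by blast
      then obtain p where p: "prime p" "p dvd gcd d l" using prime_factor_nat by blast
      hence "p dvd d" "p dvd l" using gcd_dvd1 gcd_dvd2 dvd_trans by blast+
      hence "p \<in> prime_factors l" "d \<in> F p" using p(1) l family_D[OF d] by (auto simp: F_def intro: prime_factorsI)
      thus ?thesis by blast
    qed (use d in auto)
  qed
  hence "card (family X) \<le> card ({d \<in> family X. coprime d l} \<union> (\<Union>p\<in>prime_factors l. F p))"
    by (intro card_mono) (auto simp: F_def)
  also have "\<dots> \<le> card {d \<in> family X. coprime d l} + (\<Sum>p\<in>prime_factors l. card (F p))"
    using card_Un_le[of "{d \<in> family X. coprime d l}" "\<Union>p\<in>prime_factors l. F p"]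
      card_UN_le[of "prime_factors l" F] by (meson add_left_mono finite_set_mset order_trans)
  finally have "real (card (family X)) \<le> real (card {d \<in> family X. coprime d l}) + (\<Sum>p\<in>prime_factors l. real (card (F p)))"
    by (simp only: of_nat_le_iff of_nat_add[symmetric] of_nat_sum[symmetric])
  also have "(\<Sum>p\<in>prime_factors l. real (card (F p))) \<le> (\<Sum>p\<in>prime_factors l. real X * (1 / real p))"
    by (intro sum_mono cardF)
  finally show ?thesis by (simp add: sum_distrib_left)
qed

text \<open>The tangent to the convex function L^k at c A. Being linear in L, it requires only the
  first moment of L.\<close>

lemma even_power_tangent:
  fixes L A c :: real
  assumes "even k" "k = Suc j" "c > 0"
  shows "L ^ k \<ge> real k * c ^ j * (L * A ^ j) - real j * c ^ k * A ^ k"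
proof (cases "A = 0")
  case True
  have "L ^ k \<ge> 0" using assms(1) by (rule zero_le_even_power)
  \<comment> \<open>Evenness excludes j = 0, so both terms on the right vanish at A = 0.\<close>
  thus ?thesis using assms(1,2) True by (cases j) auto
next
  case False
  define y where "y = c * A"
  have y: "y \<noteq> 0" using False assms by (simp add: y_def)
  have "1 + real k * (L / y - 1) \<le> (1 + (L / y - 1)) ^ k" by (rule Bernoulli_inequality_even[OF assms(1)])
  hence "(1 + real k * (L / y - 1)) * y ^ k \<le> (L / y) ^ k * y ^ k"
    using assms(1) by (intro mult_right_mono) (auto simp: zero_le_even_power)
  also have "\<dots> = L ^ k" using y by (simp add: power_divide)
  also have "(1 + real k * (L / y - 1)) * y ^ k = real k * y ^ j * L - real j * y ^ k"
    using y assms(2) by (simp add: field_simps)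
  finally show ?thesis by (simp add: y_def power_mult_distrib mult_ac)
qed

section \<open>Moments of the resonator\<close>

definition resonator :: "nat \<Rightarrow> nat \<Rightarrow> nat \<Rightarrow> real" where
  "resonator z x d = (\<Sum>n\<in>rough_upto z x. of_int (jacobi (int n) d) * inv_sqrt n)"

lemma jacobi_prod_left: "finite I \<Longrightarrow> jacobi (int (\<Prod>i\<in>I. f i)) d = (\<Prod>i\<in>I. jacobi (int (f i)) d)"
  by (induction I rule: finite_induct) (simp_all add: jacobi_mult_left)

lemma resonator_power:
  "resonator z x d ^ k = (\<Sum>f\<in>PiE {..<k} (\<lambda>_. rough_upto z x).
     (\<Prod>i<k. inv_sqrt (f i)) * of_int (jacobi (int (\<Prod>i<k. f i)) d))"
proof -
  have "resonator z x d ^ k = (\<Prod>i<k. \<Sum>n\<in>rough_upto z x. of_int (jacobi (int n) d) * inv_sqrt n)"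
    by (simp add: resonator_def)
  also have "\<dots> = (\<Sum>f\<in>PiE {..<k} (\<lambda>_. rough_upto z x). \<Prod>i<k. of_int (jacobi (int (f i)) d) * inv_sqrt (f i))"
    by (rule prod_sum_PiE) auto
  finally show ?thesis by (simp only: prod.distrib jacobi_prod_left[OF finite_lessThan] of_int_prod mult.commute)
qed

lemma rough_odd: "z \<ge> 2 \<Longrightarrow> n \<in> rough_upto z x \<Longrightarrow> odd n"
  by (auto simp: rough_upto_def)

lemma tuple_prod_bounds:
  assumes "f \<in> PiE {..<k} (\<lambda>_. rough_upto z x)" "z \<ge> 2"
  shows "(\<Prod>i<k. f i) > 0" "(\<Prod>i<k. f i) \<le> x ^ k" "odd (\<Prod>i<k. f i)"
proof -
  have f: "0 < f i" "f i \<le> x" "odd (f i)" if "i < k" for i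
  proof -
    have "f i \<in> rough_upto z x" using assms(1) that by auto
    thus "0 < f i" "f i \<le> x" "odd (f i)" using rough_odd[OF assms(2)] by (auto simp: rough_upto_def)
  qed
  show "(\<Prod>i<k. f i) > 0" using f by (intro prod_pos) auto
  have "(\<Prod>i<k. f i) \<le> (\<Prod>i<k. x)" using f by (intro prod_mono) auto
  thus "(\<Prod>i<k. f i) \<le> x ^ k" by simp
  show "odd (\<Prod>i<k. f i)" using f by (auto simp: even_prod_iff)
qed

lemma card_tuples_le: "card (PiE {..<k} (\<lambda>_. rough_upto z x)) \<le> x ^ k"
proof -
  have "rough_upto z x \<subseteq> {1..x}" by (auto simp: rough_upto_def)
  hence "card (rough_upto z x) \<le> x" using card_mono[of "{1..x}"] by fastforce
  thus ?thesis by (simp add: card_PiE power_mono)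
qed

lemma inv_sqrt_le_1: "inv_sqrt n \<le> 1"
  by (cases "n = 0") (auto simp: inv_sqrt_def)

text \<open>As k is even, the family may be enlarged to the whole progression, which avoids the
  sieve. Square products are estimated trivially and give T; a non-square product costs at most 36
  x^k, for at most x^k tuples.\<close>

lemma resonator_moment_le:
  assumes k: "even k" and z: "z \<ge> 2" and k0: "k > 0"
  shows "(\<Sum>d\<in>family X. resonator z x d ^ k) \<le> real X * square_sum {..<k} z x + 36 * real x ^ (2 * k)"
proof -
  define V where "V = PiE {..<k} (\<lambda>_. rough_upto z x)"
  have finV: "finite V" by (auto simp: V_def intro!: finite_PiE)
  have "(\<Sum>d\<in>family X. resonator z x d ^ k) \<le> (\<Sum>d\<in>progression 1 X. resonator z x d ^ k)"
    using k by (intro sum_mono2) (auto simp: family_def squarefree_progression_def zero_le_even_power)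
  also have "\<dots> = (\<Sum>f\<in>V. (\<Prod>i<k. inv_sqrt (f i)) * of_int (\<Sum>d\<in>progression 1 X. jacobi (int (\<Prod>i<k. f i)) d))"
    unfolding resonator_power V_def[symmetric] of_int_sum sum_distrib_left by (rule sum.swap)
  also have "\<dots> \<le> (\<Sum>f\<in>V. (if perfect_square (\<Prod>i<k. f i) then real X * (\<Prod>i<k. inv_sqrt (f i)) else 0) + 36 * real x ^ k)"
  proof (intro sum_mono)
    fix f assume f: "f \<in> V"
    define l where "l = (\<Prod>i<k. f i)"
    define w where "w = (\<Prod>i<k. inv_sqrt (f i))"
    have l: "l > 0" "l \<le> x ^ k" "odd l" using tuple_prod_bounds[of f k z x] f z by (simp_all add: V_def l_def)
    have w: "0 \<le> w" "w \<le> 1" unfolding w_def prod_inv_sqrt using inv_sqrt_le_1 by auto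
    have eq: "(\<Sum>d\<in>progression 1 X. jacobi (int l) d) = (\<Sum>d\<in>progression 1 X. jacobi (int d) l)"
      using l(3) by (intro sum.cong refl jacobi_flip) (auto simp: progression_def)
    have "w * of_int (\<Sum>d\<in>progression 1 X. jacobi (int l) d) \<le> (if perfect_square l then real X * w else 0) + 36 * real x ^ k"
    proof (cases "perfect_square l")
      case True
      have "(\<Sum>d\<in>progression 1 X. jacobi (int l) d) \<le> (\<Sum>d\<in>progression 1 X. 1)"
        using jacobi_abs_le_1 by (intro sum_mono) (simp add: abs_le_iff)
      also have "\<dots> \<le> int X" using card_progression_le[of X] by simp
      finally have "real_of_int (\<Sum>d\<in>progression 1 X. jacobi (int l) d) \<le> real X" by linarith
      hence "w * of_int (\<Sum>d\<in>progression 1 X. jacobi (int l) d) \<le> w * real X" using w by (intro mult_left_mono) auto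
      moreover have "36 * real x ^ k \<ge> 0" by simp
      ultimately have "w * of_int (\<Sum>d\<in>progression 1 X. jacobi (int l) d) \<le> real X * w + 36 * real x ^ k"
        by (simp only: mult.commute[of w])
      thus ?thesis using True by (simp only: if_True)
    next
      case False
      have "real_of_int (\<Sum>d\<in>progression 1 X. jacobi (int l) d) \<le> real_of_int \<bar>\<Sum>d\<in>progression 1 X. jacobi (int d) l\<bar>"
        unfolding eq by linarith
      also have "\<dots> \<le> 36 * real l powr (5/9)" by (rule jacobi_sum_le_powr[OF l(3) False])
      also have "real l powr (5/9) \<le> real l powr 1" using l(1) by (intro powr_mono) auto
      also have "real l powr 1 = real l" using l(1) by simp
      also have "real l \<le> real (x ^ k)" using l(2) by (rule of_nat_mono)
      finally have 1: "real_of_int (\<Sum>d\<in>progression 1 X. jacobi (int l) d) \<le> 36 * real x ^ k" by simp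
      have "w * of_int (\<Sum>d\<in>progression 1 X. jacobi (int l) d) \<le> w * (36 * real x ^ k)"
        using 1 w by (intro mult_left_mono) auto
      also have "\<dots> \<le> 1 * (36 * real x ^ k)" using w by (intro mult_right_mono) auto
      finally show ?thesis using False by simp
    qed
    thus "(\<Prod>i<k. inv_sqrt (f i)) * of_int (\<Sum>d\<in>progression 1 X. jacobi (int (\<Prod>i<k. f i)) d) \<le>
        (if perfect_square (\<Prod>i<k. f i) then real X * (\<Prod>i<k. inv_sqrt (f i)) else 0) + 36 * real x ^ k"
      by (simp only: l_def w_def)
  qed
  also have "\<dots> = real X * square_sum {..<k} z x + real (card V) * (36 * real x ^ k)"
  proof -
    have "(\<Sum>f\<in>V. if perfect_square (\<Prod>i<k. f i) then real X * (\<Prod>i<k. inv_sqrt (f i)) else 0) =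
        (\<Sum>f\<in>{f \<in> V. perfect_square (\<Prod>i<k. f i)}. real X * (\<Prod>i<k. inv_sqrt (f i)))"
      by (rule sum.inter_filter[OF finV, symmetric])
    also have "\<dots> = real X * square_sum {..<k} z x"
      by (simp only: square_sum_def square_tuples_def V_def sum_distrib_left)
    finally show ?thesis by (simp add: sum.distrib)
  qed
  also have "real (card V) * (36 * real x ^ k) \<le> real (x ^ k) * (36 * real x ^ k)"
    unfolding V_def by (intro mult_right_mono of_nat_mono card_tuples_le) auto
  also have "real (x ^ k) * (36 * real x ^ k) = 36 * real x ^ (2 * k)" by (simp add: mult_2 power_add)
  finally show ?thesis by simp
qed

text \<open>Separates the last coordinate: one variable comes from L, the other j from the
  resonator.\<close>

lemma sum_PiE_Suc:
  "(\<Sum>f\<in>PiE {..<Suc j} (\<lambda>_. R). h f) = (\<Sum>g\<in>PiE {..<j} (\<lambda>_. R). \<Sum>m\<in>R. h (g(j := m)))"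
proof -
  have "(\<Sum>f\<in>PiE {..<Suc j} (\<lambda>_. R). h f) = (\<Sum>p\<in>PiE {..<j} (\<lambda>_. R) \<times> R. h ((fst p)(j := snd p)))"
  proof (rule sum.reindex_bij_witness[of _ "\<lambda>p. (fst p)(j := snd p)" "\<lambda>f. (restrict f {..<j}, f j)"])
    fix f assume f: "f \<in> PiE {..<Suc j} (\<lambda>_. R)"
    show eq: "(fst (restrict f {..<j}, f j))(j := snd (restrict f {..<j}, f j)) = f"
    proof
      fix i
      show "((fst (restrict f {..<j}, f j))(j := snd (restrict f {..<j}, f j))) i = f i"
        using f by (cases "i < Suc j") (auto simp: PiE_def extensional_def less_Suc_eq)
    qed
    show "h ((fst (restrict f {..<j}, f j))(j := snd (restrict f {..<j}, f j))) = h f" by (simp only: eq)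
    show "(restrict f {..<j}, f j) \<in> PiE {..<j} (\<lambda>_. R) \<times> R" using f by (auto simp: PiE_def)
  next
    fix p assume p: "p \<in> PiE {..<j} (\<lambda>_. R) \<times> R"
    show "(restrict ((fst p)(j := snd p)) {..<j}, ((fst p)(j := snd p)) j) = p"
    proof (rule prod_eqI)
      show "fst (restrict ((fst p)(j := snd p)) {..<j}, ((fst p)(j := snd p)) j) = fst p"
        using p by (auto simp: PiE_def extensional_def fun_eq_iff)
    qed simp
    show "(fst p)(j := snd p) \<in> PiE {..<Suc j} (\<lambda>_. R)"
      using p by (auto simp: PiE_def extensional_def less_Suc_eq)
  qed
  also have "\<dots> = (\<Sum>g\<in>PiE {..<j} (\<lambda>_. R). \<Sum>m\<in>R. h (g(j := m)))"
    by (subst sum.cartesian_product) (simp add: case_prod_beta)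
  finally show ?thesis .
qed

text \<open>The variable m of L completes the j resonator variables to a k-tuple with square
  product, so the main terms assemble to T weighted by counts of coprime d. Such a count is at least
  X/64 minus X times the sum of 1/p over the primes of the tuple, and for z >= 128 k^2 the average
  of that sum is at most 1/128.\<close>

theorem resonated_first_moment_ge:
  assumes X: "X \<ge> 20000" and k: "k = Suc j" and z: "z \<ge> 2" "z \<ge> 128 * k ^ 2" and x: "x\<^sup>2 \<le> X" "x \<ge> 1"
  shows "sqrt pi * (\<Sum>d\<in>family X. L_half d * resonator z x d ^ j) \<ge>
    exp (-2) / sqrt 2 * (real X / 128 * square_sum {..<k} z x) -
    25 / 2 * family_constant * zeta_21_20 * real X powr (19/20) * real x ^ k"
proof -
  define R where "R = rough_upto z x"
  define V where "V = PiE {..<j} (\<lambda>_. R)"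
  define \<nu> where "\<nu> g = (\<Prod>i<j. g i)" for g :: "nat \<Rightarrow> nat"
  define w where "w g = (\<Prod>i<j. inv_sqrt (g i))" for g
  define C where "C = 25 / 2 * family_constant * zeta_21_20 * real X powr (19/20)"
  define cop where "cop l = real (card {d \<in> family X. coprime d l})" for l
  define T where "T = square_sum {..<k} z x"
  have C: "C \<ge> 0" using family_constant(1) zeta_21_20_pos by (simp add: C_def)
  have R: "finite R" "\<And>m. m \<in> R \<Longrightarrow> odd m \<and> m\<^sup>2 \<le> X"
  proof -
    show "finite R" by (simp add: R_def)
    fix m assume m: "m \<in> R"
    hence "m \<le> x" by (simp add: R_def rough_upto_def)
    hence "m\<^sup>2 \<le> x\<^sup>2" by (intro power_mono) auto
    hence "m\<^sup>2 \<le> X" using x(1) by (rule order_trans)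
    thus "odd m \<and> m\<^sup>2 \<le> X" using m rough_odd[OF z(1)] by (simp only: R_def) blast
  qed
  have finV: "finite V" using R by (auto simp: V_def intro!: finite_PiE)
  have \<nu>: "\<nu> g > 0" "\<nu> g \<le> x ^ j" "odd (\<nu> g)" if "g \<in> V" for g
    using tuple_prod_bounds[of g j z x] that z by (simp_all add: V_def R_def \<nu>_def)
  have w: "w g \<ge> 0" for g by (auto simp: w_def intro!: prod_nonneg)
  \<comment> \<open>The error grows like \<nu>^(1/4) while the weight is \<nu>^(-1/2), so each tuple
    contributes at most one unit of error.\<close>
  have w_err: "w g * real (\<nu> g) powr (1/4) \<le> 1" if "g \<in> V" for g
  proof -
    have "w g = real (\<nu> g) powr (-1/2)"
      using \<nu>(1)[OF that] powr_minus_divide[of "real (\<nu> g)" "1/2"]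
      unfolding w_def prod_inv_sqrt \<nu>_def[symmetric] by (simp add: inv_sqrt_def powr_half_sqrt)
    hence "w g * real (\<nu> g) powr (1/4) = real (\<nu> g) powr (-1/4)" by (simp add: powr_add[symmetric])
    also have "\<dots> \<le> real (\<nu> g) powr 0" using \<nu>(1)[OF that] by (intro powr_mono) auto
    also have "\<dots> = 1" using \<nu>(1)[OF that] by simp
    finally show ?thesis .
  qed
  have "sqrt pi * (\<Sum>d\<in>family X. L_half d * resonator z x d ^ j) =
      (\<Sum>d\<in>family X. \<Sum>g\<in>V. w g * (sqrt pi * (of_int (jacobi (int (\<nu> g)) d) * L_half d)))"
    unfolding resonator_power sum_distrib_left V_def R_def w_def \<nu>_def
    by (intro sum.cong refl) (simp only: mult_ac)
  also have "\<dots> = (\<Sum>g\<in>V. w g * (sqrt pi * (\<Sum>d\<in>family X. of_int (jacobi (int (\<nu> g)) d) * L_half d)))"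
    by (subst sum.swap) (simp only: sum_distrib_left)
  also have "\<dots> \<ge> (\<Sum>g\<in>V. w g * (exp (-2) / sqrt 2 * (\<Sum>m\<in>{m \<in> R. perfect_square (\<nu> g * m)}. cop (\<nu> g * m) * inv_sqrt m) -
      C * real (\<nu> g) powr (1/4)))"
  proof (intro sum_mono mult_left_mono w)
    fix g assume g: "g \<in> V"
    show "exp (-2) / sqrt 2 * (\<Sum>m\<in>{m \<in> R. perfect_square (\<nu> g * m)}. cop (\<nu> g * m) * inv_sqrt m) -
        C * real (\<nu> g) powr (1/4) \<le> sqrt pi * (\<Sum>d\<in>family X. of_int (jacobi (int (\<nu> g)) d) * L_half d)"
      unfolding cop_def C_def by (rule twisted_first_moment_ge[OF X \<nu>(3)[OF g] R])
  qed
  finally have 1: "sqrt pi * (\<Sum>d\<in>family X. L_half d * resonator z x d ^ j) \<ge>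
      (\<Sum>g\<in>V. w g * (exp (-2) / sqrt 2 * (\<Sum>m\<in>{m \<in> R. perfect_square (\<nu> g * m)}. cop (\<nu> g * m) * inv_sqrt m) -
      C * real (\<nu> g) powr (1/4)))" .
  have 2: "(\<Sum>g\<in>V. w g * (exp (-2) / sqrt 2 * (\<Sum>m\<in>{m \<in> R. perfect_square (\<nu> g * m)}. cop (\<nu> g * m) * inv_sqrt m) -
      C * real (\<nu> g) powr (1/4))) =
      exp (-2) / sqrt 2 * (\<Sum>g\<in>V. \<Sum>m\<in>{m \<in> R. perfect_square (\<nu> g * m)}. cop (\<nu> g * m) * (w g * inv_sqrt m)) -
      C * (\<Sum>g\<in>V. w g * real (\<nu> g) powr (1/4))"
    by (simp add: right_diff_distrib sum_subtractf sum_distrib_left mult_ac)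
  have 3: "C * (\<Sum>g\<in>V. w g * real (\<nu> g) powr (1/4)) \<le> C * real x ^ k"
  proof (intro mult_left_mono C)
    have "(\<Sum>g\<in>V. w g * real (\<nu> g) powr (1/4)) \<le> (\<Sum>g\<in>V. 1)" by (intro sum_mono w_err)
    also have "\<dots> = real (card V)" by simp
    also have "\<dots> \<le> real (x ^ j)" unfolding V_def R_def by (intro of_nat_mono card_tuples_le)
    also have "\<dots> \<le> real x ^ k" using x by (simp add: k)
    finally show "(\<Sum>g\<in>V. w g * real (\<nu> g) powr (1/4)) \<le> real x ^ k" .
  qed
  have 4: "(\<Sum>g\<in>V. \<Sum>m\<in>{m \<in> R. perfect_square (\<nu> g * m)}. cop (\<nu> g * m) * (w g * inv_sqrt m)) =
      (\<Sum>f\<in>square_tuples {..<k} z x. cop (\<Prod>i<k. f i) * (\<Prod>i<k. inv_sqrt (f i)))"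
  proof -
    have "(\<Sum>f\<in>square_tuples {..<k} z x. cop (\<Prod>i<k. f i) * (\<Prod>i<k. inv_sqrt (f i))) =
        (\<Sum>f\<in>PiE {..<k} (\<lambda>_. R). if perfect_square (\<Prod>i<k. f i) then cop (\<Prod>i<k. f i) * (\<Prod>i<k. inv_sqrt (f i)) else 0)"
      unfolding square_tuples_def R_def[symmetric]
      by (rule sum.inter_filter) (use R in \<open>auto intro!: finite_PiE\<close>)
    also have "\<dots> = (\<Sum>g\<in>V. \<Sum>m\<in>R. if perfect_square (\<nu> g * m) then cop (\<nu> g * m) * (w g * inv_sqrt m) else 0)"
      unfolding k sum_PiE_Suc V_def[symmetric]
    proof (intro sum.cong refl)
      fix g m
      have "(\<Prod>i<j. (g(j := m)) i) = \<nu> g" unfolding \<nu>_def by (intro prod.cong) auto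
      hence "(\<Prod>i<Suc j. (g(j := m)) i) = \<nu> g * m"
        by (simp only: prod.lessThan_Suc fun_upd_same)
      moreover have "(\<Prod>i<j. inv_sqrt ((g(j := m)) i)) = w g" unfolding w_def by (intro prod.cong) auto
      hence "(\<Prod>i<Suc j. inv_sqrt ((g(j := m)) i)) = w g * inv_sqrt m"
        by (simp only: prod.lessThan_Suc fun_upd_same)
      ultimately show "(if perfect_square (\<Prod>i<Suc j. (g(j := m)) i)
          then cop (\<Prod>i<Suc j. (g(j := m)) i) * (\<Prod>i<Suc j. inv_sqrt ((g(j := m)) i)) else 0) =
          (if perfect_square (\<nu> g * m) then cop (\<nu> g * m) * (w g * inv_sqrt m) else 0)"
        by (simp only:)
    qed
    also have "\<dots> = (\<Sum>g\<in>V. \<Sum>m\<in>{m \<in> R. perfect_square (\<nu> g * m)}. cop (\<nu> g * m) * (w g * inv_sqrt m))"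
      by (intro sum.cong refl sum.inter_filter[symmetric] R)
    finally show ?thesis ..
  qed
  have 5: "(\<Sum>f\<in>square_tuples {..<k} z x. cop (\<Prod>i<k. f i) * (\<Prod>i<k. inv_sqrt (f i))) \<ge> real X / 128 * T"
  proof -
    have "(\<Sum>f\<in>square_tuples {..<k} z x. (real X / 64 - real X * (\<Sum>p\<in>prime_factors (\<Prod>i<k. f i). 1 / real p)) * (\<Prod>i<k. inv_sqrt (f i))) \<le>
        (\<Sum>f\<in>square_tuples {..<k} z x. cop (\<Prod>i<k. f i) * (\<Prod>i<k. inv_sqrt (f i)))"
    proof (intro sum_mono mult_right_mono prod_nonneg)
      fix f assume "f \<in> square_tuples {..<k} z x"
      hence "(\<Prod>i<k. f i) > 0" using tuple_prod_bounds(1)[of f k z x] z(1) by (simp add: square_tuples_def)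
      thus "real X / 64 - real X * (\<Sum>p\<in>prime_factors (\<Prod>i<k. f i). 1 / real p) \<le> cop (\<Prod>i<k. f i)"
        using coprime_family_card_ge[of "\<Prod>i<k. f i" X] card_family_ge[OF X] unfolding cop_def by linarith
    qed auto
    also have "(\<Sum>f\<in>square_tuples {..<k} z x. (real X / 64 - real X * (\<Sum>p\<in>prime_factors (\<Prod>i<k. f i). 1 / real p)) * (\<Prod>i<k. inv_sqrt (f i))) =
        real X / 64 * T - real X * (\<Sum>f\<in>square_tuples {..<k} z x. (\<Prod>i<k. inv_sqrt (f i)) * (\<Sum>p\<in>prime_factors (\<Prod>i<k. f i). 1 / real p))"
    proof -
      have "(real X / 64 - real X * (\<Sum>p\<in>prime_factors (\<Prod>i<k. f i). 1 / real p)) * (\<Prod>i<k. inv_sqrt (f i)) =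
          real X / 64 * (\<Prod>i<k. inv_sqrt (f i)) - real X * ((\<Prod>i<k. inv_sqrt (f i)) * (\<Sum>p\<in>prime_factors (\<Prod>i<k. f i). 1 / real p))" for f
        by (simp add: left_diff_distrib)
      thus ?thesis by (simp only: sum_subtractf sum_distrib_left[symmetric] T_def square_sum_def)
    qed
    also have "\<dots> \<ge> real X / 64 * T - real X * (1 / 128 * T)"
    proof (intro diff_left_mono mult_left_mono)
      have "(\<Sum>f\<in>square_tuples {..<k} z x. (\<Prod>i<k. inv_sqrt (f i)) * (\<Sum>p\<in>prime_factors (\<Prod>i<k. f i). 1 / real p)) \<le>
          real (card {..<k}) ^ 2 / real z * T"
        unfolding T_def using z(1) by (intro square_tuples_prime_reciprocals_le) auto
      also have "\<dots> \<le> 1 / 128 * T"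
      proof (rule mult_right_mono)
        have "real (128 * k ^ 2) \<le> real z" using z(2) by (rule of_nat_mono)
        thus "real (card {..<k}) ^ 2 / real z \<le> 1 / 128" using z(1) by (simp add: field_simps)
      qed (simp add: T_def square_sum_nonneg)
      finally show "(\<Sum>f\<in>square_tuples {..<k} z x. (\<Prod>i<k. inv_sqrt (f i)) * (\<Sum>p\<in>prime_factors (\<Prod>i<k. f i). 1 / real p)) \<le> 1 / 128 * T" .
    qed auto
    finally have "real X / 64 * T - real X * (1 / 128 * T) \<le>
        (\<Sum>f\<in>square_tuples {..<k} z x. cop (\<Prod>i<k. f i) * (\<Prod>i<k. inv_sqrt (f i)))" .
    moreover have "real X / 64 * T - real X * (1 / 128 * T) = real X / 128 * T" by simp
    ultimately show ?thesis by (simp only:)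
  qed
  have "exp (-2) / sqrt 2 * (real X / 128 * T) \<le> exp (-2) / sqrt 2 * (\<Sum>f\<in>square_tuples {..<k} z x. cop (\<Prod>i<k. f i) * (\<Prod>i<k. inv_sqrt (f i)))"
    using 5 by (intro mult_left_mono) auto
  hence "exp (-2) / sqrt 2 * (real X / 128 * T) - C * real x ^ k \<le> sqrt pi * (\<Sum>d\<in>family X. L_half d * resonator z x d ^ j)"
    using 1[unfolded 2 4] 3 by linarith
  thus ?thesis unfolding T_def C_def .
qed


section \<open>Assembly of the moment bound for the family\<close>

lemma square_sum_ge_1:
  assumes "x \<ge> 1" "finite I"
  shows "square_sum I z x \<ge> 1"
proof -
  define f where "f = (\<lambda>i\<in>I. 1::nat)"
  have "1 \<in> rough_upto z x" using assms(1) by (auto simp: rough_upto_def)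
  moreover have f1: "prod f I = 1" unfolding f_def by (intro prod.neutral) simp
  moreover have "perfect_square (1::nat)" by (rule exI[of _ 1]) simp
  ultimately have "f \<in> square_tuples I z x" by (auto simp: square_tuples_def f_def)
  moreover have "(\<Prod>i\<in>I. inv_sqrt (f i)) = 1" unfolding f_def by (intro prod.neutral) (simp add: inv_sqrt_def)
  moreover have "finite (square_tuples I z x)" using assms(2) unfolding square_tuples_def by (intro finite_subset[OF _ finite_PiE[of I "\<lambda>_. rough_upto z x"]]) auto
  moreover have "0 \<le> (\<Prod>i\<in>I. inv_sqrt (g i))" for g by (intro prod_nonneg) simp
  ultimately show ?thesis unfolding square_sum_def
    using member_le_sum[of f "square_tuples I z x" "\<lambda>f. \<Prod>i\<in>I. inv_sqrt (f i)"] by simp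
qed

lemma eventually_powr_ge: "a > 0 \<Longrightarrow> \<forall>\<^sub>F X in sequentially. real X powr a \<ge> M"
  using filterlim_compose[OF real_powr_at_top filterlim_real_sequentially] by (simp add: filterlim_at_top)

theorem moment_lower_bound:
  fixes k :: nat
  assumes k: "even k" "k > 0"
  shows "\<exists>c>0. \<forall>\<^sub>F X in sequentially. (\<Sum>d\<in>family X. L_half d ^ k) \<ge> c * real X * ln X ^ (k * (k + 1) div 2)"
proof -
  define N where "N = k * (k + 1) div 2"
  obtain j where j: "k = Suc j" using k(2) by (cases k) auto
  \<comment> \<open>Large enough at once for oddness, for \<open>square_sum_lower_bound\<close> and
    for the averaged coprimality loss.\<close>
  define z where "z = 2 + 2 * N\<^sup>2 + 128 * k\<^sup>2"
  have z: "z > 0" "z \<ge> 2" "z \<ge> 2 * N\<^sup>2" "z \<ge> 128 * k\<^sup>2" by (auto simp: z_def)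
  obtain cT xT where cT: "cT > 0" "\<And>x. x \<ge> xT \<Longrightarrow> square_sum {..<k} z x \<ge> cT * ln (real x) ^ N"
    using square_sum_lower_bound[of z k] z unfolding N_def by blast
  \<comment> \<open>Makes x^k <= X^(1/40), so the first-moment error X^(19/20) x^k is at most
    X^(39/40).\<close>
  define a where "a = 1 / (40 * real k)"
  have a: "a > 0" "a \<le> 1 / 40" using k(2) by (auto simp: a_def field_simps)
  have a2: "a / 2 > 0" and a40: "1 / 40 > (0::real)" using a by auto
  define c4 :: real where "c4 = exp (-2) / sqrt 2"
  define C3 where "C3 = 25 / 2 * family_constant * zeta_21_20"
  \<comment> \<open>Half of the main term c4 X T / 128 is given up to absorb the error; sqrt pi is
    the normalisation of the integral.\<close>
  define c1 where "c1 = c4 / (256 * sqrt pi)"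
  have c4: "c4 > 0" by (simp add: c4_def)
  have c1: "c1 > 0" using c4 by (simp add: c1_def)
  have C3: "C3 \<ge> 0" using family_constant(1) zeta_21_20_pos by (simp add: C3_def)
  \<comment> \<open>The ratio of the moment bounds c1 X T and 37 X T. With it k \<kappa>^j c1 - 37 j
    \<kappa>^k collapses to \<kappa>^j c1, as k - j = 1.\<close>
  define \<kappa> where "\<kappa> = c1 / 37"
  have \<kappa>: "\<kappa> > 0" using c1 by (simp add: \<kappa>_def)
  define c where "c = \<kappa> ^ j * c1 * (cT * (a / 2) ^ N)"
  have "c > 0" using \<kappa> c1 cT(1) a(1) by (simp add: c_def)
  moreover have "\<forall>\<^sub>F X in sequentially. (\<Sum>d\<in>family X. L_half d ^ k) \<ge> c * real X * ln X ^ N"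
    using eventually_ge_at_top[of "20000::nat"] eventually_powr_ge[OF a40, of "256 * C3 / c4"]
      eventually_powr_ge[OF a(1), of "real xT + 2"] eventually_powr_ge[OF a2, of 2]
  proof eventually_elim
    case (elim X)
    have X: "X \<ge> 20000" "real X > 1" using elim(1) by auto
    have X1: "real X powr (1/40) \<ge> 256 * C3 / c4" using elim(2) by simp
    have X3: "real X powr (a / 2) \<ge> 2" using elim(4) a by simp
    define x where "x = nat \<lfloor>real X powr a\<rfloor>"
    have xle: "real x \<le> real X powr a" by (simp add: x_def)
    have xgt: "real x > real X powr a - 1" unfolding x_def using real_of_int_floor_gt_diff_one[of "real X powr a"] by simp
    have x1: "x \<ge> 1" using xgt elim(3) by simp
    have xT: "x \<ge> xT" using xgt elim(3) by linarith
    have xpow: "real x ^ m \<le> real X powr (a * real m)" for m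
    proof -
      have "real x ^ m \<le> (real X powr a) ^ m" using xle by (intro power_mono) auto
      also have "\<dots> = real X powr (a * real m)" using X by (simp add: powr_powr[symmetric] powr_realpow[symmetric])
      finally show ?thesis .
    qed
    have xk: "real x ^ k \<le> real X powr (1/40)" using xpow[of k] k(2) by (simp add: a_def)
    have x2k: "real x ^ (2 * k) \<le> real X"
    proof -
      have "a * real (2 * k) = 1 / 20" using k(2) by (simp add: a_def)
      hence "real x ^ (2 * k) \<le> real X powr (1/20)" using xpow[of "2 * k"] by (simp only:)
      also have "\<dots> \<le> real X powr 1" using X by (intro powr_mono) auto
      finally show ?thesis using X by simp
    qed
    have xx: "x\<^sup>2 \<le> X"
    proof -
      have "real x ^ 2 \<le> real x ^ (2 * k)" using x1 k(2) by (intro power_increasing) auto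
      hence "real (x\<^sup>2) \<le> real X" using x2k by (simp only: of_nat_power)
      thus ?thesis by (simp only: of_nat_le_iff)
    qed
    define T where "T = square_sum {..<k} z x"
    \<comment> \<open>This lets errors of size X be absorbed into X T: 37 is 1 + 36 from
      \<open>resonator_moment_le\<close>.\<close>
    have T1: "T \<ge> 1" unfolding T_def by (rule square_sum_ge_1[OF x1]) simp
    define S1 where "S1 = (\<Sum>d\<in>family X. L_half d * resonator z x d ^ j)"
    define S2 where "S2 = (\<Sum>d\<in>family X. resonator z x d ^ k)"
    have S2: "S2 \<le> 37 * (real X * T)"
    proof -
      have "S2 \<le> real X * T + 36 * real x ^ (2 * k)" unfolding S2_def T_def
        by (rule resonator_moment_le[OF k(1) z(2) k(2)])
      also have "36 * real x ^ (2 * k) \<le> 36 * (real X * T)"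
      proof -
        have "real x ^ (2 * k) \<le> real X * 1" using x2k by simp
        also have "\<dots> \<le> real X * T" using T1 by (intro mult_left_mono) auto
        finally show ?thesis by (rule mult_left_mono) simp
      qed
      finally show ?thesis by linarith
    qed
    have S1: "S1 \<ge> c1 * (real X * T)"
    proof -
      have "C3 * real X powr (19/20) * real x ^ k \<le> C3 * real X powr (19/20) * real X powr (1/40)"
        using C3 xk by (intro mult_left_mono) auto
      also have "\<dots> = C3 * real X powr (39/40)" by (simp add: powr_add[symmetric])
      also have "\<dots> \<le> c4 / 256 * real X powr (1/40) * real X powr (39/40)"
        using X1 c4 by (intro mult_right_mono) (auto simp: field_simps)
      also have "\<dots> = c4 / 256 * real X" using X by (simp add: powr_add[symmetric])
      also have "\<dots> = c4 / 256 * (real X * 1)" by simp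
      also have "\<dots> \<le> c4 / 256 * (real X * T)" using T1 c4 by (intro mult_left_mono) auto
      finally have "C3 * real X powr (19/20) * real x ^ k \<le> c4 / 256 * (real X * T)" .
      moreover have "sqrt pi * S1 \<ge> c4 * (real X / 128 * T) - C3 * real X powr (19/20) * real x ^ k"
        unfolding S1_def c4_def C3_def T_def by (rule resonated_first_moment_ge[OF X(1) j z(2) z(4) xx x1])
      moreover have "c4 * (real X / 128 * T) = 2 * (c4 / 256 * (real X * T))" by simp
      ultimately have "sqrt pi * S1 \<ge> c4 / 256 * (real X * T)" by linarith
      hence "c4 / 256 * (real X * T) / sqrt pi \<le> S1" by (simp add: pos_divide_le_eq mult.commute)
      moreover have "c4 / 256 * (real X * T) / sqrt pi = c1 * (real X * T)" by (simp add: c1_def)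
      ultimately show ?thesis by (simp only:)
    qed
    have "\<kappa> ^ j * c1 * (real X * T) = real k * \<kappa> ^ j * (c1 * (real X * T)) - real j * \<kappa> ^ k * (37 * (real X * T))"
      by (simp add: j \<kappa>_def algebra_simps)
    also have "\<dots> \<le> real k * \<kappa> ^ j * S1 - real j * \<kappa> ^ k * S2"
      using S1 S2 \<kappa> by (intro diff_mono mult_left_mono) auto
    also have "\<dots> = (\<Sum>d\<in>family X. real k * \<kappa> ^ j * (L_half d * resonator z x d ^ j) - real j * \<kappa> ^ k * resonator z x d ^ k)"
      unfolding S1_def S2_def by (simp only: sum_distrib_left sum_subtractf)
    also have "\<dots> \<le> (\<Sum>d\<in>family X. L_half d ^ k)"
      by (intro sum_mono even_power_tangent k(1) j \<kappa>)
    finally have main: "\<kappa> ^ j * c1 * (real X * T) \<le> (\<Sum>d\<in>family X. L_half d ^ k)" .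
    \<comment> \<open>Halving the exponent absorbs the rounding in \<open>x\<close>: x > X^a - 1 >=
      X^(a/2) once X^(a/2) >= 2.\<close>
    have "a / 2 * ln X \<le> ln (real x)"
    proof -
      have "real X powr a = real X powr (a / 2) * real X powr (a / 2)" by (simp add: powr_add[symmetric])
      moreover have "2 * real X powr (a / 2) \<le> real X powr (a / 2) * real X powr (a / 2)"
        using X3 by (intro mult_right_mono) auto
      ultimately have "real X powr (a / 2) \<le> real x" using xgt X3 by linarith
      moreover have "0 < real X powr (a / 2)" using X3 by linarith
      ultimately have "ln (real X powr (a / 2)) \<le> ln (real x)" using x1 by (subst ln_le_cancel_iff) auto
      thus ?thesis using X by (simp add: ln_powr)
    qed
    hence "(a / 2 * ln X) ^ N \<le> ln (real x) ^ N" using a X by (intro power_mono) auto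
    hence "cT * (a / 2 * ln X) ^ N \<le> cT * ln (real x) ^ N" using cT(1) by (intro mult_left_mono) auto
    also have "\<dots> \<le> T" unfolding T_def by (rule cT(2)[OF xT])
    finally have "\<kappa> ^ j * c1 * (real X * (cT * (a / 2 * ln X) ^ N)) \<le> \<kappa> ^ j * c1 * (real X * T)"
      using \<kappa> c1 by (intro mult_left_mono) auto
    moreover have "\<kappa> ^ j * c1 * (real X * (cT * (a / 2 * ln X) ^ N)) = c * real X * ln X ^ N"
      unfolding c_def power_mult_distrib by (simp only: mult_ac)
    ultimately show "c * real X * ln X ^ N \<le> (\<Sum>d\<in>family X. L_half d ^ k)" using main by linarith
  qed
  ultimately show ?thesis unfolding N_def by blast
qed

section \<open>From the family to all fundamental discriminants\<close>

lemma family_fundamental_discriminant: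
  assumes "d \<in> family X"
  shows "fundamental_discriminant (int d)" "d \<le> X"
proof -
  have d: "squarefree d" "d mod 8 = 1" "d \<le> X"
    using assms by (auto simp: family_def squarefree_progression_def progression_def)
  have "squarefree (int d)"
    unfolding squarefree_def
  proof (intro allI impI)
    fix m :: int assume "m\<^sup>2 dvd int d"
    hence "(nat \<bar>m\<bar>)\<^sup>2 dvd d" by (simp add: nat_dvd_iff nat_power_eq[symmetric] flip: int_dvd_int_iff)
    hence "is_unit (nat \<bar>m\<bar>)" using d(1) unfolding squarefree_def by blast
    thus "is_unit m" by simp
  qed
  moreover have "d mod 4 = 1" using d(2) by presburger
  hence "int d mod 4 = 1" by presburger
  ultimately show "fundamental_discriminant (int d)" "d \<le> X"
    using d(3) by (simp_all add: fundamental_discriminant_def)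
qed

lemma fundamental_discriminant_moment_ge:
  assumes "even k" "X \<ge> 0"
  shows "(\<Sum>d | fundamental_discriminant d \<and> real_of_int \<bar>d\<bar> \<le> X. Re (L_kronecker d (1 / 2)) ^ k) \<ge>
    (\<Sum>d\<in>family (nat \<lfloor>X\<rfloor>). L_half d ^ k)"
proof -
  have "(\<Sum>d\<in>family (nat \<lfloor>X\<rfloor>). L_half d ^ k) = (\<Sum>d\<in>int ` family (nat \<lfloor>X\<rfloor>). Re (L_kronecker d (1 / 2)) ^ k)"
    by (subst sum.reindex) (auto simp: L_half_def)
  also have "\<dots> \<le> (\<Sum>d | fundamental_discriminant d \<and> real_of_int \<bar>d\<bar> \<le> X. Re (L_kronecker d (1 / 2)) ^ k)"
  proof (rule sum_mono2)
    have "{d. fundamental_discriminant d \<and> real_of_int \<bar>d\<bar> \<le> X} \<subseteq> {- \<lfloor>X\<rfloor>..\<lfloor>X\<rfloor>}"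
    proof
      fix d assume "d \<in> {d. fundamental_discriminant d \<and> real_of_int \<bar>d\<bar> \<le> X}"
      hence "\<bar>d\<bar> \<le> \<lfloor>X\<rfloor>" by (simp add: le_floor_iff)
      thus "d \<in> {- \<lfloor>X\<rfloor>..\<lfloor>X\<rfloor>}" by auto
    qed
    thus "finite {d. fundamental_discriminant d \<and> real_of_int \<bar>d\<bar> \<le> X}" by (rule finite_subset) simp
    show "int ` family (nat \<lfloor>X\<rfloor>) \<subseteq> {d. fundamental_discriminant d \<and> real_of_int \<bar>d\<bar> \<le> X}"
    proof
      fix d assume "d \<in> int ` family (nat \<lfloor>X\<rfloor>)"
      then obtain e where e: "d = int e" "e \<in> family (nat \<lfloor>X\<rfloor>)" by blast
      have "real e \<le> real (nat \<lfloor>X\<rfloor>)" using family_fundamental_discriminant(2)[OF e(2)] by (rule of_nat_mono)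
      also have "\<dots> \<le> X" using assms(2) by (rule of_nat_floor)
      finally show "d \<in> {d. fundamental_discriminant d \<and> real_of_int \<bar>d\<bar> \<le> X}"
        using family_fundamental_discriminant(1)[OF e(2)] e(1) by simp
    qed
  qed (use assms(1) zero_le_even_power in blast)
  finally show ?thesis .
qed

text \<open>For k = 0 the sum counts the family and the logarithm has exponent 0, so
  \<open>card_family_ge\<close> is enough.\<close>

lemma family_moment_ge:
  assumes "even k"
  shows "\<exists>c>0. \<forall>\<^sub>F X in sequentially. (\<Sum>d\<in>family X. L_half d ^ k) \<ge> c * real X * ln X ^ (k * (k + 1) div 2)"
proof (cases "k = 0")
  case True
  have "\<forall>\<^sub>F X in sequentially. (\<Sum>d\<in>family X. L_half d ^ k) \<ge> 1 / 64 * real X * ln X ^ (k * (k + 1) div 2)"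
    using eventually_ge_at_top[of "20000::nat"]
  proof eventually_elim
    case (elim X)
    thus ?case using card_family_ge[of X] True by simp
  qed
  thus ?thesis by (intro exI[of _ "1 / 64"]) simp
qed (use assms moment_lower_bound in blast)

theorem theorem2:
  fixes k :: nat
  assumes "even k"
  shows "\<exists>c>0. \<forall>\<^sub>F X :: real in at_top.
    (\<Sum>d | fundamental_discriminant d \<and> real_of_int \<bar>d\<bar> \<le> X. Re (L_kronecker d (1 / 2)) ^ k)
      \<ge> c * X * ln X ^ (k * (k + 1) div 2)"
proof -
  define N where "N = k * (k + 1) div 2"
  obtain c where c: "c > 0" and ev: "\<forall>\<^sub>F X in sequentially. (\<Sum>d\<in>family X. L_half d ^ k) \<ge> c * real X * ln X ^ N"
    using family_moment_ge[OF assms] unfolding N_def by blast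
  have "filterlim (\<lambda>X :: real. nat \<lfloor>X\<rfloor>) sequentially at_top"
    by (rule filterlim_compose[OF filterlim_nat_sequentially filterlim_floor_sequentially])
  hence "\<forall>\<^sub>F X :: real in at_top. (\<Sum>d\<in>family (nat \<lfloor>X\<rfloor>). L_half d ^ k) \<ge> c * real (nat \<lfloor>X\<rfloor>) * ln (nat \<lfloor>X\<rfloor>) ^ N"
    using ev by (rule eventually_compose_filterlim[rotated])
  hence "\<forall>\<^sub>F X :: real in at_top. (\<Sum>d | fundamental_discriminant d \<and> real_of_int \<bar>d\<bar> \<le> X. Re (L_kronecker d (1 / 2)) ^ k)
      \<ge> (c / 2 ^ Suc N) * X * ln X ^ N"
    using eventually_ge_at_top[of "4::real"]
  proof eventually_elim
    case (elim X)
    define B where "B = nat \<lfloor>X\<rfloor>"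
    have B: "X / 2 \<le> real B" using elim(2) unfolding B_def by linarith
    \<comment> \<open>Passing from real X to its floor B loses only constants: B >= X/2 >= sqrt X,
      so ln B >= ln(X)/2. Together this costs 2^(N+1).\<close>
    have "sqrt (2\<^sup>2) \<le> sqrt X" using elim(2) by (intro real_sqrt_le_mono) simp
    hence "2 * sqrt X \<le> sqrt X * sqrt X" using elim(2) by (intro mult_right_mono) auto
    moreover have "sqrt X * sqrt X = X" using elim(2) by simp
    ultimately have "sqrt X \<le> real B" using B by linarith
    moreover have "0 < sqrt X" using elim(2) by simp
    moreover have "0 < real B" using B elim(2) by linarith
    ultimately have "ln (sqrt X) \<le> ln (real B)" by (subst ln_le_cancel_iff) auto
    hence "ln X / 2 \<le> ln (real B)" using elim(2) by (simp add: ln_sqrt)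
    hence "(ln X / 2) ^ N \<le> ln (real B) ^ N" using elim(2) by (intro power_mono) auto
    hence "c * (X / 2) * (ln X / 2) ^ N \<le> c * real B * ln (real B) ^ N"
      using B c elim(2) by (intro mult_mono mult_left_mono) auto
    also have "\<dots> \<le> (\<Sum>d\<in>family B. L_half d ^ k)" using elim(1) by (simp only: B_def)
    also have "\<dots> \<le> (\<Sum>d | fundamental_discriminant d \<and> real_of_int \<bar>d\<bar> \<le> X. Re (L_kronecker d (1 / 2)) ^ k)"
      unfolding B_def using elim(2) by (intro fundamental_discriminant_moment_ge assms) simp
    finally show ?case by (simp add: power_divide)
  qed
  thus ?thesis using c unfolding N_def by (intro exI[of _ "c / 2 ^ Suc N"]) (simp add: N_def)
qed

end
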